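(* Let $f(\tau)=\prod_{n\mid N}\eta(n\tau)^{r_n}=\sum_{n\ge0}c_f(n)q^n$ be a weakly admissible eta-quotient of level $N$ and weight $k=\frac12\sum_nr_n$ with $\sum_{n\mid N}nr_n=0$. Let $\varpi=\prod_{n\mid N}(N/n)^{|r_n|}$ and $\delta=0$ (resp. $\delta=1$) if $\varpi=2^\alpha(4m+1)$ (resp. $2^\alpha(4m+3)$), $\alpha,m\in\mathbb{Z}_{\ge0}$. Let $l\in L_f$ be such that for every prime $p$, $p\nmid N$ implies $p^2\nmid l$, and suppose that at least one of $l,N$ is odd. Then $$c_f(l)=\begin{cases}-r_1\displaystyle\sum_{a\mid l,\,(a,N)=1}\Big(\frac a\varpi\Big)a^{k-1}&\text{if }2\mid l,\ 2\nmid N,\\[2mm]-r_1\displaystyle\sum_{a\mid l,\,(a,N)=1}\Big(\frac a\varpi\Big)a^{k-1}e\Big(\frac{(k+\delta)(l-l/a)}4\Big)&\text{if }2\nmid l.\end{cases}$$ In particular, if $\operatorname{rad}(l)\mid\operatorname{rad}(N)$, then $c_f(l)=-r_1$.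
   Context: $e(x)=\exp(2\pi ix)$, $q=e(\tau)$, $\eta(\tau)=q^{1/24}\prod(1-q^n)$, $r_n\in\mathbb{Z}$, level $N=\operatorname{lcm}\{n:r_n\ne0\}$; $r_1$ is the exponent of $\eta(\tau)$. $\widetilde{\Gamma_0(N)}$: pairs $(\gamma,\varepsilon(c\tau+d)^{1/2})$, $\gamma=\begin{pmatrix}a&b\\c&d\end{pmatrix}\in\Gamma_0(N)$, $\varepsilon=\pm1$, principal square root, product $(\gamma_1,\phi_1)(\gamma_2,\phi_2)=(\gamma_1\gamma_2,\phi_1(\gamma_2\tau)\phi_2(\tau))$; $(g|_k(\gamma,\phi))(\tau)=\phi(\tau)^{-2k}g(\gamma\tau)$, $\widetilde\gamma=(\gamma,(c\tau+d)^{1/2})$. Character of $f$: $\chi(\gamma,\varepsilon(c\tau+d)^{1/2})=\varepsilon^{-2k}e(\frac1{24}\sum r_n\Psi\begin{pmatrix}a&bn\\c/n&d\end{pmatrix})$ with $\Psi\begin{pmatrix}a&b\\c&d\end{pmatrix}=\frac{a+d}c+12s(-d,c)-3$ ($c>0$), $\frac{a+d}c+12s(d,-c)+3$ ($c<0$), $b$ ($c=0,a>0$), $-b-6$ ($c=0,a<0$), Dedekind sum $s$. $M_k,S_k$ as usual (holomorphic $g$ with $g|_k\gamma=\chi(\gamma)g$ and all $q$-expansions at cusps having only nonnegative, resp. positive, exponents). Weakly admissible: $f\in M_k(\Gamma_0(N),\chi)$ and either $\dim M_k(\Gamma_0(N),\chi)=1$ or ($\dim M_k\ge2$, $\dim S_k(\Gamma_0(N),\chi)=1$,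 $f$ cusp form). $m_f=24/\gcd(24,\sum(N/n)r_n,\sum nr_n)$; $L_f=\{l\ge1:l\equiv1\bmod m_f\}$ if $k\in\mathbb{Z}$, additionally $l$ a perfect square if $k\in\frac12+\mathbb{Z}$. $(\frac a\varpi)$: Kronecker–Jacobi symbol; $\operatorname{rad}$ = product of distinct prime divisors. *)

theory Defs
  imports "HOL-Analysis.Analysis" "HOL-Number_Theory.Number_Theory" "HOL-Library.Function_Algebras"
begin

definition upper :: "complex set" where
  "upper = {\<tau>. Im \<tau> > 0}"

definition ee :: "complex \<Rightarrow> complex" where
  "ee z = exp (2 * of_real pi * \<i> * z)"

definition eta :: "complex \<Rightarrow> complex" where
  "eta \<tau> = ee (\<tau> / 24) * (\<Prod>n. (1 - ee \<tau> ^ Suc n))"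

definition eta_quotient :: "(nat \<Rightarrow> int) \<Rightarrow> nat \<Rightarrow> complex \<Rightarrow> complex" where
  "eta_quotient r N \<tau> = (\<Prod>n\<in>{n. n dvd N}. eta (of_nat n * \<tau>) powi r n)"

text \<open>Coefficients c_f(n) of the q-expansion f = sum c_f(n) q^n (valid when sum n r_n = 0)\<close>
definition eta_coeff :: "(nat \<Rightarrow> int) \<Rightarrow> nat \<Rightarrow> nat \<Rightarrow> complex" where
  "eta_coeff r N = (THE c. \<forall>\<tau>\<in>upper. (\<lambda>n. c n * ee \<tau> ^ n) sums eta_quotient r N \<tau>)"

text \<open>twice the weight: 2k = sum r_n\<close>
definition wt2 :: "(nat \<Rightarrow> int) \<Rightarrow> nat \<Rightarrow> int" where
  "wt2 r N = (\<Sum>n\<in>{n. n dvd N}. r n)"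

type_synonym mat2 = "int \<times> int \<times> int \<times> int"

definition Gamma0 :: "nat \<Rightarrow> mat2 set" where
  "Gamma0 N = {(a, b, c, d). a * d - b * c = 1 \<and> int N dvd c}"

definition moeb :: "mat2 \<Rightarrow> complex \<Rightarrow> complex" where
  "moeb \<gamma> \<tau> = (case \<gamma> of (a, b, c, d) \<Rightarrow>
      (of_int a * \<tau> + of_int b) / (of_int c * \<tau> + of_int d))"

text \<open>(g |_k (gamma, eps (c tau + d)^(1/2)))(tau) = (eps sqrt(c tau+d))^(-2k) g(gamma tau),
  principal square root; w = 2k\<close>
definition slash :: "int \<Rightarrow> mat2 \<Rightarrow> int \<Rightarrow> (complex \<Rightarrow> complex) \<Rightarrow> complex \<Rightarrow> complex" where
  "slash w \<gamma> \<epsilon> g \<tau> = (case \<gamma> of (a, b, c, d) \<Rightarrow>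
      (of_int \<epsilon> * csqrt (of_int c * \<tau> + of_int d)) powi (- w) * g (moeb \<gamma> \<tau>))"

definition sawtooth :: "real \<Rightarrow> real" where
  "sawtooth x = (if x \<in> \<int> then 0 else x - of_int \<lfloor>x\<rfloor> - 1 / 2)"

definition dedekind_sum :: "int \<Rightarrow> int \<Rightarrow> real" where
  "dedekind_sum h k = (\<Sum>r\<in>{1..k - 1}. sawtooth (of_int r / of_int k) * sawtooth (of_int (h * r) / of_int k))"

definition Psi :: "mat2 \<Rightarrow> real" where
  "Psi \<gamma> = (case \<gamma> of (a, b, c, d) \<Rightarrow>
     (if c > 0 then (of_int (a + d)) / of_int c + 12 * dedekind_sum (- d) c - 3
      else if c < 0 then (of_int (a + d)) / of_int c + 12 * dedekind_sum d (- c) + 3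
      else if a > 0 then of_int b
      else of_int (- b - 6)))"

text \<open>character chi(gamma, eps (c tau+d)^(1/2)) of the eta-quotient\<close>
definition eta_char :: "(nat \<Rightarrow> int) \<Rightarrow> nat \<Rightarrow> mat2 \<Rightarrow> int \<Rightarrow> complex" where
  "eta_char r N \<gamma> \<epsilon> = (case \<gamma> of (a, b, c, d) \<Rightarrow>
     of_int \<epsilon> powi (- wt2 r N) *
     ee (of_real ((1 / 24) * (\<Sum>n\<in>{n. n dvd N}.
            of_int (r n) * Psi (a, b * int n, c div int n, d)))))"

definition qexp_nonneg :: "(complex \<Rightarrow> complex) \<Rightarrow> bool" where
  "qexp_nonneg g \<longleftrightarrow> (\<exists>h::real. \<exists>\<kappa>::real. \<exists>c::nat \<Rightarrow> complex. h > 0 \<and> \<kappa> \<ge> 0 \<and>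
      (\<forall>\<tau>\<in>upper. (\<lambda>n. c n * ee (of_real ((of_nat n + \<kappa>) / h) * \<tau>)) sums g \<tau>))"

definition qexp_pos :: "(complex \<Rightarrow> complex) \<Rightarrow> bool" where
  "qexp_pos g \<longleftrightarrow> (\<exists>h::real. \<exists>\<kappa>::real. \<exists>c::nat \<Rightarrow> complex. h > 0 \<and> \<kappa> \<ge> 0 \<and>
      (\<forall>n. c n \<noteq> 0 \<longrightarrow> of_nat n + \<kappa> > 0) \<and>
      (\<forall>\<tau>\<in>upper. (\<lambda>n. c n * ee (of_real ((of_nat n + \<kappa>) / h) * \<tau>)) sums g \<tau>))"

text \<open>Functions are normalised to vanish off the upper half plane so that the spaces
  are genuine spaces of functions on H.\<close>
definition on_upper :: "(complex \<Rightarrow> complex) \<Rightarrow> complex \<Rightarrow> complex" where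
  "on_upper g \<tau> = (if \<tau> \<in> upper then g \<tau> else 0)"

definition modular_invariant :: "int \<Rightarrow> nat \<Rightarrow> (mat2 \<Rightarrow> int \<Rightarrow> complex) \<Rightarrow> (complex \<Rightarrow> complex) \<Rightarrow> bool" where
  "modular_invariant w N chi g \<longleftrightarrow> g holomorphic_on upper \<and> (\<forall>\<tau>. \<tau> \<notin> upper \<longrightarrow> g \<tau> = 0) \<and>
     (\<forall>\<gamma>\<in>Gamma0 N. \<forall>\<epsilon>\<in>{1, -1}. \<forall>\<tau>\<in>upper. slash w \<gamma> \<epsilon> g \<tau> = chi \<gamma> \<epsilon> * g \<tau>)"

definition Mk :: "int \<Rightarrow> nat \<Rightarrow> (mat2 \<Rightarrow> int \<Rightarrow> complex) \<Rightarrow> (complex \<Rightarrow> complex) set" where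
  "Mk w N chi = {g. modular_invariant w N chi g \<and> (\<forall>\<sigma>\<in>Gamma0 1. qexp_nonneg (slash w \<sigma> 1 g))}"

definition Sk :: "int \<Rightarrow> nat \<Rightarrow> (mat2 \<Rightarrow> int \<Rightarrow> complex) \<Rightarrow> (complex \<Rightarrow> complex) set" where
  "Sk w N chi = {g. modular_invariant w N chi g \<and> (\<forall>\<sigma>\<in>Gamma0 1. qexp_pos (slash w \<sigma> 1 g))}"

definition cdim :: "(complex \<Rightarrow> complex) set \<Rightarrow> nat" where
  "cdim V = vector_space.dim (\<lambda>c (f :: complex \<Rightarrow> complex) x. c * f x) V"

definition weakly_admissible :: "(nat \<Rightarrow> int) \<Rightarrow> nat \<Rightarrow> bool" where
  "weakly_admissible r N \<longleftrightarrow>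
     (let w = wt2 r N; chi = eta_char r N; f = on_upper (eta_quotient r N) in
       f \<in> Mk w N chi \<and>
       (cdim (Mk w N chi) = 1 \<or>
        (cdim (Mk w N chi) \<ge> 2 \<and> cdim (Sk w N chi) = 1 \<and> f \<in> Sk w N chi)))"

definition m_f :: "(nat \<Rightarrow> int) \<Rightarrow> nat \<Rightarrow> int" where
  "m_f r N = 24 div gcd 24 (gcd (\<Sum>n\<in>{n. n dvd N}. int (N div n) * r n)
                                 (\<Sum>n\<in>{n. n dvd N}. int n * r n))"

definition L_f :: "(nat \<Rightarrow> int) \<Rightarrow> nat \<Rightarrow> nat set" where
  "L_f r N = {l. l \<ge> 1 \<and> [int l = 1] (mod m_f r N) \<and>
                (odd (wt2 r N) \<longrightarrow> (\<exists>t. l = t ^ 2))}"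

definition kronecker_prime :: "int \<Rightarrow> nat \<Rightarrow> int" where
  "kronecker_prime a p = (if p = 2 then
        (if even a then 0 else if a mod 8 \<in> {1, 7} then 1 else -1)
      else Legendre a (int p))"

definition kronecker :: "int \<Rightarrow> nat \<Rightarrow> int" where
  "kronecker a n = (\<Prod>p\<in>prime_factors n. kronecker_prime a p ^ multiplicity p n)"

definition rad :: "nat \<Rightarrow> nat" where
  "rad n = \<Prod>(prime_factors n)"

definition varpi :: "(nat \<Rightarrow> int) \<Rightarrow> nat \<Rightarrow> nat" where
  "varpi r N = (\<Prod>n\<in>{n. n dvd N}. (N div n) ^ nat \<bar>r n\<bar>)"

definition delta_of :: "nat \<Rightarrow> nat" where
  "delta_of v = (if (v div 2 ^ multiplicity 2 v) mod 4 = 1 then 0 else 1)"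

end

theory Submission
  imports Defs "HOL-Complex_Analysis.Complex_Analysis"
begin

text \<open>
  The condition \<open>\<Sum> n r\<^sub>n = 0\<close> gives \<open>f = 1 - r\<^sub>1 q + \<dots>\<close>, so \<open>f\<close> is not a cusp form and weak admissibility forces
  \<open>M\<^sub>k(\<Gamma>\<^sub>0(N), \<chi>)\<close> to be the line spanned by \<open>f\<close>. Hence \<open>f\<close> is an eigenfunction of every Hecke operator that
  preserves this space, and comparing the coefficients of \<open>1\<close> and \<open>q\<close> in
  \<open>T\<^sub>l f = l\<^sup>-\<^sup>1 \<Sum> \<psi>(a) a\<^sup>k f((a\<tau> + b)/d)\<close>, summed over \<open>ad = l\<close>, \<open>(a, N) = 1\<close>, \<open>b mod d\<close>, yields the formula.

  That \<open>T\<^sub>l\<close> preserves \<open>\<chi>\<close> requires \<open>\<chi>\<close> explicitly. Dedekind reciprocity turns \<open>\<Psi>\<close> into \<open>(b - c)/d + 12 s(c, d)\<close>,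
  and \<open>12 d s(c, d)\<close> is known modulo 3 and, through the Jacobi symbol, modulo 8; this evaluates \<open>\<chi>\<close> at all
  matrices with \<open>c > 0\<close> and \<open>d > 0\<close> prime to 6. It suffices to treat these with \<open>c/N\<close> odd, because \<open>T\<^sub>l f / f\<close> is a
  function of weight 0 and they generate \<open>\<Gamma>\<^sub>0(N)\<close> together with the translations.
\<close>

section \<open>Dedekind sums\<close>

definition dedekind_num :: "int \<Rightarrow> int \<Rightarrow> int" where
  "dedekind_num h k = 2 * h * (k - 1) * (2 * k - 1) - 12 * (\<Sum>r\<in>{1..<k}. r * (h * r div k)) - 3 * k * (k - 1)"

lemma coprime_if_det_1:
  fixes a b c d :: int
  assumes "a * d - b * c = 1"
  shows "coprime c d"
proof (rule coprimeI)
  fix x assume "x dvd c" "x dvd d"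
  then have "x dvd a * d - b * c" by (intro dvd_diff dvd_mult) auto
  then show "is_unit x" using assms by simp
qed

lemma bij_betw_if_inj_on_endo:
  assumes "finite A" "inj_on f A" "f ` A \<subseteq> A"
  shows "bij_betw f A A"
  using assms by (simp add: bij_betw_def endo_inj_surj)

lemma le_div_iff_mult_le_int:
  fixes k :: int
  assumes "k > 0"
  shows "v \<le> x div k \<longleftrightarrow> v * k \<le> x"
proof -
  have "v \<le> x div k \<longleftrightarrow> of_int v \<le> (of_int x / of_int k :: real)"
    unfolding floor_divide_of_int_eq[where 'a = real, symmetric] by (rule le_floor_iff)
  also have "\<dots> \<longleftrightarrow> real_of_int (v * k) \<le> of_int x" using assms by (simp add: le_divide_eq)
  finally show ?thesis by (simp only: of_int_le_iff)
qed

lemma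
  fixes k :: int
  assumes "k > 0"
  shows sum_remainders: "2 * (\<Sum>r\<in>{1..<k}. r) = k * (k - 1)"
    and sum_square_remainders: "6 * (\<Sum>r\<in>{1..<k}. r * r) = (k - 1) * k * (2 * k - 1)"
proof -
  have "2 * (\<Sum>r\<in>{1..<k}. r) = k * (k - 1) \<and> 6 * (\<Sum>r\<in>{1..<k}. r * r) = (k - 1) * k * (2 * k - 1)"
    using assms
  proof (induction k rule: int_gr_induct)
    case (step k)
    then have "{1..<k + 1} = insert k {1..<k}" by auto
    with step(2) show ?case by (simp add: algebra_simps)
  qed simp
  then show "2 * (\<Sum>r\<in>{1..<k}. r) = k * (k - 1)"
    "6 * (\<Sum>r\<in>{1..<k}. r * r) = (k - 1) * k * (2 * k - 1)" by auto
qed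

lemma not_dvd_mult_remainder:
  fixes h k :: int
  assumes "coprime h k" "r \<in> {1..<k}"
  shows "\<not> k dvd h * r"
  using assms by (auto simp: coprime_commute coprime_dvd_mult_right_iff dest: zdvd_imp_le)

lemma minus_div_eq_if_not_dvd:
  fixes k x :: int
  assumes "\<not> k dvd x" "k > 0"
  shows "(- x) div k = - (x div k) - 1"
  using assms by (simp add: zdiv_zminus1_eq_if dvd_eq_mod_eq_0)

lemma sum_div_remainders:
  fixes h k :: int
  assumes "coprime h k" "k > 0"
  shows "2 * (\<Sum>r\<in>{1..<k}. h * r div k) = (h - 1) * (k - 1)"
proof -
  have reflect: "h * (k - r) div k = h - 1 - h * r div k" if "r \<in> {1..<k}" for r
  proof -
    have "h * (k - r) = - (h * r) + h * k" by (simp add: algebra_simps)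
    then have "h * (k - r) div k = (- (h * r)) div k + h" using assms(2) by (simp only: div_mult_self1)
    then show ?thesis
      using minus_div_eq_if_not_dvd[OF not_dvd_mult_remainder[OF assms(1) that] assms(2)] by simp
  qed
  have "bij_betw (\<lambda>r. k - r) {1..<k} {1..<k}" by (rule bij_betwI[where g = "\<lambda>r. k - r"]) auto
  then have "(\<Sum>r\<in>{1..<k}. h * r div k) = (\<Sum>r\<in>{1..<k}. h * (k - r) div k)"
    by (rule sum.reindex_bij_betw[symmetric])
  also have "\<dots> = (\<Sum>r\<in>{1..<k}. h - 1 - h * r div k)" using reflect by (rule sum.cong[OF refl])
  finally show ?thesis using assms(2) by (simp only: sum_subtractf) (simp add: algebra_simps)
qed

lemma sawtooth_divide:
  fixes k m :: int
  assumes "\<not> k dvd m" "k > 0"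
  shows "sawtooth (of_int m / of_int k) = of_int m / of_int k - of_int (m div k) - 1 / 2"
proof -
  have "of_int m / of_int k \<notin> (\<int> :: real set)" using assms by (subst of_int_div_of_int_in_Ints_iff) auto
  then show ?thesis by (simp add: sawtooth_def floor_divide_of_int_eq)
qed

lemma dedekind_sum_eq_dedekind_num:
  assumes "coprime h k" "k > 0"
  shows "12 * of_int k * dedekind_sum h k = of_int (dedekind_num h k)"
proof -
  define q where "q = (\<lambda>r. h * r div k)"
  define H K :: real where "H = of_int h" and "K = of_int k"
  have K: "K > 0" using assms(2) by (simp add: K_def)
  have interval: "{1..k - 1} = {1..<k}" by auto
  have term_eq: "K\<^sup>2 * (sawtooth (of_int r / of_int k) * sawtooth (of_int (h * r) / of_int k)) =
      H * of_int (r * r) - K * of_int (r * q r) - K * (1 + H) / 2 * of_int r + K\<^sup>2 / 2 * of_int (q r) + K\<^sup>2 / 4"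
    if r: "r \<in> {1..<k}" for r
  proof -
    have saw_r: "sawtooth (of_int r / of_int k) = of_int r / K - 1 / 2"
      using sawtooth_divide[of k r] not_dvd_mult_remainder[of 1 k r] r by (simp add: K_def)
    have saw_hr: "sawtooth (of_int (h * r) / of_int k) = H * of_int r / K - of_int (q r) - 1 / 2"
      using sawtooth_divide[OF not_dvd_mult_remainder[OF assms(1) r] assms(2)] by (simp add: H_def K_def q_def)
    show ?thesis unfolding saw_r saw_hr using K by (simp add: field_simps power2_eq_square)
  qed
  have sums: "(\<Sum>r\<in>{1..<k}. of_int r) = K * (K - 1) / 2"
    "(\<Sum>r\<in>{1..<k}. of_int (r * r)) = (K - 1) * K * (2 * K - 1) / 6"
    "(\<Sum>r\<in>{1..<k}. of_int (q r)) = (H - 1) * (K - 1) / 2"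
    unfolding of_int_sum[symmetric]
    using sum_remainders[OF assms(2), THEN arg_cong[where f = real_of_int]]
      sum_square_remainders[OF assms(2), THEN arg_cong[where f = real_of_int]]
      sum_div_remainders[OF assms, THEN arg_cong[where f = real_of_int]]
    by (simp_all add: H_def K_def q_def field_simps)
  have "K\<^sup>2 * dedekind_sum h k = (\<Sum>r\<in>{1..<k}. H * of_int (r * r) - K * of_int (r * q r)
      - K * (1 + H) / 2 * of_int r + K\<^sup>2 / 2 * of_int (q r) + K\<^sup>2 / 4)"
    unfolding dedekind_sum_def interval sum_distrib_left using term_eq by (rule sum.cong[OF refl])
  also have "\<dots> = H * ((K - 1) * K * (2 * K - 1) / 6) - K * of_int (\<Sum>r\<in>{1..<k}. r * q r)
      - K * (1 + H) / 2 * (K * (K - 1) / 2) + K\<^sup>2 / 2 * ((H - 1) * (K - 1) / 2) + (K - 1) * K\<^sup>2 / 4"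
    unfolding sum.distrib sum_subtractf sum_distrib_left[symmetric] sums using assms(2) by (simp add: K_def)
  finally have "K * (12 * K * dedekind_sum h k) = K * of_int (dedekind_num h k)"
    unfolding dedekind_num_def
    by (simp add: q_def H_def[symmetric] K_def[symmetric] field_simps power2_eq_square)
  then show ?thesis using K by (simp add: K_def)
qed

lemma sum_triangular_div_remainders:
  fixes h k :: int
  assumes "coprime h k" "h > 0" "k > 0"
  shows "(\<Sum>r\<in>{1..<k}. \<Sum>v\<in>{1..h * r div k}. v) = (\<Sum>v\<in>{1..<h}. v * (k - 1 - k * v div h))"
proof -
  have le_iff: "v \<le> h * r div k \<longleftrightarrow> k * v div h < r" if "v \<in> {1..<h}" for v r
  proof -
    have "v \<le> h * r div k \<longleftrightarrow> k * v \<le> h * r"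
      using le_div_iff_mult_le_int[OF assms(3)] by (simp add: mult.commute)
    also have "\<dots> \<longleftrightarrow> k * v < r * h"
      using not_dvd_mult_remainder[of k h v] assms(1) that
      by (metis coprime_commute dvd_triv_left mult.commute order_le_less)
    also have "\<dots> \<longleftrightarrow> k * v div h < r" using le_div_iff_mult_le_int[OF assms(2), of r "k * v"] by linarith
    finally show ?thesis .
  qed
  have "{1..h * r div k} = {v \<in> {1..<h}. v \<le> h * r div k}" if "r \<in> {1..<k}" for r
    using le_div_iff_mult_le_int[OF assms(3), of h "h * r"] that assms(2) by auto
  then have "(\<Sum>r\<in>{1..<k}. \<Sum>v\<in>{1..h * r div k}. v) = (\<Sum>r\<in>{1..<k}. \<Sum>v | v \<in> {1..<h} \<and> v \<le> h * r div k. v)"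
    by (intro sum.cong) auto
  also have "\<dots> = (\<Sum>v\<in>{1..<h}. \<Sum>r | r \<in> {1..<k} \<and> v \<le> h * r div k. v)"
    by (rule sum.swap_restrict) auto
  also have "\<dots> = (\<Sum>v\<in>{1..<h}. v * (k - 1 - k * v div h))"
  proof (rule sum.cong[OF refl])
    fix v assume v: "v \<in> {1..<h}"
    have "0 \<le> k * v div h" using assms v by (simp add: pos_imp_zdiv_nonneg_iff)
    then have "{r. r \<in> {1..<k} \<and> v \<le> h * r div k} = {k * v div h + 1..<k}"
      unfolding le_iff[OF v] by auto
    moreover have "k * v div h < k"
      using le_div_iff_mult_le_int[OF assms(2), of k "k * v"] v assms(3) by auto
    ultimately show "(\<Sum>r | r \<in> {1..<k} \<and> v \<le> h * r div k. v) = v * (k - 1 - k * v div h)" by simp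
  qed
  finally show ?thesis .
qed

lemma sum_square_div_remainders:
  fixes h k :: int
  assumes "coprime h k" "h > 0" "k > 0"
  defines "q \<equiv> \<lambda>r. h * r div k"
  shows "2 * (\<Sum>r\<in>{1..<k}. q r * q r) = 2 * (k - 1) * h * (h - 1) - 4 * (\<Sum>v\<in>{1..<h}. v * (k * v div h)) - (h - 1) * (k - 1)"
proof -
  have q_nonneg: "q r \<ge> 0" if "r \<in> {1..<k}" for r
    using assms that by (simp add: pos_imp_zdiv_nonneg_iff)
  have triangular: "2 * (\<Sum>v\<in>{1..m}. v) = m * m + m" if "m \<ge> 0" for m :: int
    using sum_remainders[of "m + 1"] that
    by (simp only: atLeastLessThanPlusOne_atLeastAtMost_int) (simp add: algebra_simps)
  have "(\<Sum>r\<in>{1..<k}. q r * q r) + (\<Sum>r\<in>{1..<k}. q r) = (\<Sum>r\<in>{1..<k}. 2 * (\<Sum>v\<in>{1..q r}. v))"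
    unfolding sum.distrib[symmetric] using triangular[OF q_nonneg] by (intro sum.cong) auto
  also have "\<dots> = 2 * (\<Sum>v\<in>{1..<h}. (k - 1) * v - v * (k * v div h))"
    unfolding sum_distrib_left[symmetric] q_def sum_triangular_div_remainders[OF assms(1-3)]
    by (simp add: algebra_simps)
  also have "\<dots> = (k - 1) * (h * (h - 1)) - 2 * (\<Sum>v\<in>{1..<h}. v * (k * v div h))"
    unfolding sum_subtractf sum_distrib_left[symmetric] sum_remainders[OF assms(2), symmetric]
    by (simp add: algebra_simps)
  finally show ?thesis
    using sum_div_remainders[OF assms(1,3)] unfolding q_def by (simp add: algebra_simps)
qed

lemma sum_square_mult_remainders:
  fixes h k :: int
  assumes "coprime h k"
  defines "q \<equiv> \<lambda>r. h * r div k"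
  shows "2 * h * k * (\<Sum>r\<in>{1..<k}. r * q r) = (h * h - 1) * (\<Sum>r\<in>{1..<k}. r * r) + k * k * (\<Sum>r\<in>{1..<k}. q r * q r)"
proof -
  have "(\<Sum>r\<in>{1..<k}. r * r) = (\<Sum>r\<in>{1..<k}. (h * r mod k) * (h * r mod k))"
    using sum.reindex_bij_betw[OF bij_betw_int_remainders_mult[OF assms(1)], of "\<lambda>r. r * r"] by simp
  also have "\<dots> = (\<Sum>r\<in>{1..<k}. h * h * (r * r) - 2 * h * k * (r * q r) + k * k * (q r * q r))"
    unfolding q_def by (intro sum.cong refl) (simp add: minus_div_mult_eq_mod[symmetric] algebra_simps)
  also have "\<dots> = h * h * (\<Sum>r\<in>{1..<k}. r * r) - 2 * h * k * (\<Sum>r\<in>{1..<k}. r * q r)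
      + k * k * (\<Sum>r\<in>{1..<k}. q r * q r)"
    by (simp only: sum.distrib sum_subtractf sum_distrib_left)
  finally show ?thesis by (simp add: algebra_simps)
qed

lemma dedekind_num_reciprocity:
  assumes "coprime h k" "h > 0" "k > 0"
  shows "h * dedekind_num h k + k * dedekind_num k h = h\<^sup>2 + k\<^sup>2 + 1 - 3 * h * k"
proof -
  define A B R Q where "A = (\<Sum>r\<in>{1..<k}. r * (h * r div k))" and "B = (\<Sum>v\<in>{1..<h}. v * (k * v div h))"
    and "R = (\<Sum>r\<in>{1..<k}. r * r)" and "Q = (\<Sum>r\<in>{1..<k}. (h * r div k) * (h * r div k))"
  have Q: "2 * Q = 2 * (k - 1) * h * (h - 1) - 4 * B - (h - 1) * (k - 1)"
    unfolding Q_def B_def by (rule sum_square_div_remainders[OF assms])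
  have "12 * h * k * A = (h * h - 1) * (6 * R) + k * k * (3 * (2 * Q))"
    using sum_square_mult_remainders[OF assms(1), folded A_def R_def Q_def] by (simp add: algebra_simps)
  also have "6 * R = (k - 1) * k * (2 * k - 1)" unfolding R_def by (rule sum_square_remainders[OF assms(3)])
  finally have "12 * h * k * A + 12 * k * k * B = (h * h - 1) * ((k - 1) * k * (2 * k - 1))
      + k * k * (6 * (k - 1) * h * (h - 1) - 3 * (h - 1) * (k - 1))"
    unfolding Q by (simp add: algebra_simps)
  then have "k * (h * dedekind_num h k + k * dedekind_num k h) = k * (h\<^sup>2 + k\<^sup>2 + 1 - 3 * h * k)"
    unfolding dedekind_num_def A_def[symmetric] B_def[symmetric] by (simp add: algebra_simps power2_eq_square)
  then show ?thesis using assms(3) by simp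
qed

lemma dedekind_num_minus:
  assumes "coprime h k" "k > 0"
  shows "dedekind_num (- h) k = - dedekind_num h k"
proof -
  have "- h * r div k = - (h * r div k) - 1" if "r \<in> {1..<k}" for r
    using minus_div_eq_if_not_dvd[OF not_dvd_mult_remainder[OF assms(1) that] assms(2)] by simp
  then have "(\<Sum>r\<in>{1..<k}. r * (- h * r div k)) = (\<Sum>r\<in>{1..<k}. - (r * (h * r div k)) - r)"
    by (intro sum.cong refl) (simp only: right_diff_distrib mult_minus_right mult_1_right)
  then have "2 * (\<Sum>r\<in>{1..<k}. r * (- h * r div k)) = - 2 * (\<Sum>r\<in>{1..<k}. r * (h * r div k)) - k * (k - 1)"
    using sum_remainders[OF assms(2)] by (simp only: sum_subtractf sum_negf) simp
  then show ?thesis unfolding dedekind_num_def by (simp add: algebra_simps)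
qed

lemma three_dvd_dedekind_num:
  assumes "\<not> 3 dvd k"
  shows "3 dvd dedekind_num h k"
proof -
  have "3 dvd k - 1 \<or> 3 dvd 2 * k - 1" using assms by presburger
  then have "3 dvd 2 * h * (k - 1) * (2 * k - 1)" by auto
  then show ?thesis unfolding dedekind_num_def by (intro dvd_diff) (auto simp: mult.assoc)
qed

section \<open>The Jacobi and Kronecker symbols\<close>

definition parity_sign :: "int \<Rightarrow> int \<Rightarrow> int" where
  "parity_sign k x = (if even (x mod k) then 1 else -1)"

definition even_representative :: "int \<Rightarrow> int \<Rightarrow> int" where
  "even_representative k x = (if even (x mod k) then x mod k else k - x mod k)"

definition even_remainders :: "int \<Rightarrow> int set" where
  "even_remainders k = {r \<in> {1..<k}. even r}"

text \<open>By Eisenstein's form of Gauss' lemma this is the Jacobi symbol of \<open>h\<close> over the odd number \<open>k\<close>.\<close>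
definition jacobi :: "int \<Rightarrow> int \<Rightarrow> int" where
  "jacobi h k = (\<Prod>r\<in>even_remainders k. parity_sign k (h * r))"

lemma finite_even_remainders [simp]: "finite (even_remainders k)"
  unfolding even_remainders_def by (rule finite_subset[of _ "{1..<k}"]) auto

lemma prod_eq_1_or_minus_1:
  fixes f :: "'a \<Rightarrow> int"
  assumes "\<And>x. x \<in> A \<Longrightarrow> f x = 1 \<or> f x = -1"
  shows "prod f A = 1 \<or> prod f A = -1"
  using assms by (induction A rule: infinite_finite_induct) force+

lemma jacobi_values: "jacobi h k = 1 \<or> jacobi h k = -1"
  unfolding jacobi_def by (rule prod_eq_1_or_minus_1) (simp add: parity_sign_def)

lemma parity_sign_cong: "[x = y] (mod k) \<Longrightarrow> parity_sign k x = parity_sign k y"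
  by (simp add: parity_sign_def cong_def)

lemma parity_sign_mult_sign:
  assumes "\<not> k dvd x" "odd k" "\<epsilon> = 1 \<or> \<epsilon> = -1"
  shows "parity_sign k (\<epsilon> * x) = \<epsilon> * parity_sign k x"
proof -
  have "(- x) mod k = k - x mod k" using assms(1) by (simp only: zmod_zminus1_eq_if mod_eq_0_iff_dvd if_False)
  then show ?thesis using assms(2,3) by (auto simp: parity_sign_def)
qed

lemma cong_even_representative: "[even_representative k x = parity_sign k x * x] (mod k)"
  by (simp add: even_representative_def parity_sign_def cong_def mod_simps)

lemma jacobi_cong: "[h = h'] (mod k) \<Longrightarrow> jacobi h k = jacobi h' k"
  unfolding jacobi_def by (intro prod.cong refl parity_sign_cong cong_scalar_right)

lemma jacobi_1_left: "jacobi 1 k = 1"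
  unfolding jacobi_def by (intro prod.neutral ballI) (simp add: parity_sign_def even_remainders_def)

lemma even_remainders_eq_if_cong_sign:
  assumes "x \<in> even_remainders k" "y \<in> even_remainders k" "odd k" "k dvd x - y \<or> k dvd x + y"
  shows "x = y"
  using assms(4)
proof
  assume "k dvd x - y"
  then have "x mod k = y mod k" by (simp add: mod_eq_dvd_iff)
  then show ?thesis using assms(1,2) by (simp add: even_remainders_def)
next
  assume "k dvd x + y"
  moreover have "even (x + y)" using assms(1,2) by (simp add: even_remainders_def)
  moreover have "coprime 2 k" using assms(3) by simp
  ultimately have "2 * k dvd x + y" by (intro divides_mult)
  then show ?thesis using assms(1,2) by (auto simp: even_remainders_def dest: zdvd_imp_le)
qed

lemma bij_betw_even_representative:
  assumes "coprime g k" "odd k"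
  shows "bij_betw (\<lambda>r. even_representative k (g * r)) (even_remainders k) (even_remainders k)"
proof (rule bij_betw_if_inj_on_endo[OF finite_even_remainders])
  show "(\<lambda>r. even_representative k (g * r)) ` even_remainders k \<subseteq> even_remainders k"
  proof (rule image_subsetI)
    fix r assume r: "r \<in> even_remainders k"
    then have "k > 0" "g * r mod k \<noteq> 0"
      using not_dvd_mult_remainder[OF assms(1), of r] by (auto simp: even_remainders_def dvd_eq_mod_eq_0)
    moreover from this have "0 \<le> g * r mod k" "g * r mod k < k" by simp_all
    ultimately show "even_representative k (g * r) \<in> even_remainders k"
      using assms(2) by (auto simp: even_representative_def even_remainders_def)
  qed
  show "inj_on (\<lambda>r. even_representative k (g * r)) (even_remainders k)"
  proof (rule inj_onI)
    fix x y
    assume xy: "x \<in> even_remainders k" "y \<in> even_remainders k"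
      and eq: "even_representative k (g * x) = even_representative k (g * y)"
    define s t where "s = parity_sign k (g * x)" and "t = parity_sign k (g * y)"
    have st: "s = 1 \<or> s = -1" "t = 1 \<or> t = -1" by (simp_all add: s_def t_def parity_sign_def)
    have "[s * (g * x) = t * (g * y)] (mod k)"
      unfolding s_def t_def using cong_even_representative eq by (metis cong_sym cong_trans)
    then have "[g * (s * x) = g * (t * y)] (mod k)" by (simp add: algebra_simps)
    then have "[s * x = t * y] (mod k)" using assms(1) by (simp only: cong_mult_lcancel)
    then have "[s * (s * x) = s * (t * y)] (mod k)" by (rule cong_scalar_left)
    then have "[x = y] (mod k) \<or> [x = - y] (mod k)" using st by (elim disjE) simp_all
    then have "k dvd x - y \<or> k dvd x + y" by (simp add: cong_iff_dvd_diff)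
    then show "x = y" by (rule even_remainders_eq_if_cong_sign[OF xy assms(2)])
  qed
qed

lemma jacobi_mult_left:
  assumes "coprime h k" "coprime g k" "odd k"
  shows "jacobi (h * g) k = jacobi h k * jacobi g k"
proof -
  let ?e = "\<lambda>r. even_representative k (g * r)"
  note bij = bij_betw_even_representative[OF assms(2,3)]
  have "parity_sign k (h * g * r) = parity_sign k (h * ?e r) * parity_sign k (g * r)"
    if r: "r \<in> even_remainders k" for r
  proof -
    define s where "s = parity_sign k (g * r)"
    have s: "s = 1 \<or> s = -1" by (simp add: s_def parity_sign_def)
    have "\<not> k dvd h * ?e r"
      using not_dvd_mult_remainder[OF assms(1)] bij_betwE[OF bij] r by (auto simp: even_remainders_def)
    then have "parity_sign k (s * (h * ?e r)) = s * parity_sign k (h * ?e r)"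
      using parity_sign_mult_sign assms(3) s by blast
    moreover have "[s * (h * ?e r) = s * (h * (s * (g * r)))] (mod k)"
      unfolding s_def by (intro cong_mult cong_refl cong_even_representative)
    then have "[s * (h * ?e r) = h * g * r] (mod k)" using s by (elim disjE) (simp_all add: mult.assoc)
    ultimately show ?thesis using parity_sign_cong s_def by (metis mult.commute)
  qed
  then have "jacobi (h * g) k = (\<Prod>r\<in>even_remainders k. parity_sign k (h * ?e r)) * jacobi g k"
    unfolding jacobi_def prod.distrib[symmetric] by (intro prod.cong refl)
  also have "(\<Prod>r\<in>even_remainders k. parity_sign k (h * ?e r)) = jacobi h k"
    unfolding jacobi_def by (rule prod.reindex_bij_betw[OF bij])
  finally show ?thesis .
qed

lemma jacobi_power_left:
  assumes "coprime h k" "odd k"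
  shows "jacobi (h ^ n) k = jacobi h k ^ n"
  using assms by (induction n) (simp_all add: jacobi_1_left jacobi_mult_left)

lemma jacobi_prod_left:
  assumes "\<And>x. x \<in> X \<Longrightarrow> coprime (g x) k" "odd k"
  shows "jacobi (\<Prod>x\<in>X. g x) k = (\<Prod>x\<in>X. jacobi (g x) k)"
  using assms(1)
  by (induction X rule: infinite_finite_induct)
    (simp_all add: jacobi_1_left jacobi_mult_left prod_coprime_left assms(2))

lemma card_even_remainders:
  assumes "odd k"
  shows "card (even_remainders k) = nat ((k - 1) div 2)"
proof -
  have "bij_betw (\<lambda>i. 2 * i) {1..(k - 1) div 2} (even_remainders k)"
  proof (rule bij_betwI[where g = "\<lambda>i. i div 2"])
    show "(*) 2 \<in> {1..(k - 1) div 2} \<rightarrow> even_remainders k" by (auto simp: even_remainders_def)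
    show "(\<lambda>i. i div 2) \<in> even_remainders k \<rightarrow> {1..(k - 1) div 2}"
      using assms by (auto simp: even_remainders_def elim!: evenE)
  qed (auto simp: even_remainders_def)
  from bij_betw_same_card[OF this] show ?thesis by simp
qed

lemma jacobi_cong_power:
  assumes p: "prime p" "odd p" and coprime: "coprime h p"
  shows "[jacobi h p = h ^ nat ((p - 1) div 2)] (mod p)"
proof -
  let ?E = "even_remainders p" and ?n = "nat ((p - 1) div 2)"
  have "\<Prod>?E = (\<Prod>r\<in>?E. even_representative p (h * r))"
    by (rule prod.reindex_bij_betw[OF bij_betw_even_representative[OF coprime p(2)], symmetric])
  also have "[\<dots> = (\<Prod>r\<in>?E. parity_sign p (h * r) * (h * r))] (mod p)"
    by (intro cong_prod cong_even_representative)
  also have "(\<Prod>r\<in>?E. parity_sign p (h * r) * (h * r)) = jacobi h p * h ^ ?n * \<Prod>?E"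
    unfolding prod.distrib jacobi_def prod_constant card_even_remainders[OF p(2)] by (simp only: mult.assoc)
  finally have "[1 * \<Prod>?E = jacobi h p * h ^ ?n * \<Prod>?E] (mod p)" by simp
  moreover have "coprime (\<Prod>?E) p"
  proof (rule prod_coprime_left)
    fix r assume "r \<in> ?E"
    then have "\<not> p dvd r" by (auto simp: even_remainders_def dest: zdvd_imp_le)
    then show "coprime r p" using p(1) by (metis coprime_commute prime_imp_coprime)
  qed
  ultimately have "[1 = jacobi h p * h ^ ?n] (mod p)" by (simp only: cong_mult_rcancel)
  then have "[jacobi h p * 1 = jacobi h p * (jacobi h p * h ^ ?n)] (mod p)" by (rule cong_scalar_left)
  then show ?thesis using jacobi_values[of h p] by auto
qed

lemma jacobi_eq_Legendre:
  assumes p: "prime p" "odd p" and coprime: "coprime h p"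
  shows "jacobi h p = Legendre h p"
proof -
  have p2: "p > 2" using p prime_ge_2_int[of p] by (cases "p = 2") auto
  have "[Legendre h (int (nat p)) = h ^ ((nat p - 1) div 2)] (mod int (nat p))"
    using p p2 by (intro euler_criterion) (simp_all add: prime_int_nat_transfer[symmetric])
  moreover have "(nat p - 1) div 2 = nat ((p - 1) div 2)" using p2 by (simp add: nat_div_distrib nat_diff_distrib)
  ultimately have "[Legendre h p = h ^ nat ((p - 1) div 2)] (mod p)" using p2 by simp
  then have "[jacobi h p = Legendre h p] (mod p)"
    by (rule cong_trans[OF jacobi_cong_power[OF assms] cong_sym])
  moreover have "\<not> [h = 0] (mod p)"
    using coprime p(1) by (metis cong_0_iff coprime_absorb_right coprime_commute not_prime_unit)
  then have "Legendre h p = 1 \<or> Legendre h p = -1" by (simp add: Legendre_def)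
  moreover have "\<not> p dvd 2" using p2 by (auto dest: zdvd_imp_le)
  ultimately show ?thesis using jacobi_values[of h p] by (auto simp: cong_iff_dvd_diff)
qed

lemma jacobi_eq_sum_div:
  assumes "odd k"
  shows "jacobi h k = (if even (\<Sum>r\<in>even_remainders k. h * r div k) then 1 else -1)"
proof -
  have "parity_sign k (h * r) = (if even (h * r div k) then 1 else -1)" if "r \<in> even_remainders k" for r
  proof -
    have "even (h * r div k * k + h * r mod k)" using that by (simp add: even_remainders_def)
    then show ?thesis using assms by (simp only: parity_sign_def even_add even_mult_iff) simp
  qed
  then have "jacobi h k = (\<Prod>r\<in>even_remainders k. if even (h * r div k) then 1 else -1)"
    unfolding jacobi_def by (rule prod.cong[OF refl])
  moreover have "(\<Prod>r\<in>X. if even (f r) then 1 else -1 :: int) = (if even (sum f X) then 1 else -1)"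
    for X and f :: "int \<Rightarrow> int"
    by (induction X rule: infinite_finite_induct) auto
  ultimately show ?thesis by simp
qed

lemma dedekind_num_mod_8:
  assumes "coprime h k" "k > 0" "odd k"
  shows "[dedekind_num h k = k + 1 - 2 * jacobi h k] (mod 8)"
proof -
  let ?q = "\<lambda>r. h * r div k"
  define A U W where "A = (\<Sum>r\<in>{1..<k}. r * ?q r)" and "U = (\<Sum>r\<in>even_remainders k. ?q r)"
    and "W = (\<Sum>r\<in>{1..<k} - even_remainders k. ?q r)"
  have "even_remainders k \<subseteq> {1..<k}" by (auto simp: even_remainders_def)
  then have split: "sum g {1..<k} = sum g (even_remainders k) + sum g ({1..<k} - even_remainders k)"
    for g :: "int \<Rightarrow> int"
    using sum.subset_diff[of "even_remainders k" "{1..<k}" g] by (simp only: finite_atLeastLessThan_int add.commute)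
  obtain j where j: "k = 2 * j + 1" using assms(3) by (elim oddE)
  have W: "W = (h - 1) * j - U"
    using sum_div_remainders[OF assms(1,2)] split[of ?q] by (simp add: U_def W_def j)
  have "even (A - W)"
    unfolding A_def W_def split[of "\<lambda>r. r * ?q r"] add_diff_eq[symmetric] sum_subtractf[symmetric]
    by (intro dvd_add dvd_sum) (auto simp: even_remainders_def)
  then obtain x where x: "A = W + 2 * x" by (metis diff_add_cancel add.commute evenE)
  have "even (j * j + j)" by simp
  then obtain y where y: "j * j = 2 * y - j" by (metis add_diff_cancel_right' dvdE)
  have "dedekind_num h k = 16 * h * (j * j) + 4 * h * j - 12 * A - 12 * (j * j) - 6 * j"
    unfolding dedekind_num_def A_def[symmetric] by (simp add: j algebra_simps)
  also have "\<dots> = 8 * (4 * h * y - 2 * h * j - h * j - 3 * x - 3 * y + 2 * j + U) + 2 * j + 4 * U"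
    unfolding x y W by (simp add: algebra_simps)
  finally have "[dedekind_num h k = 2 * j + 4 * U] (mod 8)" by (simp add: cong_iff_dvd_diff)
  moreover have "jacobi h k = (if even U then 1 else -1)" unfolding U_def by (rule jacobi_eq_sum_div[OF assms(3)])
  then have "[2 * j + 4 * U = k + 1 - 2 * jacobi h k] (mod 8)"
    unfolding j cong_iff_dvd_diff by (auto elim!: evenE oddE simp: algebra_simps)
  ultimately show ?thesis by (rule cong_trans)
qed

lemma eight_dvd_odd_square_minus_1:
  fixes x :: int
  assumes "odd x"
  shows "8 dvd x * x - 1"
proof -
  obtain j where j: "x = 2 * j + 1" using assms by (elim oddE)
  have "even (j * (j + 1))" by simp
  then have "2 * 4 dvd j * (j + 1) * 4" by (rule mult_dvd_mono) simp
  then show ?thesis by (simp add: j algebra_simps)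
qed

lemma jacobi_reciprocity:
  assumes "coprime h k" "h > 0" "k > 0" "odd h" "odd k"
  shows "jacobi h k = jacobi k h * (if h mod 4 = 3 \<and> k mod 4 = 3 then -1 else 1)"
proof -
  obtain i j where ij: "h = 2 * i + 1" "k = 2 * j + 1" using assms(4,5) by (elim oddE)
  have "[h * dedekind_num h k + k * dedekind_num k h =
      h * (k + 1 - 2 * jacobi h k) + k * (h + 1 - 2 * jacobi k h)] (mod 8)"
    using assms by (intro cong_add cong_mult cong_refl dedekind_num_mod_8) (simp_all add: coprime_commute)
  then have "8 dvd h * h + k * k + 1 - 3 * (h * k) - (h * (k + 1 - 2 * jacobi h k) + k * (h + 1 - 2 * jacobi k h))"
    unfolding dedekind_num_reciprocity[OF assms(1-3)] cong_iff_dvd_diff by (simp add: power2_eq_square mult.assoc)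
  from dvd_diff[OF dvd_diff[OF this eight_dvd_odd_square_minus_1[OF assms(4)]] eight_dvd_odd_square_minus_1[OF assms(5)]]
  have "8 dvd (h * h + k * k + 1 - 3 * (h * k) - (h * (k + 1 - 2 * jacobi h k) + k * (h + 1 - 2 * jacobi k h)))
      - (h * h - 1) - (k * k - 1)" .
  also have "\<dots> = 8 * (- 3 * (i * j) - 2 * i - 2 * j - 1) +
      (4 * (i * j) + 4 * i + 4 * j + 4 + (4 * i + 2) * jacobi h k + (4 * j + 2) * jacobi k h)"
    by (simp add: ij algebra_simps)
  finally have "8 dvd 4 * (i * j) + 4 * i + 4 * j + 4 + (4 * i + 2) * jacobi h k + (4 * j + 2) * jacobi k h"
    by (simp only: dvd_add_right_iff[OF dvd_triv_left])
  moreover have "s = t \<longleftrightarrow> even P"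
    if "8 dvd 4 * P + 4 * i + 4 * j + 4 + (4 * i + 2) * s + (4 * j + 2) * t"
      "s = 1 \<or> s = -1" "t = 1 \<or> t = -1" for P s t
    using that(2,3,1) by (elim disjE; hypsubst; simp; presburger)
  ultimately have "jacobi h k = jacobi k h \<longleftrightarrow> even (i * j)" using jacobi_values by blast
  moreover have "h mod 4 = 3 \<longleftrightarrow> odd i" "k mod 4 = 3 \<longleftrightarrow> odd j" unfolding ij by presburger+
  ultimately show ?thesis using jacobi_values[of h k] jacobi_values[of k h] by auto
qed

lemma jacobi_2_left:
  assumes "k > 0" "odd k"
  shows "jacobi 2 k = kronecker_prime k 2"
proof -
  have coprime: "coprime 2 k" using assms(2) by simp
  have "{1..<2} = {1::int}" by auto
  moreover have "k div 2 * 2 = k - 1" using assms(2) by presburger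
  ultimately have "dedekind_num k 2 = 0" by (simp add: dedekind_num_def)
  then have twice: "2 * dedekind_num 2 k = k * k + 5 - 6 * k"
    using dedekind_num_reciprocity[of 2 k] assms coprime by (simp add: power2_eq_square)
  have "8 dvd dedekind_num 2 k - (k + 1 - 2 * jacobi 2 k)"
    using dedekind_num_mod_8[OF coprime assms] by (simp only: cong_iff_dvd_diff)
  then have "2 * 8 dvd 2 * (dedekind_num 2 k - (k + 1 - 2 * jacobi 2 k))" by (rule mult_dvd_mono[OF dvd_refl])
  then have "16 dvd k * k + 3 - 8 * k + 4 * jacobi 2 k" using twice by (simp add: algebra_simps)
  moreover define t s where "t = k div 8" and "s = k mod 8"
  have k: "k = 8 * t + s" by (simp add: t_def s_def)
  ultimately have "16 dvd 16 * (4 * (t * t) + s * t - 4 * t) + (s * s + 3 - 8 * s + 4 * jacobi 2 k)"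
    unfolding k by (simp add: algebra_simps)
  then have "16 dvd s * s + 3 - 8 * s + 4 * jacobi 2 k" by (simp only: dvd_add_right_iff[OF dvd_triv_left])
  moreover have "s = 1 \<or> s = 3 \<or> s = 5 \<or> s = 7" using assms(2) unfolding s_def by presburger
  ultimately show ?thesis using jacobi_values[of 2 k] assms(2)
    by (auto simp: kronecker_prime_def s_def[symmetric])
qed

lemma kronecker_1_right: "kronecker a 1 = 1"
  by (simp add: kronecker_def)

lemma kronecker_prime_mult_right:
  assumes "prime p" "v > 0"
  shows "kronecker a (p * v) = kronecker_prime a p * kronecker a v"
proof -
  have "kronecker a n = prod_mset (image_mset (kronecker_prime a) (prime_factorization n))" for n
    unfolding kronecker_def image_prod_mset_multiplicity
    by (intro prod.cong refl) (metis count_prime_factorization_prime in_prime_factors_imp_prime)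
  then show ?thesis using assms by (simp add: prime_factorization_mult prime_factorization_prime)
qed

lemma kronecker_prime_eq_jacobi:
  assumes "prime p" "odd p" "coprime a (int p)"
  shows "kronecker_prime a p = jacobi a (int p)"
proof -
  have "jacobi a (int p) = Legendre a (int p)" using assms by (intro jacobi_eq_Legendre) simp_all
  moreover have "p \<noteq> 2" using assms(2) by auto
  ultimately show ?thesis by (simp add: kronecker_prime_def)
qed

lemma kronecker_prime_mult_left:
  assumes p: "prime p" and coprime: "coprime a (int p)" "coprime b (int p)"
  shows "kronecker_prime (a * b) p = kronecker_prime a p * kronecker_prime b p"
proof (cases "p = 2")
  case True
  have "odd a" "odd b" using coprime True by simp_all
  then have residues: "a mod 8 = 1 \<or> a mod 8 = 3 \<or> a mod 8 = 5 \<or> a mod 8 = 7"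
    "b mod 8 = 1 \<or> b mod 8 = 3 \<or> b mod 8 = 5 \<or> b mod 8 = 7" by presburger+
  have mult: "a * b mod 8 = (a mod 8) * (b mod 8) mod 8" by (simp add: mod_mult_eq)
  show ?thesis
    unfolding kronecker_prime_def mult using residues
    by (elim disjE; simp add: True \<open>odd a\<close> \<open>odd b\<close>)
next
  case False
  then have "odd p" using p prime_odd_nat prime_ge_2_nat le_neq_implies_less by metis
  moreover have "coprime (a * b) (int p)" using coprime by simp
  ultimately show ?thesis
    using kronecker_prime_eq_jacobi[OF p] jacobi_mult_left[OF coprime] coprime by simp
qed

lemma kronecker_mult_left:
  assumes "coprime a (int v)" "coprime b (int v)"
  shows "kronecker (a * b) v = kronecker a v * kronecker b v"
  unfolding kronecker_def prod.distrib[symmetric] power_mult_distrib[symmetric]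
proof (intro prod.cong refl arg_cong2[where f = "(^)"])
  fix p assume "p \<in> prime_factors v"
  then have p: "prime p" "int p dvd int v" by auto
  show "kronecker_prime (a * b) p = kronecker_prime a p * kronecker_prime b p"
    using kronecker_prime_mult_left[OF p(1)] coprime_divisors[OF dvd_refl p(2)] assms by blast
qed

lemma kronecker_1_left: "kronecker 1 v = 1"
proof -
  have "kronecker_prime 1 p = 1" if "prime p" for p
  proof (cases "p = 2")
    case False
    moreover have "\<not> [1 = 0] (mod int p)" using prime_gt_1_nat[OF that] by (simp add: cong_def)
    moreover have "QuadRes (int p) 1" unfolding QuadRes_def by (rule exI[of _ 1]) simp
    ultimately show ?thesis by (simp add: kronecker_prime_def Legendre_def)
  qed (simp add: kronecker_prime_def)
  then show ?thesis by (auto simp: kronecker_def intro!: prod.neutral dest: in_prime_factors_imp_prime)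
qed

lemma kronecker_cong:
  assumes "\<And>p. prime p \<Longrightarrow> p dvd v \<Longrightarrow> [a = b] (mod int p)" "even v \<Longrightarrow> [a = b] (mod 8)"
  shows "kronecker a v = kronecker b v"
  unfolding kronecker_def
proof (intro prod.cong refl arg_cong2[where f = "(^)"])
  fix p assume "p \<in> prime_factors v"
  then have p: "prime p" "p dvd v" by auto
  show "kronecker_prime a p = kronecker_prime b p"
  proof (cases "p = 2")
    case True
    have "[a = b] (mod 8)" using assms(2) p(2) True by simp
    moreover from this have "even a = even b" unfolding cong_def by presburger
    ultimately show ?thesis by (simp add: True kronecker_prime_def cong_def)
  next
    case False
    have "[a = b] (mod int p)" using assms(1) p .
    then have "[a = 0] (mod int p) = [b = 0] (mod int p)" "QuadRes (int p) a = QuadRes (int p) b"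
      unfolding QuadRes_def cong_def by simp_all
    then show ?thesis using False by (simp add: kronecker_prime_def Legendre_def)
  qed
qed

lemma delta_of_values: "delta_of v = 0 \<or> delta_of v = 1"
  by (simp add: delta_of_def)

lemma delta_of_two_mult: "v > 0 \<Longrightarrow> delta_of (2 * v) = delta_of v"
  by (simp add: delta_of_def multiplicity_times_same)

lemma delta_of_odd_prime_mult:
  assumes "v > 0" "prime p" "odd p"
  shows "delta_of (p * v) = (if p mod 4 = 3 then 1 - delta_of v else delta_of v)"
proof -
  obtain u where u: "v = 2 ^ multiplicity 2 v * u" "odd u" using multiplicity_decompose'[of v 2] assms(1) by auto
  have "multiplicity 2 (p * v) = multiplicity 2 v"
    using assms by (subst prime_elem_multiplicity_mult_distrib) (auto simp: not_dvd_imp_multiplicity_0)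
  then have "p * v div 2 ^ multiplicity 2 (p * v) = p * u" "v div 2 ^ multiplicity 2 v = u"
    by (subst u(1), simp)+
  moreover have "u mod 4 = 1 \<or> u mod 4 = 3" "p mod 4 = 1 \<or> p mod 4 = 3" using u(2) assms(3) by presburger+
  moreover have "p * u mod 4 = (p mod 4) * (u mod 4) mod 4" by (simp add: mod_mult_eq)
  ultimately show ?thesis unfolding delta_of_def by (elim disjE) simp_all
qed

lemma jacobi_eq_kronecker:
  assumes "v > 0" "D > 0" "odd D" "coprime D (int v)"
  shows "jacobi (int v) D = kronecker D v * (if D mod 4 = 3 \<and> delta_of v = 1 then -1 else 1)"
  using assms(1,4)
proof (induction v rule: prime_divisors_induct)
  case (unit x)
  then have "x = 1" by simp
  then show ?case by (simp add: jacobi_1_left kronecker_1_right[unfolded One_nat_def] delta_of_def)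
next
  case (factor p x)
  have x: "x > 0" using factor(3) by (cases x) simp_all
  have coprime: "coprime D (int x)" "coprime D (int p)"
    using factor(4) by (simp_all only: of_nat_mult coprime_mult_right_iff)
  have IH: "jacobi (int x) D = kronecker D x * (if D mod 4 = 3 \<and> delta_of x = 1 then -1 else 1)"
    using factor(2) x coprime(1) by simp
  have mult: "jacobi (int (p * x)) D = jacobi (int p) D * jacobi (int x) D"
    unfolding of_nat_mult using coprime assms(3) by (intro jacobi_mult_left) (simp_all add: coprime_commute)
  show ?case
  proof (cases "p = 2")
    case True
    then show ?thesis
      unfolding mult IH kronecker_prime_mult_right[OF factor(1) x]
      using jacobi_2_left[OF assms(2,3)] delta_of_two_mult[OF x] by simp
  next
    case False
    then have odd: "odd p" using factor(1) prime_odd_nat prime_ge_2_nat le_neq_implies_less by metis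
    have "jacobi (int p) D = jacobi D (int p) * (if int p mod 4 = 3 \<and> D mod 4 = 3 then -1 else 1)"
      using coprime(2) prime_gt_0_nat[OF factor(1)] odd assms(2,3)
      by (intro jacobi_reciprocity) (simp_all add: coprime_commute)
    moreover have "int p mod 4 = 3 \<longleftrightarrow> p mod 4 = 3" by presburger
    ultimately show ?thesis
      unfolding mult IH kronecker_prime_mult_right[OF factor(1) x] delta_of_odd_prime_mult[OF x factor(1) odd]
        kronecker_prime_eq_jacobi[OF factor(1) odd coprime(2)]
      using delta_of_values[of x] by (cases "D mod 4 = 3"; cases "p mod 4 = 3"; elim disjE; simp only:; simp)
  qed
qed simp

section \<open>Congruences modulo divisors of 24\<close>

lemma coprime_prime_iff_not_dvd:
  fixes p x :: int
  assumes "prime p"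
  shows "coprime x p \<longleftrightarrow> \<not> p dvd x"
  using assms by (metis coprime_absorb_right coprime_commute not_prime_unit prime_imp_coprime)

lemma coprime_6_iff: "coprime x 6 \<longleftrightarrow> odd x \<and> \<not> 3 dvd x" for x :: int
  using coprime_mult_right_iff[of x 2 3] coprime_prime_iff_not_dvd[of 3 x] by simp

lemma dvd_square_minus_1_if_dvd_24:
  fixes a m :: int
  assumes "m dvd 24" "m > 0" "coprime a m"
  shows "m dvd a * a - 1"
proof -
  have "\<forall>m\<in>set [1..24]. \<forall>b\<in>set [0..m - 1]. m dvd 24 \<longrightarrow> coprime b m \<longrightarrow> m dvd b * b - 1"
    by code_simp
  moreover have "m \<le> 24" using assms(1) by (rule zdvd_imp_le) simp
  ultimately have "m dvd (a mod m) * (a mod m) - 1" using assms by simp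
  then show ?thesis by (simp add: mod_eq_dvd_iff[symmetric] mod_mult_eq)
qed

lemma cong_24_if_cong_3_8:
  fixes c D M P w Z :: int
  assumes "coprime D 6" "P = 1 \<or> P = -1"
    and "[D * Z = - (c * M)] (mod 3)" "[D * Z = w * (D - 1) + 2 - 2 * P - c * M] (mod 8)"
  shows "[Z = 9 * w * (1 - D) + 6 * (1 - P) - D * c * M] (mod 24)"
proof -
  let ?Z = "9 * w * (1 - D) + 6 * (1 - P) - D * c * M"
  have "coprime D (6 ^ 3)" using assms(1) by (simp only: coprime_power_right_iff simp_thms)
  then have coprime: "coprime D 24" by (rule coprime_divisors[OF dvd_refl, rotated]) simp
  then have "24 dvd D * D - 1" by (intro dvd_square_minus_1_if_dvd_24) simp_all
  then obtain t where t: "D * D = 24 * t + 1" by (metis add.commute diff_add_cancel dvdE)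
  have "D * ?Z = 9 * w * (D - D * D) + 6 * D * (1 - P) - (D * D) * (c * M)" by (simp add: algebra_simps)
  then have DZ: "D * ?Z = 9 * w * (D - 24 * t - 1) + 6 * D * (1 - P) - (24 * t + 1) * (c * M)" by (simp add: t)
  have "[D * Z = D * ?Z] (mod 3)"
  proof -
    have "- (c * M) - D * ?Z = 3 * (8 * t * (c * M) - 3 * w * (D - 24 * t - 1) - 2 * D * (1 - P))"
      unfolding DZ by (simp add: algebra_simps)
    then have "[- (c * M) = D * ?Z] (mod 3)" by (simp add: cong_iff_dvd_diff)
    with assms(3) show ?thesis by (rule cong_trans)
  qed
  moreover have "[D * Z = D * ?Z] (mod 8)"
  proof -
    have "w * (D - 1) + 2 - 2 * P - c * M - D * ?Z =
        8 * (27 * w * t + 3 * t * (c * M) - w * (D - 1)) - 2 * (3 * D - 1) * (1 - P)"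
      unfolding DZ by (simp add: algebra_simps)
    moreover have "8 dvd 2 * (3 * D - 1) * (1 - P)"
      using assms(1,2) by (auto simp: coprime_6_iff elim!: oddE)
    ultimately have "[w * (D - 1) + 2 - 2 * P - c * M = D * ?Z] (mod 8)"
      unfolding cong_iff_dvd_diff by (simp only: dvd_diff[OF dvd_triv_left])
    with assms(4) show ?thesis by (rule cong_trans)
  qed
  moreover have "coprime (3 :: int) 8" using coprime_prime_iff_not_dvd[of 3 8] by (simp add: coprime_commute)
  ultimately have "[D * Z = D * ?Z] (mod (3 * 8))" by (intro coprime_cong_mult)
  then show ?thesis using coprime by (simp add: cong_mult_lcancel)
qed

lemma odd_mult_cong_4:
  fixes x y :: int
  assumes "odd x" "odd y"
  shows "[x * y = x + y - 1] (mod 4)"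
proof -
  obtain i j where "x = 2 * i + 1" "y = 2 * j + 1" using assms by (elim oddE)
  then have "x * y - (x + y - 1) = 4 * (i * j)" by (simp add: algebra_simps)
  then show ?thesis unfolding cong_iff_dvd_diff by simp
qed

lemma odd_power_cong_4:
  fixes x :: int
  assumes "odd x"
  shows "[x ^ nat \<bar>r\<bar> = r * (x - 1) + 1] (mod 4)"
proof -
  obtain i where i: "x = 2 * i + 1" using assms by (elim oddE)
  have "x ^ 2 - 1 = 4 * (i * (i + 1))" by (simp add: i power2_eq_square algebra_simps)
  then have "[x ^ 2 = 1] (mod 4)" by (simp add: cong_iff_dvd_diff)
  then have square: "[(x ^ 2) ^ n = 1] (mod 4)" for n using cong_pow[of "x ^ 2" 1 4 n] by simp
  show ?thesis
  proof (cases "even r")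
    case True
    then obtain s where "r = 2 * s" by (elim evenE)
    then have "[x ^ nat \<bar>r\<bar> = 1] (mod 4)" using square[of "nat \<bar>s\<bar>"]
      by (simp add: abs_mult nat_mult_distrib power_mult)
    moreover have "[r * (x - 1) + 1 = 1] (mod 4)" using \<open>r = 2 * s\<close> by (simp add: cong_iff_dvd_diff i)
    ultimately show ?thesis using cong_sym cong_trans by blast
  next
    case False
    then have "odd (nat \<bar>r\<bar>)" by (simp add: even_nat_iff)
    then obtain n where "nat \<bar>r\<bar> = 2 * n + 1" by (elim oddE)
    then have "[x ^ nat \<bar>r\<bar> = x] (mod 4)" using cong_scalar_left[OF square[of n], of x]
      by (simp add: power_mult)
    moreover obtain s where "r = 2 * s + 1" using False by (elim oddE)
    then have "[r * (x - 1) + 1 = x] (mod 4)" by (simp add: cong_iff_dvd_diff i algebra_simps)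
    ultimately show ?thesis using cong_sym cong_trans by blast
  qed
qed

lemma sum_mult_odd_cong_4:
  fixes r x :: "'a \<Rightarrow> int"
  assumes "\<And>n. n \<in> X \<Longrightarrow> odd (x n)"
  shows "[(\<Sum>n\<in>X. r n * x n) = (\<Sum>n\<in>X. r n) + (\<Prod>n\<in>X. x n ^ nat \<bar>r n\<bar>) - 1] (mod 4)"
  using assms
proof (induction X rule: infinite_finite_induct)
  case (insert n X)
  let ?u = "x n ^ nat \<bar>r n\<bar>" and ?P = "\<Prod>n\<in>X. x n ^ nat \<bar>r n\<bar>"
  have "odd ?u" "odd ?P" using insert by (auto simp: even_prod_iff)
  then have mult: "4 dvd ?u * ?P - (?u + ?P - 1)" unfolding cong_iff_dvd_diff[symmetric] by (rule odd_mult_cong_4)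
  have power: "4 dvd ?u - (r n * (x n - 1) + 1)"
    unfolding cong_iff_dvd_diff[symmetric] using insert by (intro odd_power_cong_4) simp
  have IH: "4 dvd (\<Sum>n\<in>X. r n * x n) - ((\<Sum>n\<in>X. r n) + ?P - 1)" using insert by (simp add: cong_iff_dvd_diff)
  from dvd_diff[OF dvd_diff[OF IH mult] power] show ?case using insert(1,2) by (simp add: cong_iff_dvd_diff algebra_simps)
qed simp_all

section \<open>The character of an eta-quotient\<close>

lemma ee_add: "ee (x + y) = ee x * ee y"
  by (simp add: ee_def distrib_left exp_add)

lemma ee_of_int [simp]: "ee (of_int n) = 1"
  using exp_integer_2pi[of "of_int n"] by (simp add: ee_def mult_ac)

lemma ee_0 [simp]: "ee 0 = 1"
  by (simp add: ee_def)

lemma ee_half: "ee (1 / 2) = -1"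
  by (simp add: ee_def)

lemma ee_eq_if_cong:
  assumes "[x = y] (mod m)" "m > 0"
  shows "ee (of_int x / of_int m) = ee (of_int y / of_int m)"
proof -
  obtain t where "x = y + m * t" using assms(1) by (metis cong_iff_lin cong_sym)
  then have "of_int x / of_int m = of_int y / of_int m + (of_int t :: complex)"
    using assms(2) by (simp add: field_simps)
  then show ?thesis by (simp add: ee_add)
qed

definition codivisor_sum :: "(nat \<Rightarrow> int) \<Rightarrow> nat \<Rightarrow> int" where
  "codivisor_sum r N = (\<Sum>n\<in>{n. n dvd N}. int (N div n) * r n)"

text \<open>
  The exponent collects the term \<open>9 w (1 - D) / 24\<close> of \<open>\<chi>\<close>, where \<open>w = 2 k\<close>, and the sign
  \<open>(-1)\<^bsup>\<delta>(D - 1)/2\<^esup>\<close> of quadratic reciprocity.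
\<close>
definition eta_twist :: "(nat \<Rightarrow> int) \<Rightarrow> nat \<Rightarrow> int \<Rightarrow> complex" where
  "eta_twist r N x = ee (of_int ((3 * wt2 r N + 2 * int (delta_of (varpi r N))) * x) / of_int 8)"

lemma eta_twist_add: "eta_twist r N (x + y) = eta_twist r N x * eta_twist r N y"
  by (simp add: eta_twist_def distrib_left add_divide_distrib ee_add)

lemma eta_twist_cong_8: "[x = y] (mod 8) \<Longrightarrow> eta_twist r N x = eta_twist r N y"
  unfolding eta_twist_def by (intro ee_eq_if_cong cong_scalar_left) simp_all

lemma eta_twist_cong_4:
  assumes "even (wt2 r N)" "[x = y] (mod 4)"
  shows "eta_twist r N x = eta_twist r N y"
proof -
  have "2 * 4 dvd (3 * wt2 r N + 2 * int (delta_of (varpi r N))) * (x - y)"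
    using assms by (intro mult_dvd_mono) (simp_all add: cong_iff_dvd_diff)
  then show ?thesis unfolding eta_twist_def by (intro ee_eq_if_cong) (simp_all add: cong_iff_dvd_diff algebra_simps)
qed

lemma divisor_pos: "N > 0 \<Longrightarrow> n \<in> {n. n dvd N} \<Longrightarrow> n > (0 :: nat)"
  by (auto intro: Nat.gr0I)

lemma codivisor_dvd: "n \<in> {n. n dvd N} \<Longrightarrow> int (N div n) dvd int N"
  by (auto elim!: dvdE)

lemma varpi_pos: "N > 0 \<Longrightarrow> varpi r N > 0"
  unfolding varpi_def by (intro prod_pos) (auto elim!: dvdE)

lemma coprime_varpi:
  assumes "coprime x (int N)"
  shows "coprime x (int (varpi r N))"
  unfolding varpi_def of_nat_prod of_nat_power
proof (rule prod_coprime_right)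
  fix n assume "n \<in> {n. n dvd N}"
  then have "coprime x (int (N div n))" by (rule coprime_divisors[OF dvd_refl codivisor_dvd assms])
  then show "coprime x (int (N div n) ^ nat \<bar>r n\<bar>)" by (simp only: coprime_power_right_iff simp_thms)
qed

lemma prime_dvd_varpi:
  assumes "prime p" "p dvd varpi r N"
  shows "p dvd N"
proof (rule ccontr)
  assume "\<not> p dvd N"
  then have "coprime (int p) (int N)" using assms(1) by (simp add: prime_imp_coprime)
  from coprime_varpi[OF this] have "coprime p (varpi r N)" by simp
  then show False using assms by (metis coprime_common_divisor dvd_refl not_prime_unit)
qed

lemma codivisor_sum_cong_4:
  assumes "odd N"
  shows "[codivisor_sum r N = wt2 r N - 2 * int (delta_of (varpi r N))] (mod 4)"
proof -
  let ?v = "varpi r N"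
  have odd: "odd (int (N div n))" if "n \<in> {n. n dvd N}" for n
    using codivisor_dvd[OF that] assms by (metis dvd_trans even_of_nat)
  have "codivisor_sum r N = (\<Sum>n\<in>{n. n dvd N}. r n * int (N div n))"
    unfolding codivisor_sum_def by (simp only: mult.commute)
  also have "[\<dots> = wt2 r N + int ?v - 1] (mod 4)"
    unfolding wt2_def varpi_def of_nat_prod of_nat_power by (rule sum_mult_odd_cong_4[OF odd])
  finally have sum: "[codivisor_sum r N = wt2 r N + int ?v - 1] (mod 4)" .
  have "odd ?v" using prime_dvd_varpi[of 2 r N] assms by auto
  then have "delta_of ?v = (if ?v mod 4 = 1 then 0 else 1)" by (simp add: delta_of_def not_dvd_imp_multiplicity_0)
  moreover have "[int u = 1 - 2 * int (if u mod 4 = 1 then 0 else 1)] (mod 4)" if "odd u" for u :: nat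
    using that unfolding cong_def by simp presburger
  ultimately have "[int ?v = 1 - 2 * int (delta_of ?v)] (mod 4)" using \<open>odd ?v\<close> by (simp only:)
  then have "[wt2 r N + int ?v - 1 = wt2 r N + (1 - 2 * int (delta_of ?v)) - 1] (mod 4)"
    by (intro cong_add cong_diff cong_refl)
  with sum show ?thesis by (auto intro: cong_trans)
qed

lemma Psi_eq_of_int:
  assumes det: "a * d - b * c = 1" and "c > 0" "d > 0"
  obtains z where "Psi (a, b, c, d) = of_int z" "d * z = b - c + dedekind_num c d"
proof -
  have coprime: "coprime c d" by (rule coprime_if_det_1[OF det])
  have "c * (b - c + dedekind_num c d) = d * (a + d - 3 * c - dedekind_num d c)"
    using dedekind_num_reciprocity[OF coprime assms(2,3)] det by (simp add: algebra_simps power2_eq_square)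
  moreover from this have "d dvd b - c + dedekind_num c d"
    using coprime by (metis coprime_commute coprime_dvd_mult_right_iff dvd_triv_left)
  then obtain z where z: "b - c + dedekind_num c d = d * z" by (elim dvdE)
  ultimately have "d * (c * z) = d * (a + d - 3 * c - dedekind_num d c)" by (simp add: mult.left_commute)
  then have cz: "c * z = a + d - 3 * c - dedekind_num d c" using assms(3) by simp
  have "12 * of_int c * dedekind_sum (- d) c = of_int (- dedekind_num d c)"
    using dedekind_sum_eq_dedekind_num[of "- d" c] dedekind_num_minus[of d c] coprime assms(2)
    by (simp add: coprime_commute)
  then have "of_int c * Psi (a, b, c, d) = of_int (a + d - 3 * c - dedekind_num d c)"
    using assms(2) by (simp add: Psi_def field_simps)
  also have "\<dots> = of_int c * of_int z" unfolding cz[symmetric] by simp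
  finally have "Psi (a, b, c, d) = of_int z" using assms(2) by simp
  from that[OF this z[symmetric]] show ?thesis .
qed

lemma eta_char_eq_ee:
  assumes N: "N > 0" and sum0: "(\<Sum>n\<in>{n. n dvd N}. int n * r n) = 0"
    and det: "A * D - B * (int N * c) = 1" and pos: "c > 0" "D > 0"
  obtains Z where "eta_char r N (A, B, int N * c, D) 1 = ee (of_int Z / 24)"
    "D * Z = (\<Sum>n\<in>{n. n dvd N}. r n * dedekind_num (c * int (N div n)) D) - c * codivisor_sum r N"
proof -
  let ?S = "{n. n dvd N}"
  have "\<exists>z. Psi (A, B * int n, int N * c div int n, D) = of_int z \<and>
      D * z = B * int n - c * int (N div n) + dedekind_num (c * int (N div n)) D" if n: "n \<in> ?S" for n
  proof -
    have "int N = int n * int (N div n)" using n by (auto elim!: dvdE)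
    then have C: "int N * c div int n = c * int (N div n)" "A * D - B * int n * (c * int (N div n)) = 1"
      using divisor_pos[OF N n] det by (auto simp: mult_ac)
    have "N div n > 0" using N n by (auto elim!: dvdE)
    then have "c * int (N div n) > 0" using pos(1) by simp
    from Psi_eq_of_int[OF C(2) this pos(2)] show ?thesis unfolding C(1) by metis
  qed
  then obtain z where Psi: "\<And>n. n \<in> ?S \<Longrightarrow> Psi (A, B * int n, int N * c div int n, D) = of_int (z n)"
    and z: "\<And>n. n \<in> ?S \<Longrightarrow> D * z n = B * int n - c * int (N div n) + dedekind_num (c * int (N div n)) D"
    by metis
  have "(\<Sum>n\<in>?S. of_int (r n) * Psi (A, B * int n, int N * c div int n, D)) = of_int (\<Sum>n\<in>?S. r n * z n)"
    unfolding of_int_sum by (intro sum.cong) (auto simp: Psi)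
  then have "eta_char r N (A, B, int N * c, D) 1 = ee (of_int (\<Sum>n\<in>?S. r n * z n) / 24)"
    unfolding eta_char_def case_prod_conv by (simp del: of_real_sum of_int_sum)
  moreover have "D * (r n * z n) = B * (int n * r n) - c * (int (N div n) * r n)
      + r n * dedekind_num (c * int (N div n)) D" if "n \<in> ?S" for n
    unfolding mult.left_commute[of D] z[OF that] by (simp add: algebra_simps)
  then have "D * (\<Sum>n\<in>?S. r n * z n) = (\<Sum>n\<in>?S. B * (int n * r n) - c * (int (N div n) * r n)
      + r n * dedekind_num (c * int (N div n)) D)"
    unfolding sum_distrib_left by (intro sum.cong refl)
  then have "D * (\<Sum>n\<in>?S. r n * z n) = (\<Sum>n\<in>?S. r n * dedekind_num (c * int (N div n)) D) - c * codivisor_sum r N"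
    unfolding codivisor_sum_def by (simp only: sum.distrib sum_subtractf sum_distrib_left[symmetric] sum0)
  ultimately show ?thesis using that by blast
qed

lemma sum_dedekind_num_mod_8:
  assumes "\<And>n. n \<in> X \<Longrightarrow> coprime (x n) D" "D > 0" "odd D"
  shows "[(\<Sum>n\<in>X. r n * dedekind_num (x n) D) =
    (\<Sum>n\<in>X. r n) * (D - 1) + 2 - 2 * (\<Prod>n\<in>X. jacobi (x n) D ^ nat \<bar>r n\<bar>)] (mod 8)"
proof -
  let ?w = "\<Sum>n\<in>X. r n" and ?P = "\<Prod>n\<in>X. jacobi (x n) D ^ nat \<bar>r n\<bar>"
  have "[(\<Sum>n\<in>X. r n * dedekind_num (x n) D) = (\<Sum>n\<in>X. r n * (D + 1 - 2 * jacobi (x n) D))] (mod 8)"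
    using assms by (intro cong_sum cong_scalar_left dedekind_num_mod_8)
  also have "(\<Sum>n\<in>X. r n * (D + 1 - 2 * jacobi (x n) D)) = (D + 1) * ?w - 2 * (\<Sum>n\<in>X. r n * jacobi (x n) D)"
    unfolding sum_distrib_left sum_subtractf[symmetric] by (intro sum.cong) (auto simp: algebra_simps)
  also have "[\<dots> = (D + 1) * ?w - 2 * (?w + ?P - 1)] (mod 8)"
  proof -
    have "odd (jacobi h D)" for h using jacobi_values[of h D] by auto
    then have "4 dvd (\<Sum>n\<in>X. r n * jacobi (x n) D) - (?w + ?P - 1)"
      using sum_mult_odd_cong_4[of X "\<lambda>n. jacobi (x n) D" r] by (simp add: cong_iff_dvd_diff)
    then have "2 * 4 dvd 2 * ((\<Sum>n\<in>X. r n * jacobi (x n) D) - (?w + ?P - 1))" by (rule mult_dvd_mono[OF dvd_refl])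
    then show ?thesis by (simp add: cong_iff_dvd_diff dvd_diff_commute algebra_simps)
  qed
  also have "(D + 1) * ?w - 2 * (?w + ?P - 1) = ?w * (D - 1) + 2 - 2 * ?P" by (simp add: algebra_simps)
  finally show ?thesis .
qed

lemma prod_jacobi_codivisors:
  assumes "N > 0" "coprime c D" "coprime (int N) D" "odd D"
  shows "(\<Prod>n\<in>{n. n dvd N}. jacobi (c * int (N div n)) D ^ nat \<bar>r n\<bar>) =
    jacobi c D ^ nat \<bar>wt2 r N\<bar> * jacobi (int (varpi r N)) D"
proof -
  let ?S = "{n. n dvd N}"
  have coprime: "coprime (int (N div n)) D" if "n \<in> ?S" for n
    by (rule coprime_divisors[OF codivisor_dvd[OF that] dvd_refl assms(3)])
  have "(\<Prod>n\<in>?S. jacobi (c * int (N div n)) D ^ nat \<bar>r n\<bar>) =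
      (\<Prod>n\<in>?S. jacobi c D ^ nat \<bar>r n\<bar> * jacobi (int (N div n) ^ nat \<bar>r n\<bar>) D)"
    using assms(2,4) coprime
    by (intro prod.cong refl) (simp add: jacobi_mult_left jacobi_power_left power_mult_distrib)
  also have "\<dots> = jacobi c D ^ (\<Sum>n\<in>?S. nat \<bar>r n\<bar>) * jacobi (int (varpi r N)) D"
    unfolding prod.distrib varpi_def of_nat_prod of_nat_power power_sum
    using coprime assms(4) by (subst jacobi_prod_left) (simp_all only: coprime_power_left_iff simp_thms)
  also have "jacobi c D ^ (\<Sum>n\<in>?S. nat \<bar>r n\<bar>) = jacobi c D ^ nat \<bar>wt2 r N\<bar>"
  proof -
    have "even (\<Sum>n\<in>X. nat \<bar>r n\<bar>) = even (\<Sum>n\<in>X. r n)" for X :: "nat set"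
      by (induction X rule: infinite_finite_induct) (auto simp: even_nat_iff)
    then have "even (\<Sum>n\<in>?S. nat \<bar>r n\<bar>) = even (nat \<bar>wt2 r N\<bar>)" by (simp add: even_nat_iff wt2_def)
    then show ?thesis using jacobi_values[of c D] by (auto simp: minus_one_power_iff)
  qed
  finally show ?thesis .
qed

lemma weight_factor_eq_eta_twist:
  assumes "odd D"
  shows "ee (of_int (9 * wt2 r N * (1 - D)) / 24) * of_int (if D mod 4 = 3 \<and> delta_of (varpi r N) = 1 then -1 else 1) =
    eta_twist r N (1 - D)"
proof -
  let ?\<delta> = "delta_of (varpi r N)"
  obtain j where D: "D = 2 * j + 1" using assms by (elim oddE)
  have "ee (of_int (int ?\<delta> * (1 - D)) / of_int 4) = of_int (if D mod 4 = 3 \<and> ?\<delta> = 1 then -1 else 1)"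
  proof (cases "D mod 4 = 3 \<and> ?\<delta> = 1")
    case True
    then have "[int ?\<delta> * (1 - D) = 2] (mod 4)" by (simp add: cong_iff_dvd_diff) presburger
    from ee_eq_if_cong[OF this] show ?thesis using True ee_half by simp
  next
    case False
    then have "4 dvd int ?\<delta> * (1 - D)"
      using delta_of_values[of "varpi r N"] assms by auto presburger
    then have "[int ?\<delta> * (1 - D) = 0] (mod 4)" by (simp add: cong_iff_dvd_diff)
    from ee_eq_if_cong[OF this] show ?thesis using False by simp
  qed
  moreover have "eta_twist r N (1 - D) = ee (of_int (9 * wt2 r N * (1 - D)) / 24) * ee (of_int (int ?\<delta> * (1 - D)) / of_int 4)"
    unfolding eta_twist_def ee_add[symmetric] by (intro arg_cong[where f = ee]) (simp add: field_simps)
  ultimately show ?thesis by simp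
qed

text \<open>For \<open>D\<close> prime to 6 the exponent \<open>Z\<close> of the character is determined modulo 24 by \<open>D Z\<close>.\<close>
lemma eta_char_eq:
  fixes A B c D :: int
  assumes N: "N > 0" and sum0: "(\<Sum>n\<in>{n. n dvd N}. int n * r n) = 0"
    and det: "A * D - B * (int N * c) = 1" and c: "c > 0" and D: "D > 0" "coprime D 6"
  shows "eta_char r N (A, B, int N * c, D) 1 = ee (of_int (- (D * c * codivisor_sum r N)) / of_int 24) *
    eta_twist r N (1 - D) * of_int (jacobi c D ^ nat \<bar>wt2 r N\<bar> * kronecker D (varpi r N))"
proof -
  let ?w = "wt2 r N" and ?v = "varpi r N" and ?M = "codivisor_sum r N"
  define P where "P = (\<Prod>n\<in>{n. n dvd N}. jacobi (c * int (N div n)) D ^ nat \<bar>r n\<bar>)"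
  have odd: "odd D" and not3: "\<not> 3 dvd D" using D(2) by (simp_all add: coprime_6_iff)
  have "coprime (int N * c) D" by (rule coprime_if_det_1[OF det])
  then have coprime: "coprime c D" "coprime (int N) D" by simp_all
  obtain Z where char: "eta_char r N (A, B, int N * c, D) 1 = ee (of_int Z / of_int 24)"
    and Z: "D * Z = (\<Sum>n\<in>{n. n dvd N}. r n * dedekind_num (c * int (N div n)) D) - c * ?M"
    using eta_char_eq_ee[OF N sum0 det c D(1)] by auto
  have "jacobi h D ^ n = 1 \<or> jacobi h D ^ n = -1" for h n
    using jacobi_values[of h D] by (cases "even n") auto
  then have P: "P = 1 \<or> P = -1" unfolding P_def by (intro prod_eq_1_or_minus_1)
  have "3 dvd (\<Sum>n\<in>{n. n dvd N}. r n * dedekind_num (c * int (N div n)) D)"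
    using three_dvd_dedekind_num[OF not3] by (intro dvd_sum dvd_mult) auto
  then have "[D * Z = - (c * ?M)] (mod 3)" unfolding Z cong_iff_dvd_diff by simp
  moreover have "[D * Z = ?w * (D - 1) + 2 - 2 * P - c * ?M] (mod 8)"
    unfolding Z P_def wt2_def
    using coprime coprime_divisors[OF codivisor_dvd dvd_refl coprime(2)] D(1) odd
    by (intro cong_diff cong_refl sum_dedekind_num_mod_8) (simp_all only: coprime_mult_left_iff simp_thms)
  ultimately have "[Z = 9 * ?w * (1 - D) + 6 * (1 - P) - D * c * ?M] (mod 24)"
    using cong_24_if_cong_3_8[OF D(2) P] by blast
  then have "ee (of_int Z / of_int 24) = ee (of_int (9 * ?w * (1 - D) + 6 * (1 - P) - D * c * ?M) / of_int 24)"
    by (rule ee_eq_if_cong) simp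
  also have "\<dots> = ee (of_int (- (D * c * ?M)) / of_int 24) * ee (of_int (9 * ?w * (1 - D)) / 24) * ee (of_int (6 * (1 - P)) / 24)"
    unfolding ee_add[symmetric] by (intro arg_cong[where f = ee]) (simp add: field_simps)
  also have "ee (of_int (6 * (1 - P)) / 24) = of_int P" using P ee_half by auto
  also have "P = jacobi c D ^ nat \<bar>?w\<bar> * (kronecker D ?v * (if D mod 4 = 3 \<and> delta_of ?v = 1 then -1 else 1))"
    unfolding P_def prod_jacobi_codivisors[OF N coprime odd]
    using jacobi_eq_kronecker[OF varpi_pos[OF N] D(1) odd coprime_varpi] coprime(2) by (simp add: coprime_commute)
  finally show ?thesis
    unfolding char weight_factor_eq_eta_twist[OF odd, symmetric] of_int_mult by (simp only: mult_ac)
qed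

lemma Psi_in_Rats: "Psi \<gamma> \<in> \<rat>"
proof -
  have "sawtooth x \<in> \<rat>" if "x \<in> \<rat>" for x using that by (simp add: sawtooth_def)
  then have "dedekind_sum h k \<in> \<rat>" for h k
    unfolding dedekind_sum_def by (intro Rats_sum Rats_mult) simp_all
  then show ?thesis unfolding Psi_def by (cases \<gamma>) simp
qed

lemma ee_power: "ee z ^ n = ee (of_nat n * z)"
  by (simp add: ee_def exp_of_nat_mult[symmetric] mult_ac)

lemma eta_char_root_of_unity: "\<exists>n>0. eta_char r N \<gamma> 1 ^ n = 1"
proof -
  obtain A B C D where \<gamma>: "\<gamma> = (A, B, C, D)" by (metis prod_cases4)
  define q where "q = (1 / 24) * (\<Sum>n\<in>{n. n dvd N}. of_int (r n) * Psi (A, B * int n, C div int n, D))"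
  have "q \<in> \<rat>" unfolding q_def by (intro Rats_mult Rats_sum Psi_in_Rats Rats_of_int Rats_divide) simp_all
  then obtain a b :: int where ab: "b > 0" "q = of_int a / of_int b" by (rule Rats_cases')
  then have "of_nat (nat b) * of_real q = (of_int a :: complex)" by simp
  then have "eta_char r N \<gamma> 1 ^ nat b = 1"
    unfolding \<gamma> eta_char_def case_prod_conv q_def[symmetric] by (simp add: ee_power)
  then show ?thesis using ab(1) by (intro exI[of _ "nat b"]) simp
qed

section \<open>Fourier expansions on the upper half plane\<close>

lemma ee_nonzero [simp]: "ee z \<noteq> 0"
  by (simp add: ee_def)

lemma ee_power_int: "ee z powi n = ee (of_int n * z)"
  by (simp add: ee_def exp_power_int mult_ac)

lemma ee_sum: "finite A \<Longrightarrow> ee (\<Sum>x\<in>A. f x) = (\<Prod>x\<in>A. ee (f x))"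
  by (induction A rule: finite_induct) (simp_all add: ee_add)

lemma norm_ee: "norm (ee z) = exp (- 2 * pi * Im z)"
  by (simp add: ee_def)

lemma norm_ee_less_1: "z \<in> upper \<Longrightarrow> norm (ee z) < 1"
  by (simp add: norm_ee upper_def)


lemma convex_upper: "convex upper"
  unfolding upper_def by (rule convex_halfspace_Im_gt)

lemma upper_add_of_real_iff [simp]: "\<tau> + of_real x \<in> upper \<longleftrightarrow> \<tau> \<in> upper"
  by (simp add: upper_def)

lemma upper_affine:
  assumes "\<tau> \<in> upper" "a > 0" "d > (0 :: int)"
  shows "(of_int a * \<tau> + of_int b) / of_int d \<in> upper"
proof -
  have "(of_int a * \<tau> + of_int b) / of_int d = of_real (of_int a / of_int d) * \<tau> + of_real (of_int b / of_int d)"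
    by (simp add: add_divide_distrib)
  then show ?thesis using assms by (simp add: upper_def)
qed

definition tau_of_log :: "real \<Rightarrow> complex \<Rightarrow> complex" where
  "tau_of_log h w = of_real h * w / (2 * of_real pi * \<i>)"

lemma Im_tau_of_log: "Im (tau_of_log h w) = - h * Re w / (2 * pi)"
proof -
  have "tau_of_log h w = of_real (h / (2 * pi)) * (- \<i> * w)" by (simp add: tau_of_log_def field_simps)
  then show ?thesis by simp
qed

lemma tau_of_log_in_upper: "h > 0 \<Longrightarrow> Re w < 0 \<Longrightarrow> tau_of_log h w \<in> upper"
  by (simp add: upper_def Im_tau_of_log divide_neg_pos mult_pos_neg)

lemma ee_tau_of_log: "h > 0 \<Longrightarrow> ee (tau_of_log h w / of_real h) = exp w"
  by (simp add: ee_def tau_of_log_def)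

lemma ex_ee_eq:
  assumes "q \<noteq> 0" "norm q < 1" "h > 0"
  obtains \<tau> where "\<tau> \<in> upper" "ee (\<tau> / of_real h) = q"
  using assms that[of "tau_of_log h (Ln q)"] by (simp add: tau_of_log_in_upper ee_tau_of_log)

lemma powser_coeff_eq_0:
  fixes d :: "nat \<Rightarrow> complex"
  assumes "\<And>q. q \<noteq> 0 \<Longrightarrow> norm q < 1 \<Longrightarrow> (\<lambda>n. d n * q ^ n) sums 0"
  shows "d n = 0"
proof (induction n rule: less_induct)
  case (less n)
  have "(\<lambda>m. d (m + n) * q ^ m) sums 0" if q: "q \<noteq> 0" "norm q < 1" for q
  proof -
    have "(\<lambda>m. d (m + n) * q ^ (m + n)) sums (0 - (\<Sum>i<n. d i * q ^ i))"
      by (rule sums_split_initial_segment[OF assms[OF q]])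
    then have "(\<lambda>m. d (m + n) * q ^ (m + n) * inverse (q ^ n)) sums (0 * inverse (q ^ n))"
      using less by (intro sums_mult2) simp
    then show ?thesis using q by (simp add: power_add field_simps)
  qed
  then have "((\<lambda>_. 0) \<longlongrightarrow> d (0 + n)) (at (0 :: complex))"
    by (intro powser_limit_0_strong[of 1 "\<lambda>m. d (m + n)" "\<lambda>_. 0"]) auto
  then show ?case using tendsto_unique[OF trivial_limit_at _ tendsto_const] by fastforce
qed

lemma qseries_unique:
  assumes "\<And>\<tau>. \<tau> \<in> upper \<Longrightarrow> (\<lambda>n. c n * ee \<tau> ^ n) sums g \<tau>"
    and "\<And>\<tau>. \<tau> \<in> upper \<Longrightarrow> (\<lambda>n. c' n * ee \<tau> ^ n) sums g \<tau>"
  shows "c = c'"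
proof
  fix n
  have "c n - c' n = 0"
  proof (rule powser_coeff_eq_0)
    fix q :: complex assume "q \<noteq> 0" "norm q < 1"
    then obtain \<tau> where \<tau>: "\<tau> \<in> upper" "ee \<tau> = q" using ex_ee_eq[of q 1] by auto
    from sums_diff[OF assms(1)[OF \<tau>(1)] assms(2)[OF \<tau>(1)]]
    show "(\<lambda>n. (c n - c' n) * q ^ n) sums 0" using \<tau>(2) by (simp add: algebra_simps)
  qed
  then show "c n = c' n" by simp
qed

lemma qexp_eq_holomorphic:
  assumes h: "h > 0"
    and sums: "\<And>\<tau>. \<tau> \<in> upper \<Longrightarrow> (\<lambda>n. c n * ee (of_real ((of_nat n + \<kappa>) / h) * \<tau>)) sums g \<tau>"
  obtains S where "S holomorphic_on ball 0 1" "S 0 = c 0"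
    "\<And>\<tau>. \<tau> \<in> upper \<Longrightarrow> g \<tau> = ee (of_real (\<kappa> / h) * \<tau>) * S (ee (\<tau> / of_real h))"
proof -
  have split: "ee (of_real ((of_nat n + \<kappa>) / h) * \<tau>) = ee (of_real (\<kappa> / h) * \<tau>) * ee (\<tau> / of_real h) ^ n" for n \<tau>
    unfolding ee_power ee_add[symmetric] using h by (intro arg_cong[where f = ee]) (simp add: field_simps)
  have quotient_sums: "(\<lambda>n. c n * ee (\<tau> / of_real h) ^ n) sums (g \<tau> / ee (of_real (\<kappa> / h) * \<tau>))"
    if "\<tau> \<in> upper" for \<tau>
    using sums_divide[OF sums[OF that], of "ee (of_real (\<kappa> / h) * \<tau>)"] unfolding split by simp
  define S where "S = (\<lambda>q. \<Sum>n. c n * q ^ n)"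
  have "(\<lambda>n. c n * (q - 0) ^ n) sums S q" if "q \<in> ball 0 1" for q
  proof (cases "q = 0")
    case True
    then show ?thesis by (simp add: S_def)
  next
    case False
    then obtain \<tau> where "\<tau> \<in> upper" "ee (\<tau> / of_real h) = q" using ex_ee_eq[OF False _ h] \<open>q \<in> ball 0 1\<close> by auto
    from quotient_sums[OF this(1)] this(2) show ?thesis unfolding S_def by (simp add: sums_summable summable_sums)
  qed
  then have "S holomorphic_on ball 0 1" by (rule power_series_holomorphic)
  moreover have "S 0 = c 0" unfolding S_def by (rule powser_zero)
  moreover have "g \<tau> = ee (of_real (\<kappa> / h) * \<tau>) * S (ee (\<tau> / of_real h))" if "\<tau> \<in> upper" for \<tau>
    using sums_unique[OF quotient_sums[OF that]] unfolding S_def by (simp add: field_simps)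
  ultimately show ?thesis using that by blast
qed

lemma qexp_nonneg_bounded:
  assumes "qexp_nonneg g" "y > 0"
  obtains B where "\<And>\<tau>. Im \<tau> \<ge> y \<Longrightarrow> norm (g \<tau>) \<le> B"
proof -
  obtain h \<kappa> :: real and c where h: "h > 0" "\<kappa> \<ge> 0"
    and sums: "\<And>\<tau>. \<tau> \<in> upper \<Longrightarrow> (\<lambda>n. c n * ee (of_real ((of_nat n + \<kappa>) / h) * \<tau>)) sums g \<tau>"
    using assms(1) unfolding qexp_nonneg_def by blast
  obtain S where S: "S holomorphic_on ball 0 1"
    "\<And>\<tau>. \<tau> \<in> upper \<Longrightarrow> g \<tau> = ee (of_real (\<kappa> / h) * \<tau>) * S (ee (\<tau> / of_real h))"
    using qexp_eq_holomorphic[OF h(1) sums] by metis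
  define \<rho> where "\<rho> = exp (- 2 * pi * y / h)"
  have "\<rho> < 1" using assms(2) h by (simp add: \<rho>_def)
  then have "continuous_on (cball 0 \<rho>) S"
    by (intro holomorphic_on_imp_continuous_on[OF holomorphic_on_subset[OF S(1)]]) auto
  then have "compact (S ` cball 0 \<rho>)" by (rule compact_continuous_image) simp
  then obtain B where B: "\<And>q. q \<in> cball 0 \<rho> \<Longrightarrow> norm (S q) \<le> B"
    by (meson bounded_iff compact_imp_bounded imageI)
  have "norm (g \<tau>) \<le> B" if "Im \<tau> \<ge> y" for \<tau>
  proof -
    have "norm (ee (of_real (\<kappa> / h) * \<tau>)) \<le> 1"
      using that assms(2) h by (simp add: norm_ee zero_le_mult_iff)
    moreover have "norm (S (ee (\<tau> / of_real h))) \<le> B"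
      using that h by (intro B) (simp add: norm_ee \<rho>_def divide_right_mono)
    ultimately have "norm (ee (of_real (\<kappa> / h) * \<tau>)) * norm (S (ee (\<tau> / of_real h))) \<le> 1 * B"
      by (intro mult_mono) auto
    moreover have "\<tau> \<in> upper" using that assms(2) by (simp add: upper_def)
    ultimately show ?thesis using S(2) by (simp add: norm_mult)
  qed
  then show ?thesis using that by blast
qed

lemma tendsto_ee_imaginary_axis:
  assumes "a > 0"
  shows "((\<lambda>y. ee (of_real a * (\<i> * of_real y))) \<longlongrightarrow> 0) at_top"
proof (rule tendsto_norm_zero_cancel)
  have "((\<lambda>y. exp (- (2 * pi * a * y))) \<longlongrightarrow> 0) at_top"
    using assms by real_asymp
  then show "((\<lambda>y. norm (ee (of_real a * (\<i> * of_real y)))) \<longlongrightarrow> 0) at_top" by (simp add: norm_ee mult_ac)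
qed

lemma qexp_tendsto_constant_term:
  assumes h: "h > 0" "\<kappa> \<ge> 0"
    and sums: "\<And>\<tau>. \<tau> \<in> upper \<Longrightarrow> (\<lambda>n. c n * ee (of_real ((of_nat n + \<kappa>) / h) * \<tau>)) sums g \<tau>"
  shows "((\<lambda>y. g (\<i> * of_real y)) \<longlongrightarrow> (if \<kappa> = 0 then c 0 else 0)) at_top"
proof -
  obtain S where S: "S holomorphic_on ball 0 1" "S 0 = c 0"
    "\<And>\<tau>. \<tau> \<in> upper \<Longrightarrow> g \<tau> = ee (of_real (\<kappa> / h) * \<tau>) * S (ee (\<tau> / of_real h))"
    using qexp_eq_holomorphic[OF h(1) sums] by metis
  have "isCont S 0"
    using holomorphic_on_imp_continuous_on[OF S(1)] by (simp add: continuous_on_eq_continuous_at)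
  moreover have "((\<lambda>y. ee (\<i> * of_real y / of_real h)) \<longlongrightarrow> 0) at_top"
    using tendsto_ee_imaginary_axis[of "1 / h"] h(1) by simp
  ultimately have lim_S: "((\<lambda>y. S (ee (\<i> * of_real y / of_real h))) \<longlongrightarrow> c 0) at_top"
    using isCont_tendsto_compose S(2) by metis
  have "((\<lambda>y. ee (of_real (\<kappa> / h) * (\<i> * of_real y)) * S (ee (\<i> * of_real y / of_real h)))
      \<longlongrightarrow> (if \<kappa> = 0 then c 0 else 0)) at_top"
  proof (cases "\<kappa> = 0")
    case False
    then show ?thesis using tendsto_mult[OF tendsto_ee_imaginary_axis[of "\<kappa> / h"] lim_S] h by simp
  qed (use lim_S in simp)
  then show ?thesis
    by (rule Lim_transform_eventually)
       (auto intro!: eventually_mono[OF eventually_gt_at_top[of 0]] simp: S(3) upper_def)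
qed

lemma qexp_pos_tendsto_0:
  assumes "qexp_pos g"
  shows "((\<lambda>y. g (\<i> * of_real y)) \<longlongrightarrow> 0) at_top"
proof -
  obtain h \<kappa> :: real and c where h: "h > 0" "\<kappa> \<ge> 0" and pos: "\<And>n. c n \<noteq> 0 \<Longrightarrow> of_nat n + \<kappa> > 0"
    and sums: "\<And>\<tau>. \<tau> \<in> upper \<Longrightarrow> (\<lambda>n. c n * ee (of_real ((of_nat n + \<kappa>) / h) * \<tau>)) sums g \<tau>"
    using assms unfolding qexp_pos_def by blast
  have "(if \<kappa> = 0 then c 0 else 0) = 0" using pos[of 0] by auto
  then show ?thesis using qexp_tendsto_constant_term[OF h sums] by simp
qed

lemma holomorphic_on_if_comp_exp:
  assumes T: "open T" "0 \<notin> T" and hol: "(\<lambda>w. P (exp w)) holomorphic_on exp -` T"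
  shows "P holomorphic_on T"
proof -
  have "P field_differentiable at q0" if q0: "q0 \<in> T" for q0
  proof -
    have nonzero: "q0 \<noteq> 0" using q0 T(2) by auto
    \<comment> \<open>a branch of the logarithm near \<open>q0\<close>\<close>
    define L where "L = (\<lambda>q. Ln (q / q0) + Ln q0)"
    have exp_L: "exp (L q) = q" if "q \<noteq> 0" for q using that nonzero by (simp add: L_def exp_add)
    have L_differentiable: "L field_differentiable at q0"
      unfolding L_def using nonzero
      by (intro derivative_intros field_differentiable_compose[of "\<lambda>q. q / q0" _ Ln, unfolded o_def]
          field_differentiable_at_Ln) (auto simp: complex_nonpos_Reals_iff)
    have "open (exp -` T)" by (rule open_vimage[OF T(1) continuous_on_exp[OF continuous_on_id]])
    moreover have "L q0 \<in> exp -` T" by (rule vimageI2) (simp add: exp_L[OF nonzero] q0)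
    ultimately have "(\<lambda>w. P (exp w)) field_differentiable at (L q0)"
      by (rule holomorphic_on_imp_differentiable_at[OF hol])
    with L_differentiable have "(\<lambda>q. P (exp (L q))) field_differentiable at q0"
      using field_differentiable_compose[of L q0 "\<lambda>w. P (exp w)"] by (simp add: o_def)
    then obtain D where D: "((\<lambda>q. P (exp (L q))) has_field_derivative D) (at q0)"
      unfolding field_differentiable_def ..
    have "\<forall>\<^sub>F q in nhds q0. q \<in> - {0}" using nonzero by (intro eventually_nhds_in_open) auto
    then have ev: "\<forall>\<^sub>F q in nhds q0. P (exp (L q)) = P q" by eventually_elim (simp add: exp_L)
    show ?thesis using D unfolding field_differentiable_def DERIV_cong_ev[OF refl ev refl] by (rule exI)
  qed
  then show ?thesis by (simp add: holomorphic_on_def field_differentiable_at_within)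
qed

lemma periodic_holomorphic_eq_function_of_ee:
  assumes h: "h > 0" and hol: "g holomorphic_on upper"
    and periodic: "\<And>\<tau>. \<tau> \<in> upper \<Longrightarrow> g (\<tau> + of_real h) = g \<tau>"
  obtains P where "P holomorphic_on ball 0 1 - {0}" "\<And>\<tau>. \<tau> \<in> upper \<Longrightarrow> P (ee (\<tau> / of_real h)) = g \<tau>"
proof -
  interpret periodic_fun_simple "on_upper g" "of_real h"
    using periodic by unfold_locales (simp add: on_upper_def)
  define P where "P = (\<lambda>q. on_upper g (tau_of_log h (Ln q)))"
  have P_exp: "P (exp w) = on_upper g (tau_of_log h w)" for w
  proof -
    have "exp (Ln (exp w)) = exp w" by simp
    then obtain n where "Ln (exp w) = w + of_int (2 * n) * of_real pi * \<i>" unfolding exp_eq by auto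
    then have "tau_of_log h (Ln (exp w)) = tau_of_log h w + of_int n * of_real h"
      by (simp add: tau_of_log_def field_simps)
    then show ?thesis by (simp only: P_def plus_of_int)
  qed
  have "on_upper g holomorphic_on upper"
    by (rule holomorphic_transform[OF hol]) (simp add: on_upper_def)
  moreover have "tau_of_log h holomorphic_on exp -` (ball 0 1 - {0})"
    unfolding tau_of_log_def by (intro holomorphic_intros) auto
  moreover have "tau_of_log h ` (exp -` (ball 0 1 - {0})) \<subseteq> upper"
    by (rule image_subsetI) (rule tau_of_log_in_upper[OF h], simp)
  ultimately have "(on_upper g \<circ> tau_of_log h) holomorphic_on exp -` (ball 0 1 - {0})"
    by (intro holomorphic_on_compose_gen)
  then have "P holomorphic_on ball 0 1 - {0}"
    using holomorphic_on_if_comp_exp[of "ball 0 1 - {0}" P] by (simp add: P_exp o_def open_delete)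
  moreover have "P (ee (\<tau> / of_real h)) = g \<tau>" if "\<tau> \<in> upper" for \<tau>
  proof -
    define w where "w = 2 * of_real pi * \<i> * (\<tau> / of_real h)"
    have "tau_of_log h w = \<tau>" using h by (simp add: tau_of_log_def w_def)
    then show ?thesis using P_exp[of w] that by (simp add: ee_def w_def on_upper_def)
  qed
  ultimately show ?thesis using that by blast
qed

lemma periodic_bounded_expansion:
  assumes h: "h > 0" and hol: "g holomorphic_on upper"
    and periodic: "\<And>\<tau>. \<tau> \<in> upper \<Longrightarrow> g (\<tau> + of_real h) = g \<tau>"
    and y: "y > 0" and bounded: "\<And>\<tau>. Im \<tau> \<ge> y \<Longrightarrow> norm (g \<tau>) \<le> B"
  obtains c where "\<And>\<tau>. \<tau> \<in> upper \<Longrightarrow> (\<lambda>n. c n * ee (\<tau> / of_real h) ^ n) sums g \<tau>"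
proof -
  obtain P where P: "P holomorphic_on ball 0 1 - {0}" "\<And>\<tau>. \<tau> \<in> upper \<Longrightarrow> P (ee (\<tau> / of_real h)) = g \<tau>"
    by (rule periodic_holomorphic_eq_function_of_ee[OF h hol]) (erule periodic, rule that)
  define \<rho> where "\<rho> = exp (- 2 * pi * y / h)"
  have "\<forall>\<^sub>F q in at 0. norm q < \<rho> \<and> q \<noteq> (0 :: complex)"
    unfolding eventually_at by (intro exI[of _ \<rho>]) (auto simp: \<rho>_def)
  then have "\<forall>\<^sub>F q in at 0. norm (P q) \<le> B"
  proof eventually_elim
    case (elim q)
    have "\<rho> < 1" using y h by (simp add: \<rho>_def)
    then have "norm q < 1" "q \<noteq> 0" using elim by simp_all
    then obtain \<tau> where \<tau>: "\<tau> \<in> upper" "ee (\<tau> / of_real h) = q" using ex_ee_eq h by blast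
    then have "norm (ee (\<tau> / of_real h)) < \<rho>" using elim by simp
    then have "2 * pi / h * y < 2 * pi / h * Im \<tau>" unfolding norm_ee \<rho>_def exp_less_cancel_iff by simp
    then have "y < Im \<tau>" by (rule mult_less_cancel_left_pos[THEN iffD1, rotated]) (use h in simp)
    then have "norm (g \<tau>) \<le> B" by (intro bounded) simp
    then show ?case using P(2)[OF \<tau>(1)] \<tau>(2) by simp
  qed
  then obtain G where G: "G holomorphic_on ball 0 1" "\<And>z. z \<in> ball 0 1 - {0} \<Longrightarrow> G z = P z"
    using holomorphic_on_extend_bounded[OF P(1)] by auto
  have "(\<lambda>n. (deriv ^^ n) G 0 / fact n * ee (\<tau> / of_real h) ^ n) sums g \<tau>" if \<tau>: "\<tau> \<in> upper" for \<tau>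
  proof -
    have "\<tau> / of_real h \<in> upper" using \<tau> h by (simp add: upper_def Im_divide_of_real)
    then have ball: "ee (\<tau> / of_real h) \<in> ball 0 1" using norm_ee_less_1 by simp
    then have "G (ee (\<tau> / of_real h)) = g \<tau>" using G(2) P(2)[OF \<tau>] by simp
    then show ?thesis using holomorphic_power_series[OF G(1) ball] by simp
  qed
  then show ?thesis by (rule that)
qed

section \<open>The product expansion of an eta-quotient\<close>

definition euler_prod :: "complex \<Rightarrow> complex" where
  "euler_prod q = (\<Prod>n. 1 - q ^ Suc n)"

lemma norm_power_less_1: "norm (q :: complex) < 1 \<Longrightarrow> n > 0 \<Longrightarrow> norm (q ^ n) < 1"
  unfolding norm_power using power_Suc_less_one[of "norm q" "n - 1"] by (cases "q = 0") (simp_all add: power_0_left)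

lemma one_minus_power_nonzero: "norm (q :: complex) < 1 \<Longrightarrow> 1 - q ^ Suc n \<noteq> 0"
  using norm_power_less_1[of q "Suc n"] by (metis less_irrefl norm_one right_minus_eq zero_less_Suc)

lemma convergent_euler_prod:
  assumes "norm (q :: complex) < 1"
  shows "convergent_prod (\<lambda>n. 1 - q ^ Suc n)"
proof -
  have "summable (\<lambda>n. norm q * norm q ^ n)" using assms by (intro summable_mult summable_geometric) simp
  then have "summable (\<lambda>n. norm ((1 - q ^ Suc n) - 1))" by (simp add: norm_mult norm_power)
  then show ?thesis
    using abs_convergent_prod_conv_summable abs_convergent_prod_imp_convergent_prod by blast
qed

lemma euler_prod_nonzero: "norm q < 1 \<Longrightarrow> euler_prod q \<noteq> 0"
  unfolding euler_prod_def by (rule prodinf_nonzero[OF convergent_euler_prod one_minus_power_nonzero])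

lemma euler_prod_0 [simp]: "euler_prod 0 = 1"
  by (simp add: euler_prod_def)

lemma uniform_limit_euler_prod:
  assumes "\<rho> < 1" "0 \<le> \<rho>"
  shows "uniform_limit (cball 0 \<rho>) (\<lambda>n q. \<Prod>k<n. 1 - q ^ Suc k) euler_prod sequentially"
proof -
  have "uniformly_convergent_on (cball 0 \<rho>) (\<lambda>n q. \<Prod>k<n. 1 - q ^ Suc k :: complex)"
  proof (rule uniformly_convergent_on_prod')
    show "uniformly_convergent_on (cball 0 \<rho>) (\<lambda>N x. \<Sum>n<N. norm (1 - x ^ Suc n - 1 :: complex))"
    proof (rule Weierstrass_m_test')
      fix n and x :: complex assume "x \<in> cball 0 \<rho>"
      then have "norm x ^ Suc n \<le> \<rho> ^ Suc n" by (intro power_mono) auto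
      then show "norm (norm (1 - x ^ Suc n - 1)) \<le> \<rho> ^ Suc n" by (simp add: norm_power norm_mult)
    next
      have "summable (\<lambda>n. \<rho> * \<rho> ^ n)" using assms by (intro summable_mult summable_geometric) simp
      then show "summable (\<lambda>n. \<rho> ^ Suc n)" by simp
    qed
  qed (auto intro!: continuous_intros)
  then have uniform_limit: "uniform_limit (cball 0 \<rho>) (\<lambda>n q. \<Prod>k<n. 1 - q ^ Suc k :: complex)
      (\<lambda>q. lim (\<lambda>n. \<Prod>k<n. 1 - q ^ Suc k)) sequentially"
    by (simp only: uniformly_convergent_uniform_limit_iff)
  have "lim (\<lambda>n. \<Prod>k<n. 1 - q ^ Suc k) = euler_prod q" if "q \<in> cball 0 \<rho>" for q :: complex
    unfolding euler_prod_def using that assms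
    by (intro prodinf_eq_lim'[symmetric] convergent_euler_prod one_minus_power_nonzero) auto
  with uniform_limit show ?thesis
    using uniform_limit_cong'[OF refl, of "cball 0 \<rho>" "\<lambda>q. lim (\<lambda>n. \<Prod>k<n. 1 - q ^ Suc k)" euler_prod] by blast
qed

lemma holomorphic_euler_prod: "euler_prod holomorphic_on ball 0 1"
proof (rule holomorphic_uniform_sequence[where f = "\<lambda>n q. \<Prod>k<n. 1 - q ^ Suc k"])
  fix x :: complex assume x: "x \<in> ball 0 1"
  define d where "d = (1 - norm x) / 2"
  have d: "d > 0" "norm x + d < 1" using x by (simp_all add: d_def field_simps)
  have sub: "cball x d \<subseteq> cball 0 (norm x + d)" by (rule cball_subset_cball_iff[THEN iffD2]) simp
  then have "uniform_limit (cball x d) (\<lambda>n q. \<Prod>k<n. 1 - q ^ Suc k) euler_prod sequentially"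
    using d by (intro uniform_limit_on_subset[OF uniform_limit_euler_prod]) auto
  moreover have "cball x d \<subseteq> ball 0 1" using sub d(2) by auto
  ultimately show "\<exists>d>0. cball x d \<subseteq> ball 0 1 \<and>
      uniform_limit (cball x d) (\<lambda>n q. \<Prod>k<n. 1 - q ^ Suc k) euler_prod sequentially"
    using d(1) by blast
qed (auto intro!: holomorphic_intros)

lemma has_field_derivative_euler_prod_0: "(euler_prod has_field_derivative -1) (at 0)"
proof -
  have "uniform_limit (ball 0 (1 / 2)) (\<lambda>n q. \<Prod>k<n. 1 - q ^ Suc k) euler_prod sequentially"
    by (rule uniform_limit_on_subset[OF uniform_limit_euler_prod[of "1 / 2"]]) auto
  then have "(\<lambda>k. deriv (\<lambda>q. 1 - q ^ Suc k) 0 / (1 - 0 ^ Suc k)) sums (deriv euler_prod 0 / euler_prod 0)"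
    by (rule logderiv_prodinf_complex_uniform_limit) (auto intro!: holomorphic_intros)
  moreover have "deriv (\<lambda>q. 1 - q ^ Suc k) 0 = (if k = 0 then -1 else 0 :: complex)" for k
    by (rule DERIV_imp_deriv) (auto intro!: derivative_eq_intros)
  ultimately have "(\<lambda>k. if k = 0 then -1 else 0) sums deriv euler_prod 0" by simp
  then have "deriv euler_prod 0 = -1" using sums_unique2 sums_single[of 0 "\<lambda>_. -1"] by blast
  moreover have "(euler_prod has_field_derivative deriv euler_prod 0) (at 0)"
    by (rule holomorphic_derivI[OF holomorphic_euler_prod]) auto
  ultimately show ?thesis by simp
qed

definition euler_quotient :: "(nat \<Rightarrow> int) \<Rightarrow> nat \<Rightarrow> complex \<Rightarrow> complex" where
  "euler_quotient r N q = (\<Prod>n\<in>{n. n dvd N}. euler_prod (q ^ n) powi r n)"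

lemma eta_quotient_eq_euler_quotient:
  assumes N: "N > 0" and sum0: "(\<Sum>n\<in>{n. n dvd N}. int n * r n) = 0"
  shows "eta_quotient r N \<tau> = euler_quotient r N (ee \<tau>)"
proof -
  let ?S = "{n. n dvd N}"
  have "eta (of_nat n * \<tau>) powi r n = ee (of_int (int n * r n) * (\<tau> / 24)) * euler_prod (ee \<tau> ^ n) powi r n" for n
    unfolding eta_def euler_prod_def power_int_mult_distrib ee_power_int ee_power by (simp add: mult_ac)
  then have "eta_quotient r N \<tau> = (\<Prod>n\<in>?S. ee (of_int (int n * r n) * (\<tau> / 24))) * euler_quotient r N (ee \<tau>)"
    unfolding eta_quotient_def euler_quotient_def prod.distrib[symmetric] by (rule prod.cong[OF refl])
  also have "(\<Prod>n\<in>?S. ee (of_int (int n * r n) * (\<tau> / 24))) = ee (of_int (\<Sum>n\<in>?S. int n * r n) * (\<tau> / 24))"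
    unfolding of_int_sum sum_distrib_right using N by (intro ee_sum[symmetric]) simp
  finally show ?thesis unfolding sum0 by simp
qed

lemma euler_quotient_nonzero: "N > 0 \<Longrightarrow> norm q < 1 \<Longrightarrow> euler_quotient r N q \<noteq> 0"
  using euler_prod_nonzero[OF norm_power_less_1[OF _ divisor_pos]] by (simp add: euler_quotient_def)

lemma eta_quotient_nonzero:
  assumes "N > 0" "(\<Sum>n\<in>{n. n dvd N}. int n * r n) = 0" "\<tau> \<in> upper"
  shows "eta_quotient r N \<tau> \<noteq> 0"
  using eta_quotient_eq_euler_quotient[OF assms(1,2)] euler_quotient_nonzero[OF assms(1) norm_ee_less_1[OF assms(3)]]
  by simp

lemma holomorphic_euler_quotient:
  assumes "N > 0"
  shows "euler_quotient r N holomorphic_on ball 0 1"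
  unfolding euler_quotient_def
proof (intro holomorphic_on_prod holomorphic_on_power_int)
  fix n assume "n \<in> {n. n dvd N}"
  then have n: "n > 0" by (rule divisor_pos[OF assms])
  have "(euler_prod \<circ> (\<lambda>q. q ^ n)) holomorphic_on ball 0 1"
    by (rule holomorphic_on_compose_gen[OF _ holomorphic_euler_prod])
      (use norm_power_less_1[OF _ n] in \<open>auto intro!: holomorphic_intros\<close>)
  then show "(\<lambda>q. euler_prod (q ^ n)) holomorphic_on ball 0 1" by (simp add: o_def)
  show "0 \<le> r n \<or> (\<forall>z\<in>ball 0 1. euler_prod (z ^ n) \<noteq> 0)"
    using euler_prod_nonzero[OF norm_power_less_1[OF _ n]] by simp
qed

lemma
  assumes "N > 0"
  shows euler_quotient_0: "euler_quotient r N 0 = 1"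
    and has_field_derivative_euler_quotient_0: "(euler_quotient r N has_field_derivative - of_int (r 1)) (at 0)"
proof -
  let ?S = "{n. n dvd N}"
  have factor_0: "euler_prod (0 ^ n) powi r n = 1" if "n \<in> ?S" for n
    using divisor_pos[OF assms that] by (simp add: power_0_left)
  then show value_0: "euler_quotient r N 0 = 1" by (simp add: euler_quotient_def)
  have "((\<lambda>q. euler_prod (q ^ n) powi r n) has_field_derivative (if n = 1 then - of_int (r n) else 0)) (at 0)"
    if "n \<in> ?S" for n
  proof -
    have n: "n > 0" by (rule divisor_pos[OF assms that])
    then have "(euler_prod has_field_derivative -1) (at (0 ^ n))"
      using has_field_derivative_euler_prod_0 by (simp add: power_0_left)
    moreover have "((\<lambda>q. q ^ n) has_field_derivative of_nat n * 0 ^ (n - 1)) (at (0 :: complex))"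
      by (auto intro!: derivative_eq_intros)
    ultimately have "((\<lambda>q. euler_prod (q ^ n)) has_field_derivative -1 * (of_nat n * 0 ^ (n - 1))) (at 0)"
      by (rule DERIV_chain2[of euler_prod _ "\<lambda>q. q ^ n"])
    then have "((\<lambda>q. euler_prod (q ^ n) powi r n) has_field_derivative
        of_int (r n) * euler_prod (0 ^ n) powi (r n - 1) * (-1 * (of_nat n * 0 ^ (n - 1)))) (at 0)"
      using n by (intro DERIV_power_int) (simp_all add: power_0_left)
    then show ?thesis using n by (cases "n = 1") (simp_all add: power_0_left)
  qed
  then have "((\<lambda>q. \<Prod>n\<in>?S. euler_prod (q ^ n) powi r n) has_field_derivative
      (\<Prod>n\<in>?S. euler_prod (0 ^ n) powi r n) *
      (\<Sum>n\<in>?S. (if n = 1 then - of_int (r n) else 0) / euler_prod (0 ^ n) powi r n)) (at 0)"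
    by (intro has_field_derivative_prod') (simp_all add: factor_0)
  moreover have "(\<Sum>n\<in>?S. (if n = 1 then - of_int (r n) else 0) / euler_prod (0 ^ n) powi r n) =
      (\<Sum>n\<in>?S. if n = 1 then - of_int (r n) else 0)"
    by (intro sum.cong refl) (simp only: factor_0 div_by_1)
  moreover have "(\<Sum>n\<in>?S. if n = 1 then - of_int (r n) else 0) = (- of_int (r 1) :: complex)"
    using assms by simp
  moreover have "(\<lambda>q. \<Prod>n\<in>?S. euler_prod (q ^ n) powi r n) = euler_quotient r N"
    by (simp add: euler_quotient_def fun_eq_iff)
  ultimately show "(euler_quotient r N has_field_derivative - of_int (r 1)) (at 0)"
    using value_0 unfolding euler_quotient_def by (simp only: mult_1)
qed

lemma
  assumes N: "N > 0" and sum0: "(\<Sum>n\<in>{n. n dvd N}. int n * r n) = 0"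
  shows eta_coeff_sums: "\<tau> \<in> upper \<Longrightarrow> (\<lambda>n. eta_coeff r N n * ee \<tau> ^ n) sums eta_quotient r N \<tau>"
    and eta_coeff_0: "eta_coeff r N 0 = 1"
    and eta_coeff_1: "eta_coeff r N 1 = - of_int (r 1)"
proof -
  define c where "c = (\<lambda>n. (deriv ^^ n) (euler_quotient r N) 0 / fact n)"
  have sums: "(\<lambda>n. c n * ee \<tau> ^ n) sums eta_quotient r N \<tau>" if "\<tau> \<in> upper" for \<tau>
    using holomorphic_power_series[OF holomorphic_euler_quotient[OF N], of "ee \<tau>" r] norm_ee_less_1[OF that]
    unfolding eta_quotient_eq_euler_quotient[OF N sum0] c_def by simp
  have eq: "eta_coeff r N = c"
    unfolding eta_coeff_def using sums by (intro the_equality) (auto intro: qseries_unique)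
  show "\<tau> \<in> upper \<Longrightarrow> (\<lambda>n. eta_coeff r N n * ee \<tau> ^ n) sums eta_quotient r N \<tau>" using sums eq by simp
  show "eta_coeff r N 0 = 1" "eta_coeff r N 1 = - of_int (r 1)"
    unfolding eq c_def using euler_quotient_0[OF N] DERIV_imp_deriv[OF has_field_derivative_euler_quotient_0[OF N]]
    by simp_all
qed

section \<open>The action of integer matrices on the upper half plane\<close>

fun mat_mult :: "mat2 \<Rightarrow> mat2 \<Rightarrow> mat2" (infixl "\<odot>" 70) where
  "(a, b, c, d) \<odot> (a', b', c', d') = (a * a' + b * c', a * b' + b * d', c * a' + d * c', c * b' + d * d')"

fun mat_det :: "mat2 \<Rightarrow> int" where
  "mat_det (a, b, c, d) = a * d - b * c"

fun mat_adj :: "mat2 \<Rightarrow> mat2" where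
  "mat_adj (a, b, c, d) = (d, - b, - c, a)"

fun denom :: "mat2 \<Rightarrow> complex \<Rightarrow> complex" where
  "denom (a, b, c, d) \<tau> = of_int c * \<tau> + of_int d"

lemma mat_mult_assoc: "\<alpha> \<odot> \<beta> \<odot> \<gamma> = \<alpha> \<odot> (\<beta> \<odot> \<gamma>)"
  by (cases \<alpha>; cases \<beta>; cases \<gamma>) (simp add: algebra_simps)

lemma mat_mult_1_right [simp]: "\<gamma> \<odot> (1, 0, 0, 1) = \<gamma>"
  by (cases \<gamma>) simp

lemma mat_mult_1_left [simp]: "(1, 0, 0, 1) \<odot> \<gamma> = \<gamma>"
  by (cases \<gamma>) simp

lemma mat_det_mult: "mat_det (\<gamma> \<odot> \<delta>) = mat_det \<gamma> * mat_det \<delta>"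
  by (cases \<gamma>; cases \<delta>) (simp add: algebra_simps)

lemma mat_det_adj [simp]: "mat_det (mat_adj \<gamma>) = mat_det \<gamma>"
  by (cases \<gamma>) (simp add: algebra_simps)

lemma mat_mult_adj: "mat_det \<gamma> = 1 \<Longrightarrow> \<gamma> \<odot> mat_adj \<gamma> = (1, 0, 0, 1)"
  by (cases \<gamma>) (simp add: algebra_simps)

lemma mat_adj_mult: "mat_det \<gamma> = 1 \<Longrightarrow> mat_adj \<gamma> \<odot> \<gamma> = (1, 0, 0, 1)"
  by (cases \<gamma>) (simp add: algebra_simps)

lemma Gamma0_iff [simp]: "(a, b, c, d) \<in> Gamma0 N \<longleftrightarrow> a * d - b * c = 1 \<and> int N dvd c"
  by (simp add: Gamma0_def)

lemma mat_det_Gamma0: "\<gamma> \<in> Gamma0 N \<Longrightarrow> mat_det \<gamma> = 1"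
  by (cases \<gamma>) simp

lemma Gamma0_1_iff: "\<gamma> \<in> Gamma0 1 \<longleftrightarrow> mat_det \<gamma> = 1"
  by (cases \<gamma>) simp

lemma denom_nonzero:
  assumes "mat_det \<gamma> \<noteq> 0" "\<tau> \<in> upper"
  shows "denom \<gamma> \<tau> \<noteq> 0"
proof (cases \<gamma>)
  case (fields a b c d)
  show ?thesis
  proof (cases "c = 0")
    case True
    then show ?thesis using assms(1) by (auto simp: fields)
  next
    case False
    then have "Im (denom \<gamma> \<tau>) \<noteq> 0" using assms(2) by (simp add: fields upper_def)
    then show ?thesis by force
  qed
qed

lemma moeb_in_upper:
  assumes "mat_det \<gamma> > 0" "\<tau> \<in> upper"
  shows "moeb \<gamma> \<tau> \<in> upper"
proof (cases \<gamma>)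
  case (fields a b c d)
  let ?z = "denom \<gamma> \<tau>"
  have "?z \<noteq> 0" using assms by (intro denom_nonzero) simp_all
  then have pos: "(Re ?z)\<^sup>2 + (Im ?z)\<^sup>2 > 0" by (metis complex_neq_0)
  have "Im (of_int a * \<tau> + of_int b) * Re ?z - Re (of_int a * \<tau> + of_int b) * Im ?z = of_int (mat_det \<gamma>) * Im \<tau>"
    by (simp add: fields algebra_simps)
  then have "Im (moeb \<gamma> \<tau>) = of_int (mat_det \<gamma>) * Im \<tau> / ((Re ?z)\<^sup>2 + (Im ?z)\<^sup>2)"
    unfolding fields moeb_def case_prod_conv Im_divide denom.simps by simp
  then show ?thesis using pos assms by (simp add: upper_def)
qed

lemma
  assumes "mat_det \<delta> \<noteq> 0" "\<tau> \<in> upper"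
  shows denom_mult: "denom (\<gamma> \<odot> \<delta>) \<tau> = denom \<gamma> (moeb \<delta> \<tau>) * denom \<delta> \<tau>"
    and moeb_mult: "moeb (\<gamma> \<odot> \<delta>) \<tau> = moeb \<gamma> (moeb \<delta> \<tau>)"
proof -
  obtain a b c d a' b' c' d' where \<gamma>: "\<gamma> = (a, b, c, d)" and \<delta>: "\<delta> = (a', b', c', d')" by (metis prod_cases4)
  have z: "of_int c' * \<tau> + of_int d' \<noteq> 0" using denom_nonzero[OF assms] by (simp add: \<delta>)
  then show "denom (\<gamma> \<odot> \<delta>) \<tau> = denom \<gamma> (moeb \<delta> \<tau>) * denom \<delta> \<tau>"
    by (simp add: \<gamma> \<delta> moeb_def field_simps)
  have "moeb \<gamma> (moeb \<delta> \<tau>) = (of_int a * (of_int a' * \<tau> + of_int b') + of_int b * (of_int c' * \<tau> + of_int d')) /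
      (of_int c * (of_int a' * \<tau> + of_int b') + of_int d * (of_int c' * \<tau> + of_int d'))"
    using z by (simp add: \<gamma> \<delta> moeb_def add_divide_eq_iff divide_simps)
  then show "moeb (\<gamma> \<odot> \<delta>) \<tau> = moeb \<gamma> (moeb \<delta> \<tau>)" by (simp add: \<gamma> \<delta> moeb_def algebra_simps)
qed

lemma moeb_triangular [simp]: "moeb (a, b, 0, d) \<tau> = (of_int a * \<tau> + of_int b) / of_int d"
  by (simp add: moeb_def)


lemma moeb_holomorphic:
  assumes "mat_det \<gamma> > 0"
  shows "moeb \<gamma> holomorphic_on upper"
proof (cases \<gamma>)
  case (fields a b c d)
  have "of_int c * \<tau> + of_int d \<noteq> (0 :: complex)" if "\<tau> \<in> upper" for \<tau>
    using denom_nonzero[OF _ that, of \<gamma>] assms by (simp add: fields)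
  then show ?thesis unfolding fields moeb_def case_prod_conv by (intro holomorphic_intros) auto
qed

lemma csqrt_denom_holomorphic:
  shows "(\<lambda>\<tau>. csqrt (denom \<gamma> \<tau>)) holomorphic_on upper"
proof (cases \<gamma>)
  case (fields a b c d)
  show ?thesis
  proof (cases "c = 0")
    case False
    then have "of_int c * \<tau> + of_int d \<notin> \<real>\<^sub>\<le>\<^sub>0" if "\<tau> \<in> upper" for \<tau>
      using that by (simp add: complex_nonpos_Reals_iff upper_def)
    then show ?thesis unfolding fields denom.simps by (intro holomorphic_on_csqrt' holomorphic_intros)
  qed (simp add: fields)
qed

section \<open>The slash action\<close>

lemma slash_eq: "slash w \<gamma> 1 g \<tau> = csqrt (denom \<gamma> \<tau>) powi (- w) * g (moeb \<gamma> \<tau>)"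
  by (cases \<gamma>) (simp add: slash_def)

lemma slash_eq_slash_1: "slash w \<gamma> \<epsilon> g \<tau> = of_int \<epsilon> powi (- w) * slash w \<gamma> 1 g \<tau>"
  by (cases \<gamma>) (simp add: slash_def power_int_mult_distrib)

lemma slash_identity: "slash w (1, 0, 0, 1) 1 g \<tau> = g \<tau>"
  by (simp add: slash_def)

lemma slash_translation: "slash w (\<sigma> \<odot> (1, n, 0, 1)) 1 g \<tau> = slash w \<sigma> 1 g (\<tau> + of_int n)"
  by (cases \<sigma>) (simp add: slash_def moeb_def algebra_simps)

lemma slash_holomorphic:
  assumes "mat_det \<gamma> > 0" "g holomorphic_on upper"
  shows "slash w \<gamma> 1 g holomorphic_on upper"
proof -
  have "(g \<circ> moeb \<gamma>) holomorphic_on upper"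
    by (rule holomorphic_on_compose_gen[OF moeb_holomorphic assms(2)]) (use assms(1) moeb_in_upper[OF assms(1)] in auto)
  moreover have "(\<lambda>\<tau>. csqrt (denom \<gamma> \<tau>) powi (- w)) holomorphic_on upper"
    using denom_nonzero[of \<gamma>] assms(1) by (intro holomorphic_on_power_int csqrt_denom_holomorphic) auto
  ultimately have "(\<lambda>\<tau>. csqrt (denom \<gamma> \<tau>) powi (- w) * (g \<circ> moeb \<gamma>) \<tau>) holomorphic_on upper"
    by (rule holomorphic_on_mult[rotated])
  then show ?thesis by (rule holomorphic_transform) (simp add: slash_eq)
qed

text \<open>The sign in the cocycle relation for \<open>csqrt \<circ> denom\<close> is constant, being continuous on the upper half plane.\<close>
lemma slash_mult:
  assumes "mat_det \<gamma> = 1" "mat_det \<sigma> = 1"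
  obtains \<epsilon> where "\<epsilon> = 1 \<or> \<epsilon> = -1"
    "\<And>g \<tau>. \<tau> \<in> upper \<Longrightarrow> slash w (\<gamma> \<odot> \<sigma>) 1 g \<tau> = \<epsilon> * slash w \<sigma> 1 (slash w \<gamma> 1 g) \<tau>"
proof -
  define u where "u = (\<lambda>\<tau>. csqrt (denom \<gamma> (moeb \<sigma> \<tau>)) * csqrt (denom \<sigma> \<tau>) / csqrt (denom (\<gamma> \<odot> \<sigma>) \<tau>))"
  have det: "mat_det (\<gamma> \<odot> \<sigma>) = 1" using assms by (simp add: mat_det_mult)
  have \<sigma>: "moeb \<sigma> \<tau> \<in> upper" if "\<tau> \<in> upper" for \<tau> using moeb_in_upper[OF _ that, of \<sigma>] assms by simp
  have nonzero: "denom (\<gamma> \<odot> \<sigma>) \<tau> \<noteq> 0" "denom \<sigma> \<tau> \<noteq> 0" "denom \<gamma> (moeb \<sigma> \<tau>) \<noteq> 0" if "\<tau> \<in> upper" for \<tau>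
    using that \<sigma>[OF that] det assms by (intro denom_nonzero; simp)+
  have sign: "u \<tau> \<in> {1, -1}" if "\<tau> \<in> upper" for \<tau>
  proof -
    have "(u \<tau>)\<^sup>2 = 1"
      using nonzero[OF that] denom_mult[OF _ that, of \<sigma> \<gamma>] assms(2)
      by (simp add: u_def power_mult_distrib power_divide)
    then show ?thesis by (simp add: power2_eq_1_iff)
  qed
  have "(\<lambda>\<tau>. csqrt (denom \<gamma> \<tau>)) \<circ> moeb \<sigma> holomorphic_on upper"
    using \<sigma> assms(2) by (intro holomorphic_on_compose_gen[OF moeb_holomorphic csqrt_denom_holomorphic]) auto
  then have "(\<lambda>\<tau>. csqrt (denom \<gamma> (moeb \<sigma> \<tau>))) holomorphic_on upper" by (simp add: o_def)
  then have "u holomorphic_on upper"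
    unfolding u_def using nonzero by (intro holomorphic_on_divide holomorphic_on_mult csqrt_denom_holomorphic) auto
  then have "u constant_on upper"
    using sign by (intro continuous_finite_range_constant convex_connected convex_upper holomorphic_on_imp_continuous_on
        finite_subset[of "u ` upper" "{1, -1}"]) auto
  then obtain u0 where u0: "\<And>\<tau>. \<tau> \<in> upper \<Longrightarrow> u \<tau> = u0" unfolding constant_on_def by blast
  have "u0 \<in> {1, -1}" using sign[of \<i>] u0[of \<i>] by (simp add: upper_def)
  then have "u0 powi w = 1 \<or> u0 powi w = -1" by (cases "even w") (auto simp: power_int_minus_left)
  moreover have "slash w (\<gamma> \<odot> \<sigma>) 1 g \<tau> = u0 powi w * slash w \<sigma> 1 (slash w \<gamma> 1 g) \<tau>" if "\<tau> \<in> upper" for g \<tau>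
  proof -
    have "csqrt (denom (\<gamma> \<odot> \<sigma>) \<tau>) powi (- w) =
        u \<tau> powi w * (csqrt (denom \<sigma> \<tau>) powi (- w) * csqrt (denom \<gamma> (moeb \<sigma> \<tau>)) powi (- w))"
      using nonzero[OF that]
      by (simp add: u_def power_int_mult_distrib power_int_divide_distrib power_int_minus field_simps)
    then show ?thesis using that assms(2) by (simp add: slash_eq moeb_mult u0)
  qed
  ultimately show ?thesis by (rule that)
qed

lemma csqrt_of_real_mult:
  assumes "x \<ge> 0"
  shows "csqrt (of_real x * z) = of_real (sqrt x) * csqrt z"
proof -
  have "csqrt (of_real x * z) = csqrt (of_real x) * csqrt z"
    using assms mpi_less_Arg[of z] Arg_le_pi[of z] by (intro csqrt_mult) simp
  also have "csqrt (of_real x) = of_real (sqrt x)" using assms by simp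
  finally show ?thesis .
qed

lemma sqrt_power_int:
  assumes "x > 0"
  shows "sqrt x powi k = x powr (of_int k / 2)"
proof -
  have "sqrt x powi k = sqrt x powr of_int k" using assms by (simp add: powr_real_of_int')
  also have "\<dots> = x powr (of_int k / 2)" using assms by (simp add: powr_half_sqrt[symmetric] powr_powr)
  finally show ?thesis .
qed

lemma powr_mult_csqrt_power_int:
  assumes "x > 0" "y > 0"
  shows "of_real (x powr (of_int w / 2)) * csqrt (of_real (x / y) * z) powi (- w) =
    of_real (y powr (of_int w / 2)) * csqrt z powi (- w)"
proof -
  have "csqrt (of_real (x / y) * z) powi (- w) = of_real (sqrt (x / y) powi (- w)) * csqrt z powi (- w)"
    using assms by (simp only: csqrt_of_real_mult power_int_mult_distrib of_real_power_int divide_nonneg_nonneg less_imp_le)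
  also have "sqrt (x / y) powi (- w) = (x / y) powr (of_int (- w) / 2)"
    using assms by (intro sqrt_power_int) simp
  also have "\<dots> = y powr (of_int w / 2) / x powr (of_int w / 2)"
    using assms by (simp add: powr_divide powr_minus field_simps)
  finally show ?thesis using assms by simp
qed

definition triangular_slash :: "int \<Rightarrow> mat2 \<Rightarrow> (complex \<Rightarrow> complex) \<Rightarrow> complex \<Rightarrow> complex" where
  "triangular_slash w \<beta> g \<tau> = of_real (of_int (fst \<beta>) powr (of_int w / 2)) * g (moeb \<beta> \<tau>)"

lemma slash_triangular:
  fixes a d a' d' :: int
  assumes pos: "a > 0" "d > 0" "a' > 0" "d' > 0" and det: "mat_det \<gamma> = 1" "mat_det \<gamma>' = 1"
    and eq: "(a, b, 0, d) \<odot> \<gamma> = \<gamma>' \<odot> (a', b', 0, d')" and \<tau>: "\<tau> \<in> upper"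
  shows "slash w \<gamma> 1 (triangular_slash w (a, b, 0, d) g) \<tau> = triangular_slash w (a', b', 0, d') (slash w \<gamma>' 1 g) \<tau>"
proof -
  let ?\<beta> = "(a, b, 0, d)" and ?\<beta>' = "(a', b', 0, d')"
  have nonzero: "mat_det ?\<beta>' \<noteq> 0" "mat_det \<gamma> \<noteq> 0" using pos det by auto
  have "a * d = a' * d'" using arg_cong[OF eq, of mat_det] det by (simp add: mat_det_mult)
  then have ad: "of_int a * of_int d = (of_int a' * of_int d' :: complex)" by (metis of_int_mult)
  have "of_int d * denom \<gamma> \<tau> = denom (?\<beta> \<odot> \<gamma>) \<tau>" using denom_mult[OF nonzero(2) \<tau>] by simp
  also have "\<dots> = of_int d' * denom \<gamma>' (moeb ?\<beta>' \<tau>)" unfolding eq using denom_mult[OF nonzero(1) \<tau>] by simp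
  finally have denom: "of_int d' * denom \<gamma>' (moeb ?\<beta>' \<tau>) = of_int d * denom \<gamma> \<tau>" ..
  have "of_int d' * (of_int a * denom \<gamma>' (moeb ?\<beta>' \<tau>)) = of_int a * (of_int d' * denom \<gamma>' (moeb ?\<beta>' \<tau>))"
    by (rule mult.left_commute)
  also have "\<dots> = (of_int a * of_int d) * denom \<gamma> \<tau>" unfolding denom by (rule mult.assoc[symmetric])
  also have "\<dots> = of_int d' * (of_int a' * denom \<gamma> \<tau>)" unfolding ad by (simp only: mult_ac)
  finally have "denom \<gamma>' (moeb ?\<beta>' \<tau>) = of_real (of_int a' / of_int a) * denom \<gamma> \<tau>" using pos by (simp add: field_simps)
  then have factor: "of_real (of_int a' powr (of_int w / 2)) * csqrt (denom \<gamma>' (moeb ?\<beta>' \<tau>)) powi (- w) =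
      of_real (of_int a powr (of_int w / 2)) * csqrt (denom \<gamma> \<tau>) powi (- w)"
    using pos by (simp only: powr_mult_csqrt_power_int of_int_0_less_iff)
  have "moeb ?\<beta> (moeb \<gamma> \<tau>) = moeb \<gamma>' (moeb ?\<beta>' \<tau>)"
    using moeb_mult[OF nonzero(2) \<tau>, of ?\<beta>] moeb_mult[OF nonzero(1) \<tau>, of \<gamma>'] eq by (simp only:)
  then show ?thesis
    unfolding triangular_slash_def fst_conv slash_eq mult.assoc[symmetric] factor by (simp only: mult.commute mult.left_commute)
qed

section \<open>Modular forms and their expansions at the cusps\<close>

lemma slash_quasi_periodic:
  assumes g: "modular_invariant w N chi g" and finite_order: "\<And>\<gamma>. \<gamma> \<in> Gamma0 N \<Longrightarrow> \<exists>n>0. chi \<gamma> 1 ^ n = 1"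
    and \<sigma>: "mat_det \<sigma> = 1"
  obtains \<kappa> n where "n > 0" "\<kappa> ^ n = 1"
    "\<And>\<tau>. \<tau> \<in> upper \<Longrightarrow> slash w \<sigma> 1 g (\<tau> + of_nat N) = \<kappa> * slash w \<sigma> 1 g \<tau>"
proof -
  obtain A B C D where ABCD: "\<sigma> = (A, B, C, D)" by (metis prod_cases4)
  define \<gamma> where "\<gamma> = \<sigma> \<odot> (1, int N, 0, 1) \<odot> mat_adj \<sigma>"
  have "mat_det \<gamma> = 1" using \<sigma> by (simp add: \<gamma>_def mat_det_mult)
  moreover have "\<gamma> = (A * D - (A * int N + B) * C, - A * B + (A * int N + B) * A,
      C * D - (C * int N + D) * C, - C * B + (C * int N + D) * A)"
    by (simp add: \<gamma>_def ABCD)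
  moreover have "C * D - (C * int N + D) * C = int N * (- C * C)" by (simp add: algebra_simps)
  ultimately have \<gamma>: "\<gamma> \<in> Gamma0 N" by simp
  then have det: "mat_det \<gamma> = 1" by (rule mat_det_Gamma0)
  obtain \<epsilon> where \<epsilon>: "\<epsilon> = 1 \<or> \<epsilon> = -1"
    "\<And>g \<tau>. \<tau> \<in> upper \<Longrightarrow> slash w (\<gamma> \<odot> \<sigma>) 1 g \<tau> = \<epsilon> * slash w \<sigma> 1 (slash w \<gamma> 1 g) \<tau>"
    by (rule slash_mult[OF det \<sigma>]) (rule that)
  have shift: "\<gamma> \<odot> \<sigma> = \<sigma> \<odot> (1, int N, 0, 1)"
    by (simp only: \<gamma>_def mat_mult_assoc mat_adj_mult[OF \<sigma>] mat_mult_1_right)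
  have "slash w \<sigma> 1 g (\<tau> + of_nat N) = \<epsilon> * chi \<gamma> 1 * slash w \<sigma> 1 g \<tau>" if "\<tau> \<in> upper" for \<tau>
  proof -
    have "slash w \<gamma> 1 g (moeb \<sigma> \<tau>) = chi \<gamma> 1 * g (moeb \<sigma> \<tau>)"
      using g \<gamma> moeb_in_upper[OF _ that, of \<sigma>] \<sigma> unfolding modular_invariant_def by simp
    moreover have "slash w \<sigma> 1 g (\<tau> + of_nat N) = slash w (\<gamma> \<odot> \<sigma>) 1 g \<tau>"
      unfolding shift slash_translation by simp
    ultimately show ?thesis using \<epsilon>(2)[OF that, of g] by (simp add: slash_eq)
  qed
  moreover obtain n where n: "n > 0" "chi \<gamma> 1 ^ n = 1" using finite_order[OF \<gamma>] by blast
  have "\<epsilon> ^ (2 * n) = 1" using \<epsilon>(1) by (auto simp: power_mult)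
  then have "(\<epsilon> * chi \<gamma> 1) ^ (2 * n) = 1"
    using n(2) by (simp add: power_mult_distrib) (simp add: mult.commute[of 2] power_mult)
  ultimately show ?thesis using that[of "2 * n" "\<epsilon> * chi \<gamma> 1"] n(1) by simp
qed

lemma slash_periodic:
  assumes g: "modular_invariant w N chi g" and finite_order: "\<And>\<gamma>. \<gamma> \<in> Gamma0 N \<Longrightarrow> \<exists>n>0. chi \<gamma> 1 ^ n = 1"
    and \<sigma>: "mat_det \<sigma> = 1" and N: "N > 0"
  obtains h :: nat where "h > 0"
    "\<And>\<tau>. \<tau> \<in> upper \<Longrightarrow> slash w \<sigma> 1 g (\<tau> + of_nat h) = slash w \<sigma> 1 g \<tau>"
proof -
  obtain \<kappa> n where n: "n > 0" "\<kappa> ^ n = 1"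
    and \<kappa>: "\<And>\<tau>. \<tau> \<in> upper \<Longrightarrow> slash w \<sigma> 1 g (\<tau> + of_nat N) = \<kappa> * slash w \<sigma> 1 g \<tau>"
    by (rule slash_quasi_periodic[OF g _ \<sigma>]) (erule finite_order, rule that)
  have "slash w \<sigma> 1 g (\<tau> + of_nat (j * N)) = \<kappa> ^ j * slash w \<sigma> 1 g \<tau>" if \<tau>: "\<tau> \<in> upper" for \<tau> j
  proof (induction j)
    case (Suc j)
    have "\<tau> + of_nat (j * N) \<in> upper" using \<tau> by (simp add: upper_def)
    from \<kappa>[OF this] Suc show ?case by (simp add: algebra_simps)
  qed simp
  from this[of _ n] show ?thesis using that[of "n * N"] n N by simp
qed

lemma Mk_if_bounded_at_cusps:
  assumes g: "modular_invariant w N chi g" and N: "N > 0"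
    and finite_order: "\<And>\<gamma>. \<gamma> \<in> Gamma0 N \<Longrightarrow> \<exists>n>0. chi \<gamma> 1 ^ n = 1"
    and bounded: "\<And>\<sigma>. mat_det \<sigma> = 1 \<Longrightarrow> \<exists>K. \<forall>\<tau>. Im \<tau> \<ge> 1 \<longrightarrow> norm (slash w \<sigma> 1 g \<tau>) \<le> K"
  shows "g \<in> Mk w N chi"
proof -
  have "qexp_nonneg (slash w \<sigma> 1 g)" if "\<sigma> \<in> Gamma0 1" for \<sigma>
  proof -
    have \<sigma>: "mat_det \<sigma> = 1" using that by (simp only: Gamma0_1_iff)
    obtain K where K: "\<And>\<tau>. Im \<tau> \<ge> 1 \<Longrightarrow> norm (slash w \<sigma> 1 g \<tau>) \<le> K" using bounded[OF \<sigma>] by blast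
    obtain h :: nat where h: "h > 0"
      and periodic: "\<And>\<tau>. \<tau> \<in> upper \<Longrightarrow> slash w \<sigma> 1 g (\<tau> + of_nat h) = slash w \<sigma> 1 g \<tau>"
      by (rule slash_periodic[OF g _ \<sigma> N]) (erule finite_order, rule that)
    have real_h: "real h > 0" using h by simp
    have periodic': "slash w \<sigma> 1 g (\<tau> + of_real (real h)) = slash w \<sigma> 1 g \<tau>" if "\<tau> \<in> upper" for \<tau>
      using periodic[OF that] by simp
    have hol: "slash w \<sigma> 1 g holomorphic_on upper"
      using g \<sigma> by (intro slash_holomorphic) (simp_all add: modular_invariant_def)
    obtain c where c: "\<And>\<tau>. \<tau> \<in> upper \<Longrightarrow> (\<lambda>n. c n * ee (\<tau> / of_real (real h)) ^ n) sums slash w \<sigma> 1 g \<tau>"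
      by (rule periodic_bounded_expansion[OF real_h hol _ zero_less_one]) (erule periodic', erule K, rule that)
    have "ee (of_real ((of_nat n + 0) / real h) * \<tau>) = ee (\<tau> / of_real (real h)) ^ n" for n \<tau>
      by (simp add: ee_power)
    then have "\<forall>\<tau>\<in>upper. (\<lambda>n. c n * ee (of_real ((of_nat n + 0) / real h) * \<tau>)) sums slash w \<sigma> 1 g \<tau>"
      using c by (simp only: ball_simps) blast
    with real_h show ?thesis
      unfolding qexp_nonneg_def by (intro exI[of _ "real h"] exI[of _ 0] exI[of _ c] conjI order_refl)
  qed
  then show ?thesis using g by (simp add: Mk_def)
qed

section \<open>Cosets of integer matrices\<close>

lemma hermite_decomposition:
  assumes "mat_det \<mu> > 0"
  obtains \<gamma> a b d where "mat_det \<gamma> = 1" "\<mu> = \<gamma> \<odot> (a, b, 0, d)" "a > 0" "d > 0"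
proof (cases \<mu>)
  case (fields x y z w)
  define g where "g = gcd x z"
  have "x \<noteq> 0 \<or> z \<noteq> 0" using assms by (auto simp: fields)
  then have g: "g > 0" by (simp add: g_def)
  then obtain A C where AC: "x = A * g" "z = C * g" "coprime A C"
    using gcd_coprime_exists[of x z] unfolding g_def by auto
  then obtain u v where uv: "u * A + v * C = 1" using bezout_int[of A C] by auto
  define b d where "b = u * y + v * w" and "d = A * w - C * y"
  have "A * b + (- v) * d = (u * A + v * C) * y" "C * b + u * d = (u * A + v * C) * w"
    by (simp_all add: b_def d_def algebra_simps)
  then have "\<mu> = (A, - v, C, u) \<odot> (g, b, 0, d)" unfolding uv by (simp add: fields AC)
  moreover have "mat_det (A, - v, C, u) = 1" using uv by (simp add: algebra_simps)
  moreover have "g * d = mat_det \<mu>" by (simp add: fields AC d_def algebra_simps)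
  then have "d > 0" using assms g by (metis zero_less_mult_pos)
  ultimately show ?thesis using g by (intro that)
qed

lemma hecke_coset:
  assumes \<gamma>: "\<gamma> \<in> Gamma0 N" and pos: "a > 0" "d > 0" and coprime: "coprime a (int N)"
  obtains \<gamma>' a' b' d' where "\<gamma>' \<in> Gamma0 N" "(a, b, 0, d) \<odot> \<gamma> = \<gamma>' \<odot> (a', b', 0, d')"
    "a' > 0" "d' > 0" "a' * d' = a * d" "coprime a' (int N)"
proof -
  obtain A B C D where ABCD: "\<gamma> = (A, B, C, D)" by (metis prod_cases4)
  then have det: "A * D - B * C = 1" and C: "int N dvd C" using \<gamma> by simp_all
  have "mat_det ((a, b, 0, d) \<odot> \<gamma>) = a * d" unfolding mat_det_mult mat_det_Gamma0[OF \<gamma>] by simp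
  then obtain \<gamma>' a' b' d' where dec: "mat_det \<gamma>' = 1" "(a, b, 0, d) \<odot> \<gamma> = \<gamma>' \<odot> (a', b', 0, d')" "a' > 0" "d' > 0"
    using hermite_decomposition[of "(a, b, 0, d) \<odot> \<gamma>"] pos by (metis mult_pos_pos)
  obtain A' B' C' D' where ABCD': "\<gamma>' = (A', B', C', D')" by (metis prod_cases4)
  have first_column: "a * A + b * C = A' * a'" "d * C = C' * a'" using dec(2) by (simp_all add: ABCD ABCD')
  have coprime': "coprime a' (int N)"
  proof (rule coprimeI)
    fix q assume q: "q dvd a'" "q dvd int N"
    have "q dvd C" using q(2) C by (rule dvd_trans)
    moreover have "q dvd a * A + b * C" unfolding first_column using q(1) by simp
    ultimately have "q dvd a * A" by (simp add: dvd_add_left_iff)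
    moreover have "coprime q a" using coprime_divisors[OF dvd_refl q(2) coprime] by (simp add: coprime_commute)
    ultimately have "q dvd A" by (simp add: coprime_dvd_mult_right_iff)
    then have "q dvd A * D - B * C" using \<open>q dvd C\<close> by simp
    then show "is_unit q" using det by simp
  qed
  have "int N dvd C' * a'" using C unfolding first_column(2)[symmetric] by simp
  then have "\<gamma>' \<in> Gamma0 N"
    using dec(1) coprime' by (simp add: ABCD' coprime_commute coprime_dvd_mult_left_iff)
  moreover have "a' * d' = a * d"
    using arg_cong[OF dec(2), of mat_det] dec(1) mat_det_Gamma0[OF \<gamma>] by (simp add: mat_det_mult)
  ultimately show ?thesis using dec(2-4) coprime' by (intro that)
qed

lemma ex_shift_coprime_6:
  assumes "coprime x (y :: int)" "y \<noteq> 0"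
  obtains s where "x + s * y > 0" "coprime (x + s * y) 6"
proof -
  have common: "\<not> (even x \<and> even y)" "\<not> (3 dvd x \<and> 3 dvd y)"
    using assms(1) by (auto dest: coprime_common_divisor)
  define s where "s = (if even x then 3 else 0) + (if 3 dvd x then 4 else 0 :: int)"
  define z where "z = x + s * y"
  have "odd z" "\<not> 3 dvd z" using common unfolding z_def s_def by (auto; presburger)+
  then have "z \<noteq> 0" by auto
  moreover have "\<bar>z\<bar> * 1 \<le> \<bar>z\<bar> * (y * y)"
    using assms(2) by (intro mult_left_mono) (auto simp: int_one_le_iff_zero_less zero_less_mult_iff)
  ultimately have "z + 6 * (\<bar>z\<bar> * (y * y)) > 0" by linarith
  moreover have "coprime (z + 6 * (\<bar>z\<bar> * (y * y))) 6"
    using \<open>odd z\<close> \<open>\<not> 3 dvd z\<close> unfolding coprime_6_iff by presburger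
  moreover have "z + 6 * (\<bar>z\<bar> * (y * y)) = x + (s + 6 * \<bar>z\<bar> * y) * y" by (simp add: z_def algebra_simps)
  ultimately show ?thesis using that by metis
qed

section \<open>Functions invariant under \<open>\<Gamma>\<^sub>0(N)\<close>\<close>

definition Gamma0_normalised :: "nat \<Rightarrow> mat2 set" where
  "Gamma0_normalised N = {(A, B, C, D). (A, B, C, D) \<in> Gamma0 N \<and> C > 0 \<and> odd (C div int N) \<and> D > 0 \<and> coprime D 6}"

definition invariant_under :: "mat2 \<Rightarrow> (complex \<Rightarrow> 'a) \<Rightarrow> bool" where
  "invariant_under \<gamma> G \<longleftrightarrow> (\<forall>\<tau>\<in>upper. G (moeb \<gamma> \<tau>) = G \<tau>)"

lemma Gamma0_normalised_subset: "Gamma0_normalised N \<subseteq> Gamma0 N"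
  by (auto simp: Gamma0_normalised_def)

lemma invariant_under_mult:
  assumes "invariant_under \<gamma> G" "invariant_under \<delta> G" "mat_det \<delta> = 1"
  shows "invariant_under (\<gamma> \<odot> \<delta>) G"
  using assms moeb_in_upper[of \<delta>] by (simp add: invariant_under_def moeb_mult)

lemma invariant_under_cancel:
  assumes "invariant_under (\<gamma> \<odot> \<delta>) G" "invariant_under \<delta> G" "mat_det \<delta> = 1"
  shows "invariant_under \<gamma> G"
  unfolding invariant_under_def
proof
  fix \<tau> assume \<tau>: "\<tau> \<in> upper"
  define \<sigma> where "\<sigma> = moeb (mat_adj \<delta>) \<tau>"
  have \<sigma>: "\<sigma> \<in> upper" unfolding \<sigma>_def using \<tau> assms(3) by (intro moeb_in_upper) simp_all
  have "moeb \<delta> \<sigma> = moeb (\<delta> \<odot> mat_adj \<delta>) \<tau>" unfolding \<sigma>_def using \<tau> assms(3) by (intro moeb_mult[symmetric]) simp_all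
  then have \<tau>_eq: "moeb \<delta> \<sigma> = \<tau>" by (simp add: mat_mult_adj[OF assms(3)])
  have "G (moeb \<gamma> (moeb \<delta> \<sigma>)) = G (moeb (\<gamma> \<odot> \<delta>) \<sigma>)" using \<sigma> assms(3) by (simp add: moeb_mult)
  also have "\<dots> = G (moeb \<delta> \<sigma>)" using assms(1,2) \<sigma> by (simp add: invariant_under_def)
  finally show "G (moeb \<gamma> \<tau>) = G \<tau>" unfolding \<tau>_eq .
qed

lemma invariant_under_translation:
  assumes "\<And>\<tau>. \<tau> \<in> upper \<Longrightarrow> G (\<tau> + 1) = G \<tau>"
  shows "invariant_under (1, n, 0, 1) G"
proof -
  interpret periodic_fun_simple "\<lambda>\<tau>. if \<tau> \<in> upper then G \<tau> else undefined" 1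
    using assms by unfold_locales (use upper_add_of_real_iff[of _ 1] in simp)
  have "G (\<tau> + of_int n) = G \<tau>" if "\<tau> \<in> upper" for \<tau>
    using plus_of_int[of \<tau> n] that upper_add_of_real_iff[of \<tau> "of_int n"] by simp
  then show ?thesis by (simp add: invariant_under_def)
qed

lemma invariant_under_lower_triangular:
  assumes N: "N > 0" and normalised: "\<And>\<gamma>. \<gamma> \<in> Gamma0_normalised N \<Longrightarrow> invariant_under \<gamma> G"
  shows "invariant_under (1, 0, int N * int n, 1) G"
proof (induction n)
  case (Suc n)
  have "(1, 0, int N, 1) \<in> Gamma0_normalised N" using N by (simp add: Gamma0_normalised_def)
  then have "invariant_under (1, 0, int N, 1) G" by (rule normalised)
  from invariant_under_mult[OF this Suc.IH] show ?case by (simp add: algebra_simps)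
qed (simp add: invariant_under_def moeb_def)

lemma ex_translations_Gamma0_normalised:
  assumes N: "N > 0" and \<gamma>: "(A, B, C, D) \<in> Gamma0 N" "C \<noteq> 0"
  obtains j :: int and n :: nat where "(A, B, C, D) \<odot> (1, j, 0, 1) \<odot> (1, 0, int N * int n, 1) \<in> Gamma0_normalised N"
proof -
  have det: "A * D - B * C = 1" using \<gamma>(1) by simp
  obtain c where c: "C = int N * c" using \<gamma>(1) by auto
  have "coprime D C" using coprime_if_det_1[OF det] by (simp add: coprime_commute)
  then obtain j where j: "D + j * C > 0" "coprime (D + j * C) 6" using ex_shift_coprime_6 \<gamma>(2) by blast
  define D1 where "D1 = D + j * C"
  define n where "n = nat (2 * \<bar>c\<bar> + (if even c then 1 else 0))"
  have n: "int n = 2 * \<bar>c\<bar> + (if even c then 1 else 0)" by (simp add: n_def)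
  define \<delta> where "\<delta> = (A, B, C, D) \<odot> (1, j, 0, 1) \<odot> (1, 0, int N * int n, 1)"
  have \<delta>: "\<delta> = (A + (A * j + B) * (int N * int n), A * j + B, int N * (c + int n * D1), D1)"
    by (simp add: \<delta>_def D1_def c algebra_simps)
  have "int n * 1 \<le> int n * D1" using j(1) by (intro mult_left_mono) (auto simp: D1_def)
  moreover have "c \<noteq> 0" "2 * \<bar>c\<bar> \<le> int n" using \<gamma>(2) c n by auto
  ultimately have "c + int n * D1 > 0" by linarith
  moreover have "odd (c + int n * D1)" using n j(2) by (cases "even c") (simp_all add: coprime_6_iff D1_def)
  moreover have "mat_det \<delta> = 1" using mat_det_Gamma0[OF \<gamma>(1)] by (simp only: \<delta>_def mat_det_mult) simp
  ultimately have "\<delta> \<in> Gamma0_normalised N"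
    using N j by (simp add: \<delta> Gamma0_normalised_def D1_def[symmetric])
  then show ?thesis unfolding \<delta>_def by (rule that)
qed

lemma invariant_under_Gamma0:
  assumes N: "N > 0" and periodic: "\<And>\<tau>. \<tau> \<in> upper \<Longrightarrow> G (\<tau> + 1) = G \<tau>"
    and normalised: "\<And>\<gamma>. \<gamma> \<in> Gamma0_normalised N \<Longrightarrow> invariant_under \<gamma> G" and \<gamma>: "\<gamma> \<in> Gamma0 N"
  shows "invariant_under \<gamma> G"
proof -
  obtain A B C D where ABCD: "\<gamma> = (A, B, C, D)" by (metis prod_cases4)
  then have det: "A * D - B * C = 1" using \<gamma> by simp
  have translation: "invariant_under (1, n, 0, 1) G" for n
    using periodic by (rule invariant_under_translation)
  show ?thesis
  proof (cases "C = 0")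
    case True
    then have "A = 1 \<and> D = 1 \<or> A = -1 \<and> D = -1" using det by (simp add: zmult_eq_1_iff)
    then have "moeb \<gamma> \<tau> = moeb (1, B * D, 0, 1) \<tau>" for \<tau> using True by (auto simp: ABCD)
    then show ?thesis using translation by (simp only: invariant_under_def)
  next
    case False
    obtain j n where "\<gamma> \<odot> (1, j, 0, 1) \<odot> (1, 0, int N * int n, 1) \<in> Gamma0_normalised N"
      by (rule ex_translations_Gamma0_normalised[OF N \<gamma>[unfolded ABCD] False, folded ABCD])
    from normalised[OF this] have "invariant_under (\<gamma> \<odot> (1, j, 0, 1)) G"
      by (rule invariant_under_cancel[OF _ invariant_under_lower_triangular[OF N normalised]]) simp_all
    then show ?thesis
      by (rule invariant_under_cancel[OF _ translation]) simp_all
  qed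
qed

lemma modular_invariant_if_Gamma0_normalised:
  assumes N: "N > 0" and f: "modular_invariant w N chi f" and f_nonzero: "\<And>\<tau>. \<tau> \<in> upper \<Longrightarrow> f \<tau> \<noteq> 0"
    and g: "g holomorphic_on upper" "\<And>\<tau>. \<tau> \<notin> upper \<Longrightarrow> g \<tau> = 0"
    and periodic: "\<And>\<tau>. \<tau> \<in> upper \<Longrightarrow> f (\<tau> + 1) = f \<tau>" "\<And>\<tau>. \<tau> \<in> upper \<Longrightarrow> g (\<tau> + 1) = g \<tau>"
    and normalised: "\<And>\<gamma> \<tau>. \<gamma> \<in> Gamma0_normalised N \<Longrightarrow> \<tau> \<in> upper \<Longrightarrow> slash w \<gamma> 1 g \<tau> = chi \<gamma> 1 * g \<tau>"
  shows "modular_invariant w N chi g"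
proof -
  define G where "G = (\<lambda>\<tau>. g \<tau> / f \<tau>)"
  have f_slash: "slash w \<gamma> \<epsilon> f \<tau> = chi \<gamma> \<epsilon> * f \<tau>" if "\<gamma> \<in> Gamma0 N" "\<epsilon> \<in> {1, -1}" "\<tau> \<in> upper" for \<gamma> \<epsilon> \<tau>
    using f that unfolding modular_invariant_def by blast
  have upper: "moeb \<gamma> \<tau> \<in> upper" if "\<gamma> \<in> Gamma0 N" "\<tau> \<in> upper" for \<gamma> \<tau>
    using moeb_in_upper[OF _ that(2), of \<gamma>] mat_det_Gamma0[OF that(1)] by simp
  have slash_g: "slash w \<gamma> \<epsilon> g \<tau> = slash w \<gamma> \<epsilon> f \<tau> * G (moeb \<gamma> \<tau>)" if "\<gamma> \<in> Gamma0 N" "\<tau> \<in> upper" for \<gamma> \<epsilon> \<tau>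
    unfolding slash_eq_slash_1[of w \<gamma> \<epsilon>] slash_eq G_def using f_nonzero[OF upper[OF that]] by simp
  have "invariant_under \<gamma> G" if "\<gamma> \<in> Gamma0_normalised N" for \<gamma>
    unfolding invariant_under_def
  proof
    fix \<tau> assume \<tau>: "\<tau> \<in> upper"
    have \<gamma>: "\<gamma> \<in> Gamma0 N" using that Gamma0_normalised_subset by blast
    have "slash w \<gamma> 1 f \<tau> \<noteq> 0"
      using denom_nonzero[OF _ \<tau>, of \<gamma>] mat_det_Gamma0[OF \<gamma>] f_nonzero[OF upper[OF \<gamma> \<tau>]] by (simp add: slash_eq)
    moreover have "slash w \<gamma> 1 f \<tau> * G (moeb \<gamma> \<tau>) = slash w \<gamma> 1 f \<tau> * G \<tau>"
      using normalised[OF that \<tau>] slash_g[OF \<gamma> \<tau>, of 1] f_slash[OF \<gamma> _ \<tau>, of 1] f_nonzero[OF \<tau>] by (simp add: G_def)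
    ultimately show "G (moeb \<gamma> \<tau>) = G \<tau>" by simp
  qed
  moreover have "G (\<tau> + 1) = G \<tau>" if "\<tau> \<in> upper" for \<tau> using periodic that by (simp add: G_def)
  ultimately have invariant: "invariant_under \<gamma> G" if "\<gamma> \<in> Gamma0 N" for \<gamma>
    using invariant_under_Gamma0[OF N, of G] that by blast
  have "slash w \<gamma> \<epsilon> g \<tau> = chi \<gamma> \<epsilon> * g \<tau>" if "\<gamma> \<in> Gamma0 N" "\<epsilon> \<in> {1, -1}" "\<tau> \<in> upper" for \<gamma> \<epsilon> \<tau>
  proof -
    have "G (moeb \<gamma> \<tau>) = G \<tau>" using invariant[OF that(1)] that(3) by (simp add: invariant_under_def)
    then show ?thesis
      unfolding slash_g[OF that(1,3)] f_slash[OF that] using f_nonzero[OF that(3)] by (simp add: G_def)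
  qed
  then show ?thesis using g by (simp add: modular_invariant_def)
qed

section \<open>Hecke operators\<close>

definition hecke_divisors :: "nat \<Rightarrow> nat \<Rightarrow> nat set" where
  "hecke_divisors N l = {a. a dvd l \<and> coprime a N}"

definition hecke_index :: "nat \<Rightarrow> nat \<Rightarrow> (int \<times> int) set" where
  "hecke_index N l = (SIGMA a:int ` hecke_divisors N l. {0..<int l div a})"

definition hecke_mat :: "nat \<Rightarrow> int \<times> int \<Rightarrow> mat2" where
  "hecke_mat l p = (fst p, snd p, 0, int l div fst p)"

definition hecke_op :: "int \<Rightarrow> nat \<Rightarrow> (int \<Rightarrow> complex) \<Rightarrow> nat \<Rightarrow> (complex \<Rightarrow> complex) \<Rightarrow> complex \<Rightarrow> complex" where
  "hecke_op w N \<psi> l g \<tau> = (\<Sum>p\<in>hecke_index N l.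
     \<psi> (fst p) * triangular_slash w (hecke_mat l p) g \<tau>) / of_nat l"

lemma finite_hecke_divisors: "l > 0 \<Longrightarrow> finite (hecke_divisors N l)"
  by (simp add: hecke_divisors_def)

lemma finite_hecke_index: "l > 0 \<Longrightarrow> finite (hecke_index N l)"
  unfolding hecke_index_def by (intro finite_SigmaI finite_imageI finite_hecke_divisors) auto

lemma hecke_divisors_cofactor:
  assumes "a \<in> hecke_divisors N l" "l > 0"
  shows "a > 0" "l div a > 0" "a * (l div a) = l"
  using assms by (auto simp: hecke_divisors_def elim!: dvdE)

lemma hecke_index_iff:
  fixes a d :: int
  assumes "a > 0" "d > 0" "a * d = int l"
  shows "(a, b) \<in> hecke_index N l \<longleftrightarrow> coprime a (int N) \<and> 0 \<le> b \<and> b < d"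
proof -
  obtain n where n: "a = int n" using assms(1) by (metis zero_less_imp_eq_int)
  have "int l div a = d" "a dvd int l" using assms(1,3) by (metis nonzero_mult_div_cancel_left less_irrefl) (metis assms(3) dvd_triv_left)
  then show ?thesis by (auto simp: hecke_index_def hecke_divisors_def n)
qed

lemma hecke_indexE:
  assumes "p \<in> hecke_index N l" "l > 0"
  obtains a b d where "p = (a, b)" "hecke_mat l p = (a, b, 0, d)" "a > 0" "d > 0" "a * d = int l"
    "coprime a (int N)" "0 \<le> b" "b < d"
proof -
  obtain n b where p: "p = (int n, b)" "n \<in> hecke_divisors N l" "0 \<le> b" "b < int l div int n"
    using assms(1) by (auto simp: hecke_index_def)
  note cofactor = hecke_divisors_cofactor[OF p(2) assms(2)]
  have "int n * int (l div n) = int l" using cofactor(3) by (metis of_nat_mult)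
  then show ?thesis
    using that[of "int n" b "int (l div n)"] p cofactor by (simp add: hecke_mat_def hecke_divisors_def zdiv_int)
qed

lemma triangular_eq_translation_mult: "(a, b, 0, d) = (1, b div d, 0, 1) \<odot> (a, b mod d, 0, d)"
  by simp

lemma hecke_mat_left_associated_imp_eq:
  assumes "p \<in> hecke_index N l" "q \<in> hecke_index N l" "l > 0"
    and \<rho>: "mat_det \<rho> = 1" "hecke_mat l p = \<rho> \<odot> hecke_mat l q"
  shows "p = q"
proof -
  obtain a1 b1 d1 where p: "p = (a1, b1)" "hecke_mat l p = (a1, b1, 0, d1)" "a1 > 0" "d1 > 0" "0 \<le> b1" "b1 < d1"
    using hecke_indexE[OF assms(1,3)] by metis
  obtain a2 b2 d2 where q: "q = (a2, b2)" "hecke_mat l q = (a2, b2, 0, d2)" "a2 > 0" "d2 > 0" "0 \<le> b2" "b2 < d2"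
    using hecke_indexE[OF assms(2,3)] by metis
  obtain x y z t where xyzt: "\<rho> = (x, y, z, t)" by (metis prod_cases4)
  have eqs: "a1 = x * a2" "b1 = x * b2 + y * d2" "z * a2 = 0" "d1 = z * b2 + t * d2"
    using \<rho>(2) unfolding p(2) q(2) xyzt by simp_all
  then have "z = 0" using q(3) by simp
  then have "x * t = 1" using \<rho>(1) by (simp add: xyzt)
  moreover have "x > 0" using p(3) q(3) unfolding eqs(1) by (simp add: zero_less_mult_iff)
  ultimately have "x = 1" "t = 1" by (auto simp: zmult_eq_1_iff)
  then have "d1 = d2" "b1 = b2 + y * d2" "a1 = a2" using eqs \<open>z = 0\<close> by simp_all
  moreover from this have "b1 mod d2 = b2 mod d2" by simp
  ultimately have "b1 = b2" using p(5,6) q(5,6) by (metis mod_pos_pos_trivial)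
  then show ?thesis using p(1) q(1) \<open>a1 = a2\<close> by simp
qed

lemma hecke_mat_transport_inj:
  assumes "p \<in> hecke_index N l" "q \<in> hecke_index N l" "l > 0" and \<gamma>: "mat_det \<gamma> = 1"
    and "mat_det \<gamma>1 = 1" "hecke_mat l p \<odot> \<gamma> = \<gamma>1 \<odot> \<beta>"
    and "mat_det \<gamma>2 = 1" "hecke_mat l q \<odot> \<gamma> = \<gamma>2 \<odot> \<beta>"
  shows "p = q"
proof (rule hecke_mat_left_associated_imp_eq[OF assms(1-3)])
  have "mat_adj \<gamma>2 \<odot> (hecke_mat l q \<odot> \<gamma>) = \<beta>"
    unfolding assms(8) mat_mult_assoc[symmetric] mat_adj_mult[OF assms(7)] by simp
  then have "hecke_mat l p \<odot> \<gamma> = \<gamma>1 \<odot> mat_adj \<gamma>2 \<odot> hecke_mat l q \<odot> \<gamma>"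
    unfolding assms(6) by (simp only: mat_mult_assoc)
  then have "hecke_mat l p \<odot> (\<gamma> \<odot> mat_adj \<gamma>) = \<gamma>1 \<odot> mat_adj \<gamma>2 \<odot> hecke_mat l q \<odot> (\<gamma> \<odot> mat_adj \<gamma>)"
    by (simp only: mat_mult_assoc[symmetric])
  then show "hecke_mat l p = \<gamma>1 \<odot> mat_adj \<gamma>2 \<odot> hecke_mat l q" unfolding mat_mult_adj[OF \<gamma>] by simp
  show "mat_det (\<gamma>1 \<odot> mat_adj \<gamma>2) = 1" using assms(5,7) by (simp add: mat_det_mult)
qed

lemma slash_hecke_op:
  "slash w \<gamma> 1 (hecke_op w N \<psi> l g) \<tau> =
    (\<Sum>p\<in>hecke_index N l. \<psi> (fst p) * slash w \<gamma> 1 (triangular_slash w (hecke_mat l p) g) \<tau>) / of_nat l"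
  unfolding slash_eq hecke_op_def times_divide_eq_right sum_distrib_left by (simp only: mult_ac)

lemma hecke_op_eq_0_off_upper:
  assumes "\<And>\<tau>. \<tau> \<notin> upper \<Longrightarrow> g \<tau> = 0" "l > 0" "\<tau> \<notin> upper"
  shows "hecke_op w N \<psi> l g \<tau> = 0"
proof -
  have "g (moeb (hecke_mat l p) \<tau>) = 0" if "p \<in> hecke_index N l" for p
  proof -
    from that assms(2) obtain a b d where p: "hecke_mat l p = (a, b, 0, d)" "a > 0" "d > 0" by (rule hecke_indexE)
    have "(of_int d * ((of_int a * \<tau> + of_int b) / of_int d) + of_int (- b)) / of_int a = \<tau>" using p(2,3) by simp
    then have "(of_int a * \<tau> + of_int b) / of_int d \<notin> upper"
      using upper_affine[of "(of_int a * \<tau> + of_int b) / of_int d" d a "- b"] p(2,3) assms(3) by metis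
    then show ?thesis unfolding p(1) moeb_triangular by (rule assms(1))
  qed
  then show ?thesis by (simp add: hecke_op_def triangular_slash_def)
qed

lemma hecke_op_holomorphic:
  assumes "g holomorphic_on upper" "l > 0"
  shows "hecke_op w N \<psi> l g holomorphic_on upper"
proof -
  have "(\<lambda>\<tau>. g (moeb (hecke_mat l p) \<tau>)) holomorphic_on upper" if "p \<in> hecke_index N l" for p
  proof -
    from that assms(2) obtain a b d where p: "hecke_mat l p = (a, b, 0, d)" "a > 0" "d > 0" by (rule hecke_indexE)
    then have det: "mat_det (hecke_mat l p) > 0" by simp
    then have "(g \<circ> moeb (hecke_mat l p)) holomorphic_on upper"
      using moeb_in_upper[OF det] by (intro holomorphic_on_compose_gen[OF moeb_holomorphic assms(1)]) auto
    then show ?thesis by (simp add: o_def)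
  qed
  then have "(\<lambda>\<tau>. hecke_op w N \<psi> l g \<tau>) holomorphic_on upper"
    unfolding hecke_op_def triangular_slash_def using assms(2)
    by (intro holomorphic_on_divide holomorphic_on_sum holomorphic_on_mult holomorphic_on_const) simp_all
  then show ?thesis .
qed

lemma slash_triangular_slash_bounded:
  fixes a d :: int
  assumes g: "\<And>\<sigma>. \<sigma> \<in> Gamma0 1 \<Longrightarrow> qexp_nonneg (slash w \<sigma> 1 g)" and \<sigma>: "mat_det \<sigma> = 1" and pos: "a > 0" "d > 0"
  obtains K where "\<And>\<tau>. Im \<tau> \<ge> 1 \<Longrightarrow> norm (slash w \<sigma> 1 (triangular_slash w (a, b, 0, d) g) \<tau>) \<le> K"
proof -
  have "\<sigma> \<in> Gamma0 1" using \<sigma> by (simp only: Gamma0_1_iff)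
  then obtain \<sigma>' a' b' d' where coset: "\<sigma>' \<in> Gamma0 1" "(a, b, 0, d) \<odot> \<sigma> = \<sigma>' \<odot> (a', b', 0, d')" "a' > 0" "d' > 0"
    by (rule hecke_coset[OF _ pos]) simp_all
  have "of_int a' / of_int d' > (0 :: real)" using coset(3,4) by simp
  then obtain B where B: "\<And>\<tau>. Im \<tau> \<ge> of_int a' / of_int d' \<Longrightarrow> norm (slash w \<sigma>' 1 g \<tau>) \<le> B"
    using qexp_nonneg_bounded[OF g[OF coset(1)]] by blast
  have "norm (slash w \<sigma> 1 (triangular_slash w (a, b, 0, d) g) \<tau>) \<le> of_int a' powr (of_int w / 2) * B"
    if "Im \<tau> \<ge> 1" for \<tau>
  proof -
    have "moeb (a', b', 0, d') \<tau> = of_real (of_int a' / of_int d') * \<tau> + of_real (of_int b' / of_int d')"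
      by (simp add: add_divide_distrib)
    then have "Im (moeb (a', b', 0, d') \<tau>) = of_int a' / of_int d' * Im \<tau>" by simp
    moreover have "of_int a' / of_int d' * Im \<tau> \<ge> of_int a' / of_int d' * 1"
      using that coset(3,4) by (intro mult_left_mono) simp_all
    ultimately have "norm (slash w \<sigma>' 1 g (moeb (a', b', 0, d') \<tau>)) \<le> B" by (intro B) simp
    moreover have "\<tau> \<in> upper" using that by (simp add: upper_def)
    ultimately show ?thesis
      unfolding slash_triangular[OF pos coset(3,4) \<sigma> mat_det_Gamma0[OF coset(1)] coset(2) \<open>\<tau> \<in> upper\<close>]
        triangular_slash_def fst_conv norm_mult
      by (simp add: mult_left_mono)
  qed
  then show ?thesis by (rule that)
qed

lemma hecke_op_bounded_at_cusps:
  assumes g: "\<And>\<sigma>. \<sigma> \<in> Gamma0 1 \<Longrightarrow> qexp_nonneg (slash w \<sigma> 1 g)" and \<sigma>: "mat_det \<sigma> = 1" and l: "l > 0"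
  shows "\<exists>K. \<forall>\<tau>. Im \<tau> \<ge> 1 \<longrightarrow> norm (slash w \<sigma> 1 (hecke_op w N \<psi> l g) \<tau>) \<le> K"
proof -
  let ?t = "\<lambda>p. slash w \<sigma> 1 (triangular_slash w (hecke_mat l p) g)"
  have "\<forall>p\<in>hecke_index N l. \<exists>K. \<forall>\<tau>. Im \<tau> \<ge> 1 \<longrightarrow> norm (?t p \<tau>) \<le> K"
  proof
    fix p assume "p \<in> hecke_index N l"
    then obtain a b d where p: "hecke_mat l p = (a, b, 0, d)" "a > 0" "d > 0" using hecke_indexE l by metis
    obtain K where "norm (slash w \<sigma> 1 (triangular_slash w (a, b, 0, d) g) \<tau>) \<le> K" if "Im \<tau> \<ge> 1" for \<tau>
      by (rule slash_triangular_slash_bounded[OF _ \<sigma> p(2,3)]) (erule g, rule that)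
    then show "\<exists>K. \<forall>\<tau>. Im \<tau> \<ge> 1 \<longrightarrow> norm (?t p \<tau>) \<le> K" unfolding p(1) by blast
  qed
  from bchoice[OF this] obtain K where K: "\<And>p \<tau>. p \<in> hecke_index N l \<Longrightarrow> Im \<tau> \<ge> 1 \<Longrightarrow> norm (?t p \<tau>) \<le> K p" by blast
  have "norm (slash w \<sigma> 1 (hecke_op w N \<psi> l g) \<tau>) \<le> (\<Sum>p\<in>hecke_index N l. norm (\<psi> (fst p)) * K p) / real l"
    if "Im \<tau> \<ge> 1" for \<tau>
    unfolding slash_hecke_op norm_divide norm_of_nat
    using K[OF _ that] by (intro divide_right_mono sum_norm_le) (simp_all add: norm_mult mult_left_mono)
  then show ?thesis by blast
qed

lemma sum_roots_of_unity:
  assumes "d > 0"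
  shows "(\<Sum>b<d. ee (of_nat b / of_nat d) ^ n) = (if d dvd n then of_nat d else 0)"
proof -
  define z where "z = ee (of_nat n / of_nat d)"
  have "ee (of_nat b / of_nat d) ^ n = z ^ b" for b by (simp add: z_def ee_power mult.commute)
  moreover have "z ^ d = 1" using assms ee_of_int[of "int n"] by (simp add: z_def ee_power)
  moreover have "z = 1 \<longleftrightarrow> d dvd n"
    using complex_root_unity_eq_1[of d n] assms by (simp add: z_def ee_def)
  ultimately show ?thesis by (simp add: sum_gp_strict)
qed

lemma sums_sum_translates:
  assumes sums: "\<And>\<tau>. \<tau> \<in> upper \<Longrightarrow> (\<lambda>n. c n * ee \<tau> ^ n) sums g \<tau>" and a: "a > 0" and d: "d > 0" and \<tau>: "\<tau> \<in> upper"
  shows "(\<lambda>j. (if a dvd j then of_nat d * c (d * (j div a)) else 0) * ee \<tau> ^ j) sums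
    (\<Sum>b<d. g ((of_nat a * \<tau> + of_nat b) / of_nat d))" (is "?f sums ?s")
proof -
  define p where "p = ee (of_nat a * \<tau> / of_nat d)"
  have p_power: "p ^ (d * k) = ee \<tau> ^ (a * k)" for k
    unfolding p_def ee_power using d by (intro arg_cong[where f = ee]) simp
  have coeff: "(\<Sum>b<d. c n * ee ((of_nat a * \<tau> + of_nat b) / of_nat d) ^ n) = (if d dvd n then of_nat d * c n * p ^ n else 0)" for n
  proof -
    have "(\<Sum>b<d. c n * ee ((of_nat a * \<tau> + of_nat b) / of_nat d) ^ n) = c n * (p ^ n * (\<Sum>b<d. ee (of_nat b / of_nat d) ^ n))"
      unfolding add_divide_distrib ee_add power_mult_distrib p_def sum_distrib_left ..
    then show ?thesis unfolding sum_roots_of_unity[OF d] by simp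
  qed
  have "(of_nat a * \<tau> + of_nat b) / of_nat d \<in> upper" for b
    using upper_affine[OF \<tau>, of "int a" "int d" "int b"] a d by simp
  then have "(\<lambda>n. if d dvd n then of_nat d * c n * p ^ n else 0) sums ?s"
    unfolding coeff[symmetric] by (intro sums_sum sums)
  moreover have strict_mono: "strict_mono ((*) k)" if "k > 0" for k :: nat using that by (simp add: strict_mono_def)
  ultimately have "(\<lambda>k. if d dvd d * k then of_nat d * c (d * k) * p ^ (d * k) else 0) sums ?s"
    using d by (subst sums_mono_reindex[OF strict_mono, where f = "\<lambda>n. if d dvd n then of_nat d * c n * p ^ n else 0"])
      (auto simp: dvd_def)
  then have "(\<lambda>k. ?f (a * k)) sums ?s" using a by (simp add: p_power)
  moreover have "?f j = 0" if "j \<notin> range ((*) a)" for j using that by (auto simp: dvd_def)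
  ultimately show ?thesis using sums_mono_reindex[OF strict_mono[OF a], of ?f] by blast
qed

definition hecke_coeff :: "int \<Rightarrow> nat \<Rightarrow> (int \<Rightarrow> complex) \<Rightarrow> nat \<Rightarrow> (nat \<Rightarrow> complex) \<Rightarrow> nat \<Rightarrow> complex" where
  "hecke_coeff w N \<psi> l c j = (\<Sum>a\<in>hecke_divisors N l. \<psi> (int a) * of_real (real a powr (of_int w / 2 - 1)) *
     (if a dvd j then c (l div a * (j div a)) else 0))"

lemma hecke_op_eq_sum_divisors:
  assumes "l > 0"
  shows "hecke_op w N \<psi> l g \<tau> = (\<Sum>a\<in>hecke_divisors N l. \<psi> (int a) * of_real (real a powr (of_int w / 2)) *
     (\<Sum>b<l div a. g ((of_nat a * \<tau> + of_nat b) / of_nat (l div a)))) / of_nat l"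
proof -
  let ?t = "\<lambda>a b. \<psi> a * of_real (of_int a powr (of_int w / 2)) * g ((of_int a * \<tau> + of_int b) / of_int (int l div a))"
  have "hecke_op w N \<psi> l g \<tau> = (\<Sum>(a, b)\<in>hecke_index N l. ?t a b) / of_nat l"
    by (simp add: hecke_op_def triangular_slash_def hecke_mat_def case_prod_beta mult.assoc)
  also have "(\<Sum>(a, b)\<in>hecke_index N l. ?t a b) = (\<Sum>a\<in>hecke_divisors N l. \<Sum>b\<in>{0..<int l div int a}. ?t (int a) b)"
    unfolding hecke_index_def using finite_hecke_divisors[OF assms]
    by (subst sum.Sigma[symmetric]) (auto simp: sum.reindex)
  also have "\<dots> = (\<Sum>a\<in>hecke_divisors N l. \<Sum>b<l div a. ?t (int a) (int b))"
  proof (rule sum.cong[OF refl])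
    fix a
    have "{0..<int l div int a} = int ` {..<l div a}"
      unfolding lessThan_atLeast0 image_int_atLeastLessThan by (simp add: zdiv_int)
    then show "(\<Sum>b\<in>{0..<int l div int a}. ?t (int a) b) = (\<Sum>b<l div a. ?t (int a) (int b))"
      by (simp add: sum.reindex)
  qed
  finally show ?thesis unfolding sum_distrib_left zdiv_int[symmetric] by simp
qed

lemma hecke_op_sums:
  assumes sums: "\<And>\<tau>. \<tau> \<in> upper \<Longrightarrow> (\<lambda>n. c n * ee \<tau> ^ n) sums g \<tau>" and l: "l > 0" and \<tau>: "\<tau> \<in> upper"
  shows "(\<lambda>j. hecke_coeff w N \<psi> l c j * ee \<tau> ^ j) sums hecke_op w N \<psi> l g \<tau>"
proof -
  have "(\<lambda>j. (if a dvd j then of_nat (l div a) * c (l div a * (j div a)) else 0) * ee \<tau> ^ j) sums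
      (\<Sum>b<l div a. g ((of_nat a * \<tau> + of_nat b) / of_nat (l div a)))" if "a \<in> hecke_divisors N l" for a
    using hecke_divisors_cofactor[OF that l] \<tau> by (intro sums_sum_translates[OF sums])
  then have "(\<lambda>j. (\<Sum>a\<in>hecke_divisors N l. \<psi> (int a) * of_real (real a powr (of_int w / 2)) *
      ((if a dvd j then of_nat (l div a) * c (l div a * (j div a)) else 0) * ee \<tau> ^ j)) / of_nat l)
      sums hecke_op w N \<psi> l g \<tau>"
    unfolding hecke_op_eq_sum_divisors[OF l]
    by (intro sums_divide sums_sum sums_mult)
  moreover have "(\<Sum>a\<in>hecke_divisors N l. \<psi> (int a) * of_real (real a powr (of_int w / 2)) *
      ((if a dvd j then of_nat (l div a) * c (l div a * (j div a)) else 0) * ee \<tau> ^ j)) / of_nat l =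
      hecke_coeff w N \<psi> l c j * ee \<tau> ^ j" for j
    unfolding hecke_coeff_def sum_distrib_right sum_divide_distrib
  proof (rule sum.cong[OF refl])
    fix a assume "a \<in> hecke_divisors N l"
    note cofactor = hecke_divisors_cofactor[OF this l]
    have l_eq: "(of_nat l :: complex) = of_nat a * of_nat (l div a)" using cofactor(3) by (metis of_nat_mult)
    have powr_eq: "real a powr (of_int w / 2 - 1) = real a powr (of_int w / 2) / real a"
      using cofactor(1) by (simp add: powr_diff)
    show "\<psi> (int a) * of_real (real a powr (of_int w / 2)) *
        ((if a dvd j then of_nat (l div a) * c (l div a * (j div a)) else 0) * ee \<tau> ^ j) / of_nat l =
        \<psi> (int a) * of_real (real a powr (of_int w / 2 - 1)) *
        (if a dvd j then c (l div a * (j div a)) else 0) * ee \<tau> ^ j"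
      unfolding l_eq powr_eq using cofactor(1,2) by (cases "a dvd j") simp_all
  qed
  ultimately show ?thesis by simp
qed

lemma hecke_coeff_0:
  "hecke_coeff w N \<psi> l c 0 = (\<Sum>a\<in>hecke_divisors N l. \<psi> (int a) * of_real (real a powr (of_int w / 2 - 1))) * c 0"
  by (simp add: hecke_coeff_def sum_distrib_right)

lemma hecke_coeff_1:
  assumes "l > 0"
  shows "hecke_coeff w N \<psi> l c 1 = \<psi> 1 * c l"
proof -
  have "hecke_coeff w N \<psi> l c 1 = (\<Sum>a\<in>hecke_divisors N l. if a = 1 then \<psi> 1 * c l else 0)"
    unfolding hecke_coeff_def by (intro sum.cong refl) auto
  also have "\<dots> = \<psi> 1 * c l" using finite_hecke_divisors[OF assms] by (simp add: hecke_divisors_def)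
  finally show ?thesis .
qed

lemma qseries_periodic:
  assumes "\<And>\<tau>. \<tau> \<in> upper \<Longrightarrow> (\<lambda>n. c n * ee \<tau> ^ n) sums g \<tau>" "\<tau> \<in> upper"
  shows "g (\<tau> + of_int n) = g \<tau>"
proof -
  have "\<tau> + of_int n \<in> upper" using assms(2) by (simp add: upper_def)
  from assms(1)[OF this] have "(\<lambda>k. c k * ee \<tau> ^ k) sums g (\<tau> + of_int n)" by (simp add: ee_add)
  then show ?thesis using assms(1)[OF assms(2)] by (rule sums_unique2)
qed

lemma proportional_if_cdim_1:
  assumes "cdim V = 1" "f \<in> V" "g \<in> V" "f x \<noteq> 0"
  obtains c where "\<And>x. g x = c * f x"
proof -
  interpret vs: vector_space "\<lambda>c (f :: complex \<Rightarrow> complex) x. c * f x"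
    by unfold_locales (auto simp: algebra_simps)
  obtain B where B: "B \<subseteq> V" "V \<subseteq> vs.span B" "card B = vs.dim V" using vs.basis_exists[of V] by metis
  then have "card B = 1" using assms(1) by (simp add: cdim_def)
  then obtain b where "B = {b}" by (rule card_1_singletonE)
  then have "f \<in> vs.span {b}" "g \<in> vs.span {b}" using assms(2,3) B by auto
  then obtain c1 c2 where c: "f = (\<lambda>x. c1 * b x)" "g = (\<lambda>x. c2 * b x)" unfolding vs.span_singleton by blast
  have "c1 \<noteq> 0" using assms(4) c(1) by auto
  then have "g x = (c2 / c1) * f x" for x unfolding c by simp
  then show ?thesis by (rule that)
qed

definition hecke_compatible :: "nat \<Rightarrow> nat \<Rightarrow> (mat2 \<Rightarrow> int \<Rightarrow> complex) \<Rightarrow> (int \<Rightarrow> complex) \<Rightarrow> bool" where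
  "hecke_compatible N l chi \<psi> \<longleftrightarrow> (\<forall>a b d. \<forall>\<gamma>\<in>Gamma0_normalised N.
     a > 0 \<and> d > 0 \<and> a * d = int l \<and> coprime a (int N) \<longrightarrow>
     (\<exists>\<gamma>'\<in>Gamma0 N. \<exists>a' b' d'. a' > 0 \<and> d' > 0 \<and> a' * d' = int l \<and> coprime a' (int N) \<and>
       (a, b, 0, d) \<odot> \<gamma> = \<gamma>' \<odot> (a', b', 0, d') \<and> \<psi> a * chi \<gamma>' 1 = chi \<gamma> 1 * \<psi> a'))"

locale hecke_form =
  fixes w :: int and N l :: nat and chi :: "mat2 \<Rightarrow> int \<Rightarrow> complex" and \<psi> :: "int \<Rightarrow> complex"
    and f :: "complex \<Rightarrow> complex" and c :: "nat \<Rightarrow> complex"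
  assumes N: "N > 0" and l: "l > 0" and f_in_Mk: "f \<in> Mk w N chi"
    and f_sums: "\<And>\<tau>. \<tau> \<in> upper \<Longrightarrow> (\<lambda>n. c n * ee \<tau> ^ n) sums f \<tau>"
    and f_nonzero: "\<And>\<tau>. \<tau> \<in> upper \<Longrightarrow> f \<tau> \<noteq> 0"
    and chi_finite_order: "\<And>\<gamma>. \<gamma> \<in> Gamma0 N \<Longrightarrow> \<exists>n>0. chi \<gamma> 1 ^ n = 1"
    and compatible: "hecke_compatible N l chi \<psi>"
begin

lemma hecke_term_transform:
  assumes p: "p \<in> hecke_index N l" and \<gamma>: "\<gamma> \<in> Gamma0_normalised N"
  obtains q \<gamma>' where "q \<in> hecke_index N l" "mat_det \<gamma>' = 1" "hecke_mat l p \<odot> \<gamma> = \<gamma>' \<odot> hecke_mat l q"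
    "\<And>\<tau>. \<tau> \<in> upper \<Longrightarrow> \<psi> (fst p) * slash w \<gamma> 1 (triangular_slash w (hecke_mat l p) f) \<tau> =
       chi \<gamma> 1 * (\<psi> (fst q) * triangular_slash w (hecke_mat l q) f \<tau>)"
proof -
  obtain a b d where ab: "p = (a, b)" "hecke_mat l p = (a, b, 0, d)" "a > 0" "d > 0" "a * d = int l" "coprime a (int N)"
    using hecke_indexE[OF p l] by metis
  obtain \<gamma>' a' b' d' where \<gamma>': "\<gamma>' \<in> Gamma0 N" and pos: "a' > 0" "d' > 0" "a' * d' = int l" "coprime a' (int N)"
    and eq: "(a, b, 0, d) \<odot> \<gamma> = \<gamma>' \<odot> (a', b', 0, d')" and \<psi>: "\<psi> a * chi \<gamma>' 1 = chi \<gamma> 1 * \<psi> a'"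
    using compatible[unfolded hecke_compatible_def, rule_format, where b = b, OF \<gamma> conjI[OF ab(3) conjI[OF ab(4) conjI[OF ab(5,6)]]]]
    by (elim bexE exE conjE) (rule that)
  define q where "q = (a', b' mod d')"
  have det: "mat_det \<gamma> = 1" "mat_det \<gamma>' = 1"
    using \<gamma> \<gamma>' Gamma0_normalised_subset by (auto intro: mat_det_Gamma0)
  have "int l div a' = d'" using pos(1,3) by (metis nonzero_mult_div_cancel_left less_irrefl)
  then have mat_q: "hecke_mat l q = (a', b' mod d', 0, d')" by (simp add: q_def hecke_mat_def)
  show ?thesis
  proof (rule that)
    show "q \<in> hecke_index N l" using hecke_index_iff[OF pos(1-3)] pos(2,4) by (simp add: q_def)
    show "mat_det (\<gamma>' \<odot> (1, b' div d', 0, 1)) = 1" using det(2) by (simp add: mat_det_mult)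
    show "hecke_mat l p \<odot> \<gamma> = \<gamma>' \<odot> (1, b' div d', 0, 1) \<odot> hecke_mat l q"
      unfolding ab(2) eq mat_q mat_mult_assoc triangular_eq_translation_mult[symmetric] ..
    fix \<tau> assume \<tau>: "\<tau> \<in> upper"
    have up: "moeb (a', b', 0, d') \<tau> \<in> upper" "moeb (hecke_mat l q) \<tau> \<in> upper"
      using upper_affine[OF \<tau> pos(1,2)] by (simp_all add: mat_q)
    have "moeb (a', b', 0, d') \<tau> = moeb (hecke_mat l q) \<tau> + of_int (b' div d')"
      using moeb_mult[of "hecke_mat l q" \<tau> "(1, b' div d', 0, 1)"] \<tau> pos(1,2)
      unfolding mat_q triangular_eq_translation_mult[symmetric] by simp
    then have f_eq: "f (moeb (a', b', 0, d') \<tau>) = f (moeb (hecke_mat l q) \<tau>)"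
      using qseries_periodic[OF f_sums up(2)] by simp
    have "slash w \<gamma>' 1 f (moeb (a', b', 0, d') \<tau>) = chi \<gamma>' 1 * f (moeb (a', b', 0, d') \<tau>)"
      using f_in_Mk \<gamma>' up(1) unfolding Mk_def modular_invariant_def by blast
    then have "\<psi> a * slash w \<gamma> 1 (triangular_slash w (a, b, 0, d) f) \<tau> =
        (\<psi> a * chi \<gamma>' 1) * triangular_slash w (hecke_mat l q) f \<tau>"
      unfolding slash_triangular[OF ab(3,4) pos(1,2) det eq \<tau>] triangular_slash_def f_eq
      by (simp add: mat_q mult_ac del: moeb_triangular)
    then show "\<psi> (fst p) * slash w \<gamma> 1 (triangular_slash w (hecke_mat l p) f) \<tau> =
        chi \<gamma> 1 * (\<psi> (fst q) * triangular_slash w (hecke_mat l q) f \<tau>)"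
      unfolding \<psi> ab(2) by (simp add: ab(1) q_def mult.assoc)
  qed
qed

lemma hecke_op_transform:
  assumes \<gamma>: "\<gamma> \<in> Gamma0_normalised N" and \<tau>: "\<tau> \<in> upper"
  shows "slash w \<gamma> 1 (hecke_op w N \<psi> l f) \<tau> = chi \<gamma> 1 * hecke_op w N \<psi> l f \<tau>"
proof -
  let ?I = "hecke_index N l"
  let ?s = "\<lambda>p. \<psi> (fst p) * slash w \<gamma> 1 (triangular_slash w (hecke_mat l p) f) \<tau>"
    and ?t = "\<lambda>q. \<psi> (fst q) * triangular_slash w (hecke_mat l q) f \<tau>"
  have "\<forall>p\<in>?I. \<exists>q. q \<in> ?I \<and> (\<exists>\<gamma>'. mat_det \<gamma>' = 1 \<and> hecke_mat l p \<odot> \<gamma> = \<gamma>' \<odot> hecke_mat l q) \<and> ?s p = chi \<gamma> 1 * ?t q"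
  proof
    fix p assume "p \<in> ?I"
    then show "\<exists>q. q \<in> ?I \<and> (\<exists>\<gamma>'. mat_det \<gamma>' = 1 \<and> hecke_mat l p \<odot> \<gamma> = \<gamma>' \<odot> hecke_mat l q) \<and> ?s p = chi \<gamma> 1 * ?t q"
      by (rule hecke_term_transform[OF _ \<gamma>]) (use \<tau> in blast)
  qed
  from bchoice[OF this] obtain \<pi> where \<pi>: "\<And>p. p \<in> ?I \<Longrightarrow> \<pi> p \<in> ?I"
    "\<And>p. p \<in> ?I \<Longrightarrow> \<exists>\<gamma>'. mat_det \<gamma>' = 1 \<and> hecke_mat l p \<odot> \<gamma> = \<gamma>' \<odot> hecke_mat l (\<pi> p)"
    "\<And>p. p \<in> ?I \<Longrightarrow> ?s p = chi \<gamma> 1 * ?t (\<pi> p)" by blast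
  have "mat_det \<gamma> = 1" using \<gamma> Gamma0_normalised_subset mat_det_Gamma0 by blast
  then have "inj_on \<pi> ?I" using \<pi>(2) hecke_mat_transport_inj[OF _ _ l] by (intro inj_onI) metis
  then have bij: "bij_betw \<pi> ?I ?I" using \<pi>(1) finite_hecke_index[OF l] by (intro bij_betw_if_inj_on_endo) auto
  have "(\<Sum>p\<in>?I. ?s p) = (\<Sum>p\<in>?I. chi \<gamma> 1 * ?t (\<pi> p))" by (intro sum.cong refl \<pi>(3))
  also have "\<dots> = (\<Sum>p\<in>?I. chi \<gamma> 1 * ?t p)" by (rule sum.reindex_bij_betw[OF bij])
  finally show ?thesis unfolding slash_hecke_op hecke_op_def times_divide_eq_right sum_distrib_left by simp
qed

lemma hecke_op_in_Mk: "hecke_op w N \<psi> l f \<in> Mk w N chi"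
proof (rule Mk_if_bounded_at_cusps)
  have f: "modular_invariant w N chi f" using f_in_Mk by (simp add: Mk_def)
  show "modular_invariant w N chi (hecke_op w N \<psi> l f)"
  proof (rule modular_invariant_if_Gamma0_normalised[OF N f f_nonzero])
    show "hecke_op w N \<psi> l f holomorphic_on upper"
      using f l by (intro hecke_op_holomorphic) (simp_all add: modular_invariant_def)
    show "hecke_op w N \<psi> l f \<tau> = 0" if "\<tau> \<notin> upper" for \<tau>
      using f l that by (intro hecke_op_eq_0_off_upper) (simp_all add: modular_invariant_def)
    show "f (\<tau> + 1) = f \<tau>" if "\<tau> \<in> upper" for \<tau> using qseries_periodic[OF f_sums that, where n = 1] by simp
    show "hecke_op w N \<psi> l f (\<tau> + 1) = hecke_op w N \<psi> l f \<tau>" if "\<tau> \<in> upper" for \<tau>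
      using qseries_periodic[OF hecke_op_sums[OF f_sums l] that, where n = 1] by simp
  qed (assumption, erule (1) hecke_op_transform)
  show "\<exists>K. \<forall>\<tau>. Im \<tau> \<ge> 1 \<longrightarrow> norm (slash w \<sigma> 1 (hecke_op w N \<psi> l f) \<tau>) \<le> K" if "mat_det \<sigma> = 1" for \<sigma>
    using f_in_Mk that l by (intro hecke_op_bounded_at_cusps) (simp_all add: Mk_def)
qed (rule N, erule chi_finite_order)

lemma coeff_eq_if_cdim_1:
  assumes "cdim (Mk w N chi) = 1" "c 0 = 1" "\<psi> 1 = 1"
  shows "c l = c 1 * (\<Sum>a\<in>hecke_divisors N l. \<psi> (int a) * of_real (real a powr (of_int w / 2 - 1)))"
proof -
  have "f \<i> \<noteq> 0" by (rule f_nonzero) (simp add: upper_def)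
  then obtain \<Lambda> where \<Lambda>: "\<And>\<tau>. hecke_op w N \<psi> l f \<tau> = \<Lambda> * f \<tau>"
    by (rule proportional_if_cdim_1[OF assms(1) f_in_Mk hecke_op_in_Mk]) (rule that)
  have "(\<lambda>j. \<Lambda> * c j * ee \<tau> ^ j) sums hecke_op w N \<psi> l f \<tau>" if "\<tau> \<in> upper" for \<tau>
    unfolding \<Lambda> mult.assoc by (intro sums_mult f_sums that)
  with hecke_op_sums[OF f_sums l] have "hecke_coeff w N \<psi> l c = (\<lambda>j. \<Lambda> * c j)" by (rule qseries_unique)
  then have "hecke_coeff w N \<psi> l c 0 = \<Lambda> * c 0" "hecke_coeff w N \<psi> l c 1 = \<Lambda> * c 1" by simp_all
  then show ?thesis
    using hecke_coeff_0[of w N \<psi> l c] hecke_coeff_1[OF l, of w N \<psi> c] assms(2,3) by (simp add: mult.commute)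
qed

end

section \<open>Normalised cosets\<close>

lemma triangular_coset_relations:
  fixes a d a' d' b' C D C' D' :: int
  assumes "(a, b, 0, d) \<odot> (A, B, C, D) = (A', B', C', D') \<odot> (a', b', 0, d')" "a' * d' = a * d" "a' \<noteq> 0" "d' \<noteq> 0"
  shows "a * C' = d' * C" "a * D' = a' * D - b' * C"
proof -
  have eqs: "d * C = C' * a'" "d * D = C' * b' + D' * d'" using assms(1) by simp_all
  have "a' * (a * C') = a * (d * C)" by (simp add: eqs(1))
  also have "\<dots> = a' * (d' * C)" unfolding mult.assoc[symmetric] assms(2) ..
  finally show C': "a * C' = d' * C" using assms(3) by simp
  have "d' * (a * D') = a * (d * D) - b' * (a * C')" unfolding eqs(2) by (simp add: algebra_simps)
  also have "\<dots> = d' * (a' * D - b' * C)"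
    unfolding C' mult.assoc[symmetric] assms(2)[symmetric] by (simp add: algebra_simps)
  finally show "a * D' = a' * D - b' * C" using assms(4) by simp
qed

lemma coprime_if_mult_eq_diff:
  fixes a a' b C D D' Q :: int
  assumes eq: "a * D' = a' * D - b * C" and b: "Q dvd b" and coprime: "coprime a' Q" "coprime D Q"
  shows "coprime D' Q"
proof (rule coprimeI)
  fix q assume q: "q dvd D'" "q dvd Q"
  then have "q dvd a * D' + b * C" using b by (meson dvd_add dvd_mult dvd_mult2 dvd_trans)
  then have "q dvd a' * D" unfolding eq by simp
  moreover have "coprime (a' * D) Q" using coprime by simp
  ultimately show "is_unit q" using q(2) coprime_common_divisor by blast
qed

lemma hecke_coset_normalised:
  assumes \<gamma>: "(A, B, C, D) \<in> Gamma0 N" "C \<noteq> 0" and pos: "a > 0" "d > 0" and coprime: "coprime a (int N)"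
    and Q: "Q \<noteq> 0" "coprime (a * d) Q" "coprime D Q"
  obtains A' B' C' D' a' b' d' where "(A', B', C', D') \<in> Gamma0 N"
    "(a, b, 0, d) \<odot> (A, B, C, D) = (A', B', C', D') \<odot> (a', b', 0, d')"
    "a' > 0" "d' > 0" "a' * d' = a * d" "coprime a' (int N)" "Q dvd b'" "D' > 0" "coprime D' 6"
proof -
  obtain \<gamma>' a' b0 d' where dec: "\<gamma>' \<in> Gamma0 N" "(a, b, 0, d) \<odot> (A, B, C, D) = \<gamma>' \<odot> (a', b0, 0, d')"
    "a' > 0" "d' > 0" "a' * d' = a * d" "coprime a' (int N)"
    by (rule hecke_coset[OF \<gamma>(1) pos coprime])
  obtain A' B0 C' D0 where ABCD: "\<gamma>' = (A', B0, C', D0)" by (metis prod_cases4)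
  have shift: "(a, b, 0, d) \<odot> (A, B, C, D) = (A', B0 - t * A', C', D0 - t * C') \<odot> (a', b0 + t * d', 0, d')" for t
    unfolding dec(2) ABCD by (simp add: algebra_simps)
  note relations = triangular_coset_relations[OF shift dec(5)]
  have coprime_Q: "coprime a' Q" "coprime d' Q" using Q(2) unfolding dec(5)[symmetric] by simp_all
  then obtain t where "[d' * t = - b0] (mod Q)"
    using cong_solve_coprime_int[of d' Q] by (metis cong_scalar_right mult.assoc mult_1)
  then have Q_dvd: "Q dvd b0 + t * d'" by (simp add: cong_iff_dvd_diff algebra_simps)
  define D1 where "D1 = D0 - t * C'"
  have D1: "a * D1 = a' * D - (b0 + t * d') * C" using relations(2)[of t] dec(3,4) by (simp add: D1_def)
  have "coprime D1 Q" by (rule coprime_if_mult_eq_diff[OF D1 Q_dvd coprime_Q(1) Q(3)])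
  moreover have "A' * D1 - (B0 - t * A') * C' = 1" using dec(1) by (simp add: ABCD D1_def algebra_simps)
  from coprime_if_det_1[OF this] have "coprime D1 C'" by (simp only: coprime_commute)
  ultimately have "coprime D1 (Q * C')" by simp
  moreover have "C' \<noteq> 0" using relations(1) dec(3,4) \<gamma>(2) pos by auto
  ultimately obtain s where s: "D1 + s * (Q * C') > 0" "coprime (D1 + s * (Q * C')) 6"
    using ex_shift_coprime_6[of D1 "Q * C'"] Q(1) by auto
  define u where "u = t - s * Q"
  have D': "D0 - u * C' = D1 + s * (Q * C')" by (simp add: u_def D1_def algebra_simps)
  have "(A', B0 - u * A', C', D0 - u * C') \<in> Gamma0 N" using dec(1) by (simp add: ABCD algebra_simps)
  moreover have "b0 + u * d' = (b0 + t * d') - Q * (s * d')" by (simp add: u_def algebra_simps)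
  then have "Q dvd b0 + u * d'" using Q_dvd by (simp only: dvd_diff dvd_triv_left)
  ultimately show ?thesis using that shift[of u] dec(3-6) s unfolding D' by metis
qed

section \<open>Compatibility of the Hecke operator with the character\<close>

lemma
  assumes "(\<Sum>n\<in>{n. n dvd N}. int n * r n) = 0"
  shows m_f_pos: "m_f r N > 0" and m_f_dvd_24: "m_f r N dvd 24"
    and dvd_m_f_mult_codivisor_sum: "24 dvd m_f r N * codivisor_sum r N"
proof -
  define g where "g = gcd 24 (codivisor_sum r N)"
  have g: "g > 0" "g dvd 24" "g dvd codivisor_sum r N" by (simp_all add: g_def)
  have "m_f r N = 24 div g" unfolding m_f_def codivisor_sum_def g_def assms by simp
  then have m: "m_f r N * g = 24" using g(2) by simp
  then show "m_f r N > 0" using g(1) by (metis zero_less_mult_pos2 zero_less_numeral)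
  show "m_f r N dvd 24" using m by (metis dvd_triv_left)
  have "m_f r N * g dvd m_f r N * codivisor_sum r N" using g(3) by (rule mult_dvd_mono[OF dvd_refl])
  then show "24 dvd m_f r N * codivisor_sum r N" unfolding m .
qed

definition hecke_twist :: "(nat \<Rightarrow> int) \<Rightarrow> nat \<Rightarrow> nat \<Rightarrow> int \<Rightarrow> complex" where
  "hecke_twist r N l a = (if odd l then eta_twist r N (int l - int l div a) else 1)"

definition hecke_weight :: "(nat \<Rightarrow> int) \<Rightarrow> nat \<Rightarrow> nat \<Rightarrow> int \<Rightarrow> complex" where
  "hecke_weight r N l a = of_int (kronecker a (varpi r N)) * hecke_twist r N l a"

locale eta_hecke =
  fixes r :: "nat \<Rightarrow> int" and N l :: nat
  assumes N: "N > 0" and sum0: "(\<Sum>n\<in>{n. n dvd N}. int n * r n) = 0"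
    and l_in_L_f: "l \<in> L_f r N"
    and l_squarefree: "\<And>p. prime p \<Longrightarrow> \<not> p dvd N \<Longrightarrow> \<not> p ^ 2 dvd l"
    and odd_l_or_N: "odd l \<or> odd N"
begin

lemma l_pos: "l > 0"
  using l_in_L_f by (simp add: L_f_def)

lemma l_cong_1: "[int l = 1] (mod m_f r N)"
  using l_in_L_f by (simp add: L_f_def)

lemma l_square_if_odd_weight: "odd (wt2 r N) \<Longrightarrow> \<exists>t. l = t ^ 2"
  using l_in_L_f by (simp add: L_f_def)

lemma coprime_l_m_f: "coprime (int l) (m_f r N)"
  using l_cong_1 by (metis cong_imp_coprime cong_sym coprime_1_left)

lemma hecke_divisor_eq_1_if_odd_weight:
  assumes "odd (wt2 r N)" "a \<in> hecke_divisors N l"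
  shows "a = 1"
proof (rule ccontr)
  assume "a \<noteq> 1"
  then obtain p where p: "prime p" "p dvd a" by (metis prime_factor_nat)
  obtain t where t: "l = t ^ 2" using l_square_if_odd_weight assms(1) by blast
  have "p dvd t ^ 2" using p(2) assms(2) t by (auto simp: hecke_divisors_def intro: dvd_trans)
  then have "p ^ 2 dvd l" unfolding t using p(1) prime_dvd_power dvd_power_same by blast
  then have "p dvd N" using l_squarefree p(1) by blast
  then show False using p assms(2) by (auto simp: hecke_divisors_def dest: coprime_common_divisor)
qed

lemma odd_l_if_odd_weight:
  assumes "odd (wt2 r N)"
  shows "odd l"
proof
  assume "even l"
  then have "2 \<in> hecke_divisors N l" using odd_l_or_N by (simp add: hecke_divisors_def)
  from hecke_divisor_eq_1_if_odd_weight[OF assms this] show False by simp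
qed

lemma eta_twist_eq_1_if_even_l:
  assumes "even l" "even x"
  shows "eta_twist r N x = 1"
proof -
  let ?k = "3 * wt2 r N + 2 * int (delta_of (varpi r N))"
  have "coprime 2 (m_f r N)" using coprime_divisors[OF _ dvd_refl coprime_l_m_f, of 2] assms(1) by simp
  then have "coprime (2 ^ 2) (m_f r N)" by (simp only: coprime_power_left_iff simp_thms)
  moreover have "2 ^ 2 dvd m_f r N * codivisor_sum r N"
    by (rule dvd_trans[OF _ dvd_m_f_mult_codivisor_sum[OF sum0]]) simp
  ultimately have "4 dvd codivisor_sum r N" by (simp add: coprime_dvd_mult_right_iff)
  moreover have "4 dvd codivisor_sum r N - (wt2 r N - 2 * int (delta_of (varpi r N)))"
    using codivisor_sum_cong_4[of N r] odd_l_or_N assms(1) by (simp add: cong_iff_dvd_diff)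
  ultimately have "4 dvd ?k" by presburger
  then have "4 * 2 dvd ?k * x" using assms(2) by (rule mult_dvd_mono)
  then have "[?k * x = 0] (mod 8)" by (simp add: cong_iff_dvd_diff)
  from ee_eq_if_cong[OF this] show ?thesis by (simp add: eta_twist_def)
qed

lemma eta_twist_eq_ee_quarter:
  assumes "odd l" "a \<in> hecke_divisors N l"
  shows "eta_twist r N (int l - int l div int a) =
    ee (of_real ((real_of_int (wt2 r N) / 2 + real (delta_of (varpi r N))) * (real l - real (l div a)) / 4))"
proof (cases "odd (wt2 r N)")
  case True
  then have "a = 1" using hecke_divisor_eq_1_if_odd_weight assms(2) by blast
  then show ?thesis by (simp add: eta_twist_def)
next
  case False
  then obtain k where k: "wt2 r N = 2 * k" by (auto elim: evenE)
  have "odd (l div a)" using hecke_divisors_cofactor(3)[OF assms(2) l_pos] assms(1) by (metis even_mult_iff)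
  then obtain y where y: "int l - int (l div a) = 2 * y" using assms(1) by (metis even_diff even_of_nat evenE odd_even_add)
  have "real l - real (l div a) = real_of_int (2 * y)" unfolding y[symmetric] by simp
  then have "eta_twist r N (int l - int l div int a) = ee (of_int (k * y) +
      of_real ((real_of_int (wt2 r N) / 2 + real (delta_of (varpi r N))) * (real l - real (l div a)) / 4))"
    unfolding eta_twist_def zdiv_int[symmetric] y k by (intro arg_cong[where f = ee]) (simp add: field_simps)
  then show ?thesis by (simp only: ee_add ee_of_int mult_1)
qed

context
  fixes a d a' d' b' c D c' D' :: int
  assumes a: "a > 0" "d > 0" "a * d = int l" "coprime a (int N)"
    and a': "a' > 0" "d' > 0" "a' * d' = int l" "coprime a' (int N)"
    and c: "c > 0" "odd c" and D: "D > 0" "coprime D 6" "D' > 0" "coprime D' 6"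
    and coprime_D: "coprime (int N * c) D" "coprime (int N * c') D'"
    and relations: "a * c' = d' * c" "a * D' = a' * D - b' * (int N * c)"
    and b': "m_f r N dvd b'" "odd l \<Longrightarrow> 8 dvd b'"
begin

lemma odd_lower_right: "odd D" "odd D'"
  using D(2,4) by (simp_all add: coprime_6_iff)

lemma exponential_factor_eq:
  "ee (of_int (- (D' * c' * codivisor_sum r N)) / of_int 24) = ee (of_int (- (D * c * codivisor_sum r N)) / of_int 24)"
proof (rule ee_eq_if_cong)
  let ?m = "m_f r N"
  have "coprime a ?m" using coprime_l_m_f unfolding a(3)[symmetric] by simp
  then have square: "?m dvd a * a - 1" by (rule dvd_square_minus_1_if_dvd_24[OF m_f_dvd_24[OF sum0] m_f_pos[OF sum0]])
  have l: "?m dvd int l - 1" using l_cong_1 by (simp add: cong_iff_dvd_diff)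
  have "(a * a) * (D' * c') = (a * D') * (a * c')" by (simp add: algebra_simps)
  also have "\<dots> = int l * (D * c) - b' * (d' * c * (int N * c))"
    unfolding relations a'(3)[symmetric] by (simp add: algebra_simps)
  finally have "D' * c' - D * c = (int l - 1) * (D * c) - b' * (d' * c * (int N * c)) - (a * a - 1) * (D' * c')"
    by (simp add: algebra_simps)
  then have "?m dvd D' * c' - D * c"
    using dvd_diff[OF dvd_diff[OF dvd_mult2[OF l] dvd_mult2[OF b'(1)]] dvd_mult2[OF square]] by simp
  then have "?m * codivisor_sum r N dvd (D' * c' - D * c) * codivisor_sum r N" by (rule mult_dvd_mono[OF _ dvd_refl])
  then have "24 dvd (D' * c' - D * c) * codivisor_sum r N"
    by (rule dvd_trans[OF dvd_m_f_mult_codivisor_sum[OF sum0]])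
  then show "[- (D' * c' * codivisor_sum r N) = - (D * c * codivisor_sum r N)] (mod 24)"
    by (simp add: cong_iff_dvd_diff dvd_diff_commute algebra_simps)
qed simp

lemma kronecker_factor_eq:
  "kronecker a (varpi r N) * kronecker D' (varpi r N) = kronecker D (varpi r N) * kronecker a' (varpi r N)"
proof -
  have "kronecker (a * D') (varpi r N) = kronecker (a' * D) (varpi r N)"
  proof (rule kronecker_cong)
    fix p assume "prime p" "p dvd varpi r N"
    then have "int p dvd int N" using prime_dvd_varpi by simp
    then show "[a * D' = a' * D] (mod int p)" unfolding relations by (simp add: cong_iff_dvd_diff)
  next
    assume "even (varpi r N)"
    then have "8 dvd b'" using prime_dvd_varpi[of 2 r N] b'(2) odd_l_or_N by auto
    then show "[a * D' = a' * D] (mod 8)" unfolding relations by (simp add: cong_iff_dvd_diff)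
  qed
  moreover have "coprime D (int (varpi r N))" "coprime D' (int (varpi r N))"
    using coprime_D by (auto intro!: coprime_varpi simp: coprime_commute)
  ultimately show ?thesis
    using coprime_varpi[OF a(4)] coprime_varpi[OF a'(4)] by (simp add: kronecker_mult_left mult.commute)
qed

lemma upper_left_eq_1_if_odd_weight:
  assumes "odd (wt2 r N)" "x > 0" "x * y = int l" "coprime x (int N)"
  shows "x = 1"
proof -
  obtain n where n: "x = int n" using assms(2) by (metis zero_less_imp_eq_int)
  have "int n dvd int l" unfolding assms(3)[symmetric] n by simp
  then have "n \<in> hecke_divisors N l" using assms(4) by (simp add: n hecke_divisors_def)
  then show ?thesis using hecke_divisor_eq_1_if_odd_weight[OF assms(1)] n by simp
qed

lemma odd_weight_relations:
  assumes "odd (wt2 r N)"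
  shows "a = 1" "a' = 1" "d = int l" "d' = int l" "[D' = D] (mod 8)" "D' = D - b' * (int N * c)"
proof -
  show aa': "a = 1" "a' = 1" using upper_left_eq_1_if_odd_weight[OF assms] a a' by blast+
  then show "d = int l" "d' = int l" using a(3) a'(3) by simp_all
  show "D' = D - b' * (int N * c)" using relations(2) by (simp add: aa')
  then show "[D' = D] (mod 8)" using b'(2)[OF odd_l_if_odd_weight[OF assms]] by (simp add: cong_iff_dvd_diff)
qed

lemma jacobi_factor_eq: "jacobi c' D' ^ nat \<bar>wt2 r N\<bar> = jacobi c D ^ nat \<bar>wt2 r N\<bar>"
proof (cases "odd (wt2 r N)")
  case True
  note odd_weight = odd_weight_relations[OF True]
  obtain t where t: "l = t ^ 2" using l_square_if_odd_weight[OF True] by blast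
  have c': "c' = int t * int t * c" using relations(1) by (simp add: odd_weight(1,4) t power2_eq_square)
  have coprime: "coprime (int t) D'" "coprime c D'" "coprime c D" using coprime_D unfolding c' by simp_all
  have square: "jacobi (int t) D' * jacobi (int t) D' = 1" using jacobi_values[of "int t" D'] by auto
  have "jacobi c' D' = (jacobi (int t) D' * jacobi (int t) D') * jacobi c D'"
    unfolding c' using coprime odd_lower_right by (simp add: jacobi_mult_left)
  then have drop_square: "jacobi c' D' = jacobi c D'" unfolding square by simp
  have "[D' = D] (mod c)" unfolding odd_weight(6) by (simp add: cong_iff_dvd_diff)
  then have upper: "jacobi D' c = jacobi D c" by (rule jacobi_cong)
  have "[D' = D] (mod 4)" using odd_weight(5) by (rule cong_dvd_modulus) simp
  then have "D' mod 4 = D mod 4" by (simp only: cong_def)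
  then have "jacobi c D' = jacobi c D"
    using jacobi_reciprocity[OF coprime(2) c(1) D(3) c(2) odd_lower_right(2)]
      jacobi_reciprocity[OF coprime(3) c(1) D(1) c(2) odd_lower_right(1)]
    unfolding upper by simp
  then show ?thesis unfolding drop_square by simp
next
  case False
  then have "even (nat \<bar>wt2 r N\<bar>)" by (simp add: even_nat_iff)
  then have "jacobi h k ^ nat \<bar>wt2 r N\<bar> = 1" for h k using jacobi_values[of h k] by auto
  then show ?thesis by simp
qed

lemma twist_factor_eq:
  "hecke_twist r N l a * eta_twist r N (1 - D') = eta_twist r N (1 - D) * hecke_twist r N l a'"
proof (cases "odd l")
  case False
  then show ?thesis using odd_lower_right by (simp add: hecke_twist_def eta_twist_eq_1_if_even_l)
next
  case True
  have "int l div a = d" "int l div a' = d'"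
    using a(1,3) a'(1,3) by (metis nonzero_mult_div_cancel_left less_irrefl)+
  then have twist: "hecke_twist r N l a = eta_twist r N (int l - d)" "hecke_twist r N l a' = eta_twist r N (int l - d')"
    using True by (simp_all add: hecke_twist_def)
  have "eta_twist r N ((int l - d) + (1 - D')) = eta_twist r N ((1 - D) + (int l - d'))"
  proof (cases "odd (wt2 r N)")
    case True
    then show ?thesis
      using odd_weight_relations[OF True] by (intro eta_twist_cong_8) (simp add: cong_iff_dvd_diff dvd_diff_commute)
  next
    case False
    have odd: "odd a" "odd d" "odd a'" "odd d'" using True a(3) a'(3) by (metis even_mult_iff even_of_nat)+
    have "4 dvd b'" by (rule dvd_trans[OF _ b'(2)[OF True]]) simp
    then have "[a * D' = a' * D] (mod 4)" unfolding relations by (simp add: cong_iff_dvd_diff)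
    then have "[a + D' - 1 = a' + D - 1] (mod 4)"
      using odd_mult_cong_4[OF odd(1) odd_lower_right(2)] odd_mult_cong_4[OF odd(3) odd_lower_right(1)]
      by (meson cong_sym cong_trans)
    moreover have "[a + d - 1 = a' + d' - 1] (mod 4)"
      using odd_mult_cong_4[OF odd(1,2)] odd_mult_cong_4[OF odd(3,4)] unfolding a(3) a'(3)
      by (meson cong_sym cong_trans)
    ultimately have "[(int l - d) + (1 - D') = (1 - D) + (int l - d')] (mod 4)"
      using odd_lower_right unfolding cong_iff_dvd_diff by presburger
    then show ?thesis by (rule eta_twist_cong_4[rotated]) (use False in simp)
  qed
  then show ?thesis unfolding twist eta_twist_add .
qed

lemma hecke_weight_eta_char:
  assumes "A * D - B * (int N * c) = 1" "A' * D' - B' * (int N * c') = 1"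
  shows "hecke_weight r N l a * eta_char r N (A', B', int N * c', D') 1 =
    eta_char r N (A, B, int N * c, D) 1 * hecke_weight r N l a'"
proof -
  have "a * c' > 0" unfolding relations(1) using a'(2) c(1) by simp
  then have c': "c' > 0" using a(1) by (metis zero_less_mult_pos)
  let ?e = "ee (of_int (- (D * c * codivisor_sum r N)) / of_int 24)" and ?J = "jacobi c D ^ nat \<bar>wt2 r N\<bar>"
    and ?v = "varpi r N"
  have "hecke_weight r N l a * eta_char r N (A', B', int N * c', D') 1 =
      ?e * of_int ?J * of_int (kronecker a ?v * kronecker D' ?v) * (hecke_twist r N l a * eta_twist r N (1 - D'))"
    unfolding hecke_weight_def eta_char_eq[OF N sum0 assms(2) c' D(3,4)] exponential_factor_eq jacobi_factor_eq of_int_mult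
    by (simp only: mult_ac)
  also have "\<dots> = eta_char r N (A, B, int N * c, D) 1 * hecke_weight r N l a'"
    unfolding twist_factor_eq kronecker_factor_eq hecke_weight_def eta_char_eq[OF N sum0 assms(1) c(1) D(1,2)] of_int_mult
    by (simp only: mult_ac)
  finally show ?thesis .
qed

end

text \<open>The modulus \<open>Q\<close> of the normalisation is chosen such that \<open>b'\<close> disappears from all factors of the character.\<close>
lemma hecke_compatible_eta_char: "hecke_compatible N l (eta_char r N) (hecke_weight r N l)"
  unfolding hecke_compatible_def
proof (intro allI ballI impI, elim conjE)
  fix a b d :: int and \<gamma>
  assume a: "a > 0" "d > 0" "a * d = int l" "coprime a (int N)" and \<gamma>: "\<gamma> \<in> Gamma0_normalised N"
  obtain A B C D where ABCD: "\<gamma> = (A, B, C, D)" by (metis prod_cases4)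
  then have \<gamma>_Gamma0: "(A, B, C, D) \<in> Gamma0 N" and C: "C > 0" "odd (C div int N)" and D: "D > 0" "coprime D 6"
    using \<gamma> by (simp_all add: Gamma0_normalised_def)
  define Q where "Q = (if odd l then 8 * m_f r N else m_f r N)"
  have m: "m_f r N > 0" "m_f r N dvd 24" using m_f_pos[OF sum0] m_f_dvd_24[OF sum0] .
  have "coprime (int l) (2 ^ 3)" if "odd l" using that by (simp only: coprime_power_right_iff) simp
  then have "coprime (a * d) Q" using coprime_l_m_f by (simp add: a(3) Q_def)
  moreover have "Q dvd 8 * m_f r N" by (simp add: Q_def)
  then have "Q dvd 8 * 24" by (rule dvd_trans) (rule mult_dvd_mono[OF dvd_refl m(2)])
  then have "Q dvd 6 ^ 6" by (rule dvd_trans) simp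
  then have "coprime D Q" by (rule coprime_divisors[OF dvd_refl]) (use D(2) in \<open>simp only: coprime_power_right_iff simp_thms\<close>)
  moreover have "Q \<noteq> 0" using m(1) by (simp add: Q_def)
  ultimately have Q: "Q \<noteq> 0" "coprime (a * d) Q" "coprime D Q" by simp_all
  obtain A' B' C' D' a' b' d' where \<gamma>': "(A', B', C', D') \<in> Gamma0 N"
    and eq: "(a, b, 0, d) \<odot> (A, B, C, D) = (A', B', C', D') \<odot> (a', b', 0, d')"
    and a': "a' > 0" "d' > 0" "a' * d' = a * d" "coprime a' (int N)" and b': "Q dvd b'" and D': "D' > 0" "coprime D' 6"
    by (rule hecke_coset_normalised[OF \<gamma>_Gamma0 less_imp_neq[OF C(1), symmetric] a(1,2,4) Q]) (rule that)
  obtain c c' where c: "C = int N * c" "C' = int N * c'" using \<gamma>_Gamma0 \<gamma>' by (auto elim!: dvdE)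
  have "c > 0" "odd c" using C N by (simp_all add: c zero_less_mult_iff)
  have det: "A * D - B * (int N * c) = 1" "A' * D' - B' * (int N * c') = 1" using \<gamma>_Gamma0 \<gamma>' by (simp_all add: c)
  have relations: "a * C' = d' * C" "a * D' = a' * D - b' * C"
    using triangular_coset_relations[OF eq a'(3)] a'(1,2) by simp_all
  have "int N * (a * c') = int N * (d' * c)" using relations(1) by (simp only: c mult_ac)
  then have "a * c' = d' * c" using N by simp
  have "m_f r N dvd b'" using b' by (auto simp: Q_def split: if_splits dest: dvd_mult_right)
  moreover have "8 dvd b'" if "odd l" using b' that by (auto simp: Q_def dest: dvd_mult_left)
  ultimately have "hecke_weight r N l a * eta_char r N (A', B', int N * c', D') 1 =
      eta_char r N (A, B, int N * c, D) 1 * hecke_weight r N l a'"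
    by (rule hecke_weight_eta_char[OF a a'(1,2) a'(3)[unfolded a(3)] a'(4) \<open>c > 0\<close> \<open>odd c\<close> D D'
          coprime_if_det_1[OF det(1)] coprime_if_det_1[OF det(2)] \<open>a * c' = d' * c\<close> relations(2)[unfolded c] _ _ det])
  then show "\<exists>\<gamma>'\<in>Gamma0 N. \<exists>a' b' d'. a' > 0 \<and> d' > 0 \<and> a' * d' = int l \<and> coprime a' (int N) \<and>
      (a, b, 0, d) \<odot> \<gamma> = \<gamma>' \<odot> (a', b', 0, d') \<and>
      hecke_weight r N l a * eta_char r N \<gamma>' 1 = eta_char r N \<gamma> 1 * hecke_weight r N l a'"
    using a' eq unfolding ABCD c a(3) by (intro bexI[OF _ \<gamma>'[unfolded c]] exI conjI)
qed

end

section \<open>Coefficients of weakly admissible eta-quotients\<close>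

lemma eta_quotient_not_in_Sk:
  assumes "N > 0" "(\<Sum>n\<in>{n. n dvd N}. int n * r n) = 0"
  shows "on_upper (eta_quotient r N) \<notin> Sk w N chi"
proof
  let ?f = "on_upper (eta_quotient r N)"
  assume "?f \<in> Sk w N chi"
  then have "qexp_pos (slash w (1, 0, 0, 1) 1 ?f)" by (simp add: Sk_def)
  from qexp_pos_tendsto_0[OF this] have "((\<lambda>y. ?f (\<i> * of_real y)) \<longlongrightarrow> 0) at_top"
    by (simp only: slash_identity)
  moreover have "(\<lambda>n. eta_coeff r N n * ee (of_real ((of_nat n + 0) / 1) * \<tau>)) sums ?f \<tau>" if "\<tau> \<in> upper" for \<tau>
    using eta_coeff_sums[OF assms that] that by (simp add: on_upper_def ee_power)
  from qexp_tendsto_constant_term[OF zero_less_one order_refl this]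
  have "((\<lambda>y. ?f (\<i> * of_real y)) \<longlongrightarrow> eta_coeff r N 0) at_top" by simp
  ultimately have "eta_coeff r N 0 = 0" by (rule tendsto_unique[OF trivial_limit_at_top_linorder, rotated])
  then show False using eta_coeff_0[OF assms] by simp
qed

lemma cdim_Mk_if_weakly_admissible:
  assumes "weakly_admissible r N" "N > 0" "(\<Sum>n\<in>{n. n dvd N}. int n * r n) = 0"
  shows "cdim (Mk (wt2 r N) N (eta_char r N)) = 1"
  using assms eta_quotient_not_in_Sk unfolding weakly_admissible_def Let_def by blast

lemma hecke_divisors_if_rad_dvd:
  assumes "rad l dvd rad N" "l > 0"
  shows "hecke_divisors N l = {1}"
proof -
  have "a = 1" if a: "a dvd l" "coprime a N" for a
  proof (rule ccontr)
    assume "a \<noteq> 1"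
    then obtain p where p: "prime p" "p dvd a" by (metis prime_factor_nat)
    have "p \<in> prime_factors l" using p a(1) assms(2) by (auto simp: in_prime_factors_iff intro: dvd_trans)
    then have "p dvd rad l" unfolding rad_def by (intro dvd_prodI) auto
    then have "p dvd \<Prod>(prime_factors N)" using assms(1) unfolding rad_def by (rule dvd_trans)
    then obtain q where "q \<in> prime_factors N" "p dvd q" using p(1) by (auto simp: prime_dvd_prod_iff)
    then have "p dvd N" by (auto simp: in_prime_factors_iff intro: dvd_trans)
    then show False using p a(2) by (metis coprime_common_divisor not_prime_unit)
  qed
  then show ?thesis by (auto simp: hecke_divisors_def)
qed

context eta_hecke
begin

lemma hecke_weight_1: "hecke_weight r N l 1 = 1"
  by (simp add: hecke_weight_def hecke_twist_def eta_twist_def kronecker_1_left)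

lemma eta_coeff_eq:
  assumes "weakly_admissible r N"
  shows "eta_coeff r N l = - of_int (r 1) *
    (\<Sum>a\<in>hecke_divisors N l. hecke_weight r N l (int a) * of_real (real a powr (real_of_int (wt2 r N) / 2 - 1)))"
proof -
  interpret hecke_form "wt2 r N" N l "eta_char r N" "hecke_weight r N l" "on_upper (eta_quotient r N)" "eta_coeff r N"
  proof
    show "on_upper (eta_quotient r N) \<in> Mk (wt2 r N) N (eta_char r N)"
      using assms by (simp add: weakly_admissible_def Let_def)
    show "(\<lambda>n. eta_coeff r N n * ee \<tau> ^ n) sums on_upper (eta_quotient r N) \<tau>" if "\<tau> \<in> upper" for \<tau>
      using eta_coeff_sums[OF N sum0 that] that by (simp add: on_upper_def)
    show "on_upper (eta_quotient r N) \<tau> \<noteq> 0" if "\<tau> \<in> upper" for \<tau>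
      using eta_quotient_nonzero[OF N sum0 that] that by (simp add: on_upper_def)
  qed (rule N l_pos eta_char_root_of_unity hecke_compatible_eta_char)+
  show ?thesis
    using coeff_eq_if_cdim_1[OF cdim_Mk_if_weakly_admissible[OF assms N sum0] eta_coeff_0[OF N sum0] hecke_weight_1]
    unfolding eta_coeff_1[OF N sum0] .
qed

end

theorem theorem9p20:
  fixes r :: "nat \<Rightarrow> int" and N l :: nat
  defines "k \<equiv> real_of_int (wt2 r N) / 2"
  defines "\<delta> \<equiv> delta_of (varpi r N)"
  assumes r0: "r 0 = 0"
    and fin: "finite {n. r n \<noteq> 0}"
    and level: "N = Lcm {n. r n \<noteq> 0}"
    and adm: "weakly_admissible r N"
    and sum0: "(\<Sum>n\<in>{n. n dvd N}. int n * r n) = 0"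
    and lL: "l \<in> L_f r N"
    and sqfree: "\<forall>p. prime p \<longrightarrow> \<not> p dvd N \<longrightarrow> \<not> p ^ 2 dvd l"
    and odd: "odd l \<or> odd N"
  shows "(even l \<and> odd N \<longrightarrow>
            eta_coeff r N l = - of_int (r 1) *
              (\<Sum>a\<in>{a. a dvd l \<and> coprime a N}.
                 of_int (kronecker (int a) (varpi r N)) * of_real (real a powr (k - 1))))
       \<and> (odd l \<longrightarrow>
            eta_coeff r N l = - of_int (r 1) *
              (\<Sum>a\<in>{a. a dvd l \<and> coprime a N}.
                 of_int (kronecker (int a) (varpi r N)) * of_real (real a powr (k - 1)) *
                 ee (of_real ((k + real \<delta>) * (real l - real (l div a)) / 4))))
       \<and> (rad l dvd rad N \<longrightarrow> eta_coeff r N l = - of_int (r 1))"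
proof -
  have "0 \<notin> {n. r n \<noteq> 0}" using r0 by simp
  then have N: "N > 0" using fin level by (simp add: Lcm_0_iff zero_less_iff_neq_zero)
  interpret eta_hecke r N l using N sum0 lL sqfree odd by unfold_locales simp_all
  note coeff = eta_coeff_eq[OF adm, folded k_def]
  have "hecke_weight r N l (int a) = of_int (kronecker (int a) (varpi r N))" if "even l" for a
    using that by (simp add: hecke_weight_def hecke_twist_def)
  moreover have "hecke_weight r N l (int a) * of_real (real a powr (k - 1)) =
      of_int (kronecker (int a) (varpi r N)) * of_real (real a powr (k - 1)) *
      ee (of_real ((k + real \<delta>) * (real l - real (l div a)) / 4))" if "odd l" "a \<in> hecke_divisors N l" for a
    unfolding hecke_weight_def hecke_twist_def k_def \<delta>_def eta_twist_eq_ee_quarter[OF that, symmetric]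
    using that(1) by simp
  moreover have "eta_coeff r N l = - of_int (r 1)" if "rad l dvd rad N"
    unfolding coeff hecke_divisors_if_rad_dvd[OF that l_pos] using hecke_weight_1 by simp
  ultimately show ?thesis
    unfolding coeff hecke_divisors_def[symmetric]
    by (intro conjI impI arg_cong[where f = "\<lambda>x. - of_int (r 1) * x"] sum.cong refl) simp_all
qed

end
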